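(* Let $n\ge 0$ be an integer. There exists a constant $C>0$, independent of $\hbar$, with the following property. Let $\hbar>0$ and let $R=R^*\in\mathcal L^1(L^2(\mathbb R))$ be a self-adjoint trace-class operator with integral kernel $R(X,Y)$, such that $\tilde R(x,y):=R(x+\tfrac\hbar2y,\,x-\tfrac\hbar2y)$ satisfies \[ \partial_y(-i\partial_x)\tilde R(x,y)=\sum_{k=0}^n u_k(x,y)\,y^k \] in the sense of distributions on $\mathbb R\times\mathbb R$, with $u_0,\ldots,u_n\in L^2(\mathbb R\times\mathbb R)$. Then the function $x\mapsto\rho(x):=R(x,x)=\tilde R(x,0)$ belongs to the Sobolev space $H^{\frac1{2(n+1)}}(\mathbb R)$, and \[ \|\rho\|^2_{H^{\frac1{2(n+1)}}(\mathbb R)}\le C\left(\left(\mathrm{tr}_{L^2(\mathbb R)}|R|\right)^2+\|\tilde R\|^2_{L^2(\mathbb R\times\mathbb R)}+\sum_{k=0}^n\|u_k\|^2_{L^2(\mathbb R\times\mathbb R)}\right). \]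
   Context: $\mathcal L^1(L^2(\mathbb R))$ denotes the trace-class operators on $L^2(\mathbb R)$. For such $R$ the integral kernel is chosen so that $z\mapsto(X\mapsto R(X,X+z))$ belongs to $C_b(\mathbb R;L^1(\mathbb R))$; hence the restriction to the diagonal $\rho(x)=R(x,x)$ is a well-defined element of $L^1(\mathbb R)$. (Equivalently, if $R=\sum_j\lambda_j|\psi_j\rangle\langle\psi_j|$ is a spectral decomposition, then $R(X,Y)=\sum_j\lambda_j\psi_j(X)\overline{\psi_j(Y)}$ and $\rho=\sum_j\lambda_j|\psi_j|^2$.) *)

theory Defs
  imports "HOL-Analysis.Analysis"
begin

section \<open>Square-integrable functions\<close>

text \<open>
  Elements of \<open>L\<^sup>2\<close> are represented by Borel functions; everything below is invariant under
  almost-everywhere modification.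
\<close>

definition L2 :: "('a::euclidean_space \<Rightarrow> complex) set" where
  "L2 = {f \<in> borel_measurable borel. integrable lborel (\<lambda>x. (cmod (f x))\<^sup>2)}"

definition L2_inner :: "('a::euclidean_space \<Rightarrow> complex) \<Rightarrow> ('a \<Rightarrow> complex) \<Rightarrow> complex" where
  "L2_inner f g = (\<integral>x. cnj (f x) * g x \<partial>lborel)"

definition L2_norm :: "('a::euclidean_space \<Rightarrow> complex) \<Rightarrow> real" where
  "L2_norm f = sqrt (\<integral>x. (cmod (f x))\<^sup>2 \<partial>lborel)"

definition orthonormal_basis :: "(nat \<Rightarrow> real \<Rightarrow> complex) \<Rightarrow> bool" where
  "orthonormal_basis e \<longleftrightarrow>
     (\<forall>k. e k \<in> L2) \<and>
     (\<forall>j k. L2_inner (e j) (e k) = (if j = k then 1 else 0)) \<and>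
     (\<forall>f\<in>L2. (\<forall>k. L2_inner (e k) f = 0) \<longrightarrow> (AE x in lborel. f x = 0))"

section \<open>Operators on \<open>L\<^sup>2(\<real>)\<close>\<close>

type_synonym L2_op = "(real \<Rightarrow> complex) \<Rightarrow> (real \<Rightarrow> complex)"

text \<open>
  Linearity and boundedness together imply that a bounded operator respects
  almost-everywhere equality, so it descends to the Hilbert space \<open>L\<^sup>2(\<real>)\<close>.
\<close>

definition bounded_operator :: "L2_op \<Rightarrow> bool" where
  "bounded_operator T \<longleftrightarrow>
     (\<forall>f\<in>L2. T f \<in> L2) \<and>
     (\<forall>f\<in>L2. \<forall>g\<in>L2. \<forall>a b. AE x in lborel. T (\<lambda>x. a * f x + b * g x) x = a * T f x + b * T g x) \<and>
     (\<exists>B. \<forall>f\<in>L2. L2_norm (T f) \<le> B * L2_norm f)"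

definition is_adjoint :: "L2_op \<Rightarrow> L2_op \<Rightarrow> bool" where
  "is_adjoint S T \<longleftrightarrow>
     bounded_operator S \<and> (\<forall>f\<in>L2. \<forall>g\<in>L2. L2_inner (S f) g = L2_inner f (T g))"

definition self_adjoint :: "L2_op \<Rightarrow> bool" where
  "self_adjoint T \<longleftrightarrow> is_adjoint T T"

definition positive_operator :: "L2_op \<Rightarrow> bool" where
  "positive_operator P \<longleftrightarrow>
     bounded_operator P \<and> (\<forall>f\<in>L2. L2_inner f (P f) \<in> \<real>\<^sub>\<ge>\<^sub>0)"

text \<open>\<open>P = |T|\<close>, i.e. \<open>P\<close> is the positive square root of \<open>T\<^sup>* T\<close>.\<close>

definition is_operator_abs :: "L2_op \<Rightarrow> L2_op \<Rightarrow> bool" where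
  "is_operator_abs P T \<longleftrightarrow>
     positive_operator P \<and>
     (\<exists>S. is_adjoint S T \<and> (\<forall>f\<in>L2. AE x in lborel. P (P f) x = S (T f) x))"

text \<open>
  The trace, as the value of \<open>\<Sum>\<^sub>k \<langle>e\<^sub>k, T e\<^sub>k\<rangle>\<close> that is common to all orthonormal bases.
\<close>

definition has_trace :: "L2_op \<Rightarrow> complex \<Rightarrow> bool" where
  "has_trace T t \<longleftrightarrow> (\<forall>e. orthonormal_basis e \<longrightarrow> (\<lambda>k. L2_inner (e k) (T (e k))) sums t)"

definition has_trace_norm :: "L2_op \<Rightarrow> real \<Rightarrow> bool" where
  "has_trace_norm T t \<longleftrightarrow> (\<exists>P. is_operator_abs P T \<and> has_trace P (complex_of_real t))"

definition trace_class :: "L2_op \<Rightarrow> bool" where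
  "trace_class T \<longleftrightarrow> bounded_operator T \<and> (\<exists>t. has_trace_norm T t)"

definition trace_norm :: "L2_op \<Rightarrow> real" where
  "trace_norm T = (THE t. has_trace_norm T t)"

section \<open>Integral kernels\<close>

definition is_kernel :: "L2_op \<Rightarrow> (real \<times> real \<Rightarrow> complex) \<Rightarrow> bool" where
  "is_kernel T K \<longleftrightarrow>
     K \<in> L2 \<and> (\<forall>f\<in>L2. AE X in lborel. T f X = (\<integral>Y. K (X, Y) * f Y \<partial>lborel))"

definition Cb_L1 :: "(real \<Rightarrow> real \<Rightarrow> complex) set" where
  "Cb_L1 = {F.
     (\<forall>z. integrable lborel (F z)) \<and>
     (\<exists>B. \<forall>z. (\<integral>x. cmod (F z x) \<partial>lborel) \<le> B) \<and>
     (\<forall>z. ((\<lambda>w. \<integral>x. cmod (F w x - F z x) \<partial>lborel) \<longlongrightarrow> 0) (at z))}"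

text \<open>
  A kernel of an operator is determined only up to null sets of the plane; requiring
  \<open>z \<mapsto> K(\<cdot>, \<cdot> + z)\<close> to be in \<open>C\<^sub>b(\<real>; L\<^sup>1(\<real>))\<close> pins down the restriction to the
  diagonal as an element of \<open>L\<^sup>1(\<real>)\<close>.
\<close>

definition is_continuous_kernel :: "L2_op \<Rightarrow> (real \<times> real \<Rightarrow> complex) \<Rightarrow> bool" where
  "is_continuous_kernel T K \<longleftrightarrow> is_kernel T K \<and> (\<lambda>z X. K (X, X + z)) \<in> Cb_L1"

definition rotated_kernel :: "real \<Rightarrow> (real \<times> real \<Rightarrow> complex) \<Rightarrow> real \<times> real \<Rightarrow> complex" where
  "rotated_kernel h K = (\<lambda>(x, y). K (x + h / 2 * y, x - h / 2 * y))"

section \<open>Distributions\<close>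

definition dir_deriv :: "'a::euclidean_space \<Rightarrow> ('a \<Rightarrow> complex) \<Rightarrow> 'a \<Rightarrow> complex" where
  "dir_deriv v f = (\<lambda>x. frechet_derivative f (at x) v)"

text \<open>
  \<open>C\<^sup>\<infinity>\<close> as the largest class of everywhere Frechet differentiable functions that is closed
  under directional derivatives.
\<close>

coinductive smooth :: "('a::euclidean_space \<Rightarrow> complex) \<Rightarrow> bool" where
  "(\<forall>x. f differentiable (at x)) \<Longrightarrow> (\<forall>v. smooth (dir_deriv v f)) \<Longrightarrow> smooth f"

definition test_functions :: "('a::euclidean_space \<Rightarrow> complex) set" where
  "test_functions = {\<phi>. smooth \<phi> \<and> compact (closure {x. \<phi> x \<noteq> 0})}"

type_synonym 'a distr = "('a \<Rightarrow> complex) \<Rightarrow> complex"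

definition distr_of :: "('a::euclidean_space \<Rightarrow> complex) \<Rightarrow> 'a distr" where
  "distr_of f = (\<lambda>\<phi>. \<integral>x. f x * \<phi> x \<partial>lborel)"

definition distr_deriv :: "'a::euclidean_space \<Rightarrow> 'a distr \<Rightarrow> 'a distr" where
  "distr_deriv v T = (\<lambda>\<phi>. - T (dir_deriv v \<phi>))"

definition distr_scale :: "complex \<Rightarrow> 'a::euclidean_space distr \<Rightarrow> 'a distr" where
  "distr_scale c T = (\<lambda>\<phi>. c * T \<phi>)"

definition distr_eq :: "'a::euclidean_space distr \<Rightarrow> 'a distr \<Rightarrow> bool" where
  "distr_eq S T \<longleftrightarrow> (\<forall>\<phi>\<in>test_functions. S \<phi> = T \<phi>)"

section \<open>Fourier transform and Sobolev spaces on the real line\<close>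

definition fourier_L1 :: "(real \<Rightarrow> complex) \<Rightarrow> real \<Rightarrow> complex" where
  "fourier_L1 f = (\<lambda>\<xi>. complex_of_real (1 / sqrt (2 * pi)) *
                        (\<integral>x. exp (- \<i> * complex_of_real (\<xi> * x)) * f x \<partial>lborel))"

text \<open>The Fourier--Plancherel transform, as the \<open>L\<^sup>2\<close> limit over truncations.\<close>

definition is_fourier_L2 :: "(real \<Rightarrow> complex) \<Rightarrow> (real \<Rightarrow> complex) \<Rightarrow> bool" where
  "is_fourier_L2 f g \<longleftrightarrow>
     g \<in> L2 \<and>
     (\<lambda>N. L2_norm (\<lambda>\<xi>. fourier_L1 (\<lambda>x. indicator {- real N..real N} x * f x) \<xi> - g \<xi>))
       \<longlonglongrightarrow> 0"

text \<open>Unique up to a null set for \<open>f \<in> L2\<close>, which does not affect the integrals below.\<close>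

definition fourier_L2 :: "(real \<Rightarrow> complex) \<Rightarrow> real \<Rightarrow> complex" where
  "fourier_L2 f = (SOME g. is_fourier_L2 f g)"

text \<open>Used for \<open>s \<ge> 0\<close> only, where \<open>H\<^sup>s\<close> consists of \<open>L\<^sup>2\<close> functions.\<close>

definition sobolev_space :: "real \<Rightarrow> (real \<Rightarrow> complex) set" where
  "sobolev_space s =
     {f \<in> L2. integrable lborel (\<lambda>\<xi>. (1 + \<xi>\<^sup>2) powr s * (cmod (fourier_L2 f \<xi>))\<^sup>2)}"

definition sobolev_norm :: "real \<Rightarrow> (real \<Rightarrow> complex) \<Rightarrow> real" where
  "sobolev_norm s f = sqrt (\<integral>\<xi>. (1 + \<xi>\<^sup>2) powr s * (cmod (fourier_L2 f \<xi>))\<^sup>2 \<partial>lborel)"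

end

theory Submission
  imports Defs "HOL-Probability.Probability"
begin

text \<open>
  Write \<open>F(x, y)\<close> for the rotated kernel and \<open>F^(\<xi>, y)\<close> for its Fourier transform in \<open>x\<close>, so that
  \<open>\<rho>^(\<xi>) = F^(\<xi>, 0)\<close>, and let \<open>s = 1 / (2 (n + 1))\<close>. The two ranges of frequencies are treated differently.

  For \<open>|\<xi>| \<ge> 1\<close> the equation says \<open>\<partial>\<^sub>y (\<xi> F^) = \<Sum>\<^sub>k u\<^sub>k^ y\<^sup>k\<close>. The value at \<open>y = 0\<close> is bounded by the value at
  \<open>y\<close> plus the increment, and averaging over \<open>0 < y < \<delta>\<close> with the Cauchy--Schwarz inequality gives
  \<open>|F^(\<xi>, 0)|\<^sup>2 \<le> (2 / \<delta>) \<integral>|F^|\<^sup>2 dy + C \<xi>\<^sup>-\<^sup>2 \<Sum>\<^sub>k \<delta>\<^sup>2\<^sup>k\<^sup>+\<^sup>1 \<integral>|u\<^sub>k^|\<^sup>2 dy\<close>. The choice \<open>\<delta> = |\<xi>|\<^sup>2\<^sup>s\<close> makes every coefficient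
  at most a constant times \<open>|\<xi>|\<^sup>-\<^sup>2\<^sup>s\<close>, and integration in \<open>\<xi>\<close> with Plancherel's inequality bounds
  \<open>\<integral>|\<xi>|\<^sup>2\<^sup>s |\<rho>^|\<^sup>2\<close> over \<open>|\<xi>| \<ge> 1\<close> (lemma \<open>high_frequency_estimate\<close>). Since \<open>u\<^sub>k(\<cdot>, y)\<close> is only square integrable,
  everything is done with a cutoff in \<open>x\<close> at scale \<open>m\<close>, which is removed at the end by Fatou's lemma; the
  pointwise equation for the cut-off transforms is \<open>slice_increment\<close>, obtained from the weak equation by
  testing with products \<open>a(x) b(y)\<close> and letting \<open>b\<close> tend to an indicator function. The continuity of
  \<open>z \<mapsto> K(\<cdot>, \<cdot> + z)\<close> in \<open>L\<^sup>1\<close> is what gives a meaning to the value at \<open>y = 0\<close>.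

  For \<open>|\<xi>| < 1\<close> one uses \<open>|\<integral> \<rho> exp(-i \<xi> x) dx| \<le> tr |R|\<close> (lemma \<open>diagonal_fourier_le_trace_norm\<close>). Averages of the
  kernel over dyadic squares along the diagonal are matrix coefficients \<open>\<langle>g\<^sub>j, R g\<^sub>j\<rangle>\<close> with the members \<open>g\<^sub>j\<close> of a
  Haar basis that are normalized indicator functions, and by \<open>L\<^sup>1\<close> continuity they approximate the integrals
  of \<open>\<rho>\<close> over dyadic intervals. Moreover \<open>\<Sum>\<^sub>j |\<langle>g\<^sub>j, R g\<^sub>j\<rangle>| \<le> tr |R|\<close> because \<open>|\<langle>g, R g\<rangle>| \<le> \<langle>g, |R| g\<rangle>\<close> for self-adjoint \<open>R\<close>.
  This inequality, and the uniqueness of \<open>|R|\<close> on which the trace norm rests, are proved without the spectral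
  theorem, by iteration arguments that work in any inner product space (lemmas \<open>anticommuting_positive\<close>,
  \<open>positive_square_root_unique\<close> and \<open>abs_operator_dominates\<close>).

  Finally \<open>\<rho>^\<close> lies in \<open>L\<^sup>2\<close>, hence so does the integrable function \<open>\<rho>\<close> (lemma \<open>ft_L2_imp_L2\<close>), and its
  Fourier--Plancherel transform agrees with the integral transform.
\<close>

section \<open>Positive square roots in inner product spaces\<close>

text \<open>For \<open>t > 0\<close> this is positivity of \<open>Q\<close> at \<open>x - Q x / t\<close>.\<close>

lemma positive_symmetric_norm_bound:
  fixes Q :: "'a::real_inner \<Rightarrow> 'a"
  assumes Q: "bounded_linear Q" and sym: "\<And>x y. inner (Q x) y = inner x (Q y)"
    and pos: "\<And>x. inner x (Q x) \<ge> 0" and t: "onorm Q \<le> t"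
  shows "(norm (Q x))\<^sup>2 \<le> t * inner x (Q x)"
proof -
  interpret Q: bounded_linear Q by (rule Q)
  have bound: "norm (Q y) \<le> t * norm y" for y
    using onorm[OF Q, of y] t by (meson mult_right_mono norm_ge_zero order_trans)
  have t0: "t \<ge> 0" using onorm_pos_le[OF Q] t by linarith
  have quad: "0 \<le> inner x (Q x) - 2 * s * (norm (Q x))\<^sup>2 + s\<^sup>2 * inner (Q x) (Q (Q x))" for s
  proof -
    have "0 \<le> inner (x - s *\<^sub>R Q x) (Q (x - s *\<^sub>R Q x))" by (rule pos)
    also have "\<dots> = inner x (Q x) - 2 * s * (norm (Q x))\<^sup>2 + s\<^sup>2 * inner (Q x) (Q (Q x))"
      unfolding power2_norm_eq_inner
      by (simp add: Q.diff Q.scaleR inner_diff_left inner_diff_right power2_eq_square sym algebra_simps)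
    finally show ?thesis .
  qed
  have le: "inner (Q x) (Q (Q x)) \<le> t * (norm (Q x))\<^sup>2"
  proof -
    have "inner (Q x) (Q (Q x)) \<le> norm (Q x) * norm (Q (Q x))" by (rule norm_cauchy_schwarz)
    also have "\<dots> \<le> norm (Q x) * (t * norm (Q x))" by (intro mult_left_mono bound) auto
    finally show ?thesis by (simp add: power2_eq_square mult_ac)
  qed
  show ?thesis
  proof (cases "t = 0")
    case True
    then show ?thesis using bound[of x] by simp
  next
    case False
    with t0 have tp: "t > 0" by simp
    have "0 \<le> inner x (Q x) - 2 * (1/t) * (norm (Q x))\<^sup>2 + (1/t)\<^sup>2 * inner (Q x) (Q (Q x))"
      by (rule quad)
    also have "\<dots> \<le> inner x (Q x) - 2 * (1/t) * (norm (Q x))\<^sup>2 + (1/t)\<^sup>2 * (t * (norm (Q x))\<^sup>2)"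
      by (intro add_left_mono mult_left_mono le) auto
    also have "\<dots> = inner x (Q x) - (norm (Q x))\<^sup>2 / t"
      using tp by (simp add: power2_eq_square field_simps)
    finally show ?thesis using tp by (simp add: field_simps)
  qed
qed

lemma positive_kernel:
  fixes Q :: "'a::real_inner \<Rightarrow> 'a"
  assumes Q: "bounded_linear Q" and sym: "\<And>x y. inner (Q x) y = inner x (Q y)"
    and pos: "\<And>x. inner x (Q x) \<ge> 0" and "inner x (Q x) = 0"
  shows "Q x = 0"
  using positive_symmetric_norm_bound[OF Q sym pos order_refl, of x] assms(4) by simp

text \<open>For \<open>t \<ge> \<parallel>Q\<parallel>\<close> the operator \<open>A = 1 - Q / t\<close> is a contraction, and \<open>B = 1 + P / t\<close> satisfies \<open>B X = X A\<close>, so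
  that \<open>B\<^sup>m X f = X A\<^sup>m f\<close> stays bounded. On the other hand \<open>\<parallel>B\<^sup>m g\<parallel>\<^sup>2 \<ge> (2 m / t) \<langle>g, P g\<rangle>\<close>, which forces
  \<open>\<langle>X f, P X f\<rangle> = 0\<close>.\<close>

lemma anticommuting_positive:
  fixes P Q X :: "'a::real_inner \<Rightarrow> 'a"
  assumes P: "bounded_linear P" and symP: "\<And>x y. inner (P x) y = inner x (P y)"
    and posP: "\<And>x. inner x (P x) \<ge> 0"
    and Q: "bounded_linear Q" and symQ: "\<And>x y. inner (Q x) y = inner x (Q y)"
    and posQ: "\<And>x. inner x (Q x) \<ge> 0"
    and X: "bounded_linear X" and anti: "\<And>x. P (X x) = - X (Q x)"
  shows "P (X f) = 0"
proof -
  interpret P: bounded_linear P by (rule P)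
  interpret Q: bounded_linear Q by (rule Q)
  interpret X: bounded_linear X by (rule X)
  define t where "t = onorm Q + 1"
  have t: "t > 0" "onorm Q \<le> t" using onorm_pos_le[OF Q] by (auto simp: t_def)
  define B where "B = (\<lambda>x. x + (1/t) *\<^sub>R P x)"
  define A where "A = (\<lambda>x. x - (1/t) *\<^sub>R Q x)"
  have BX: "B (X x) = X (A x)" for x
    by (simp add: A_def B_def anti X.diff X.scaleR)
  have BXm: "(B ^^ m) (X x) = X ((A ^^ m) x)" for m x
    by (induction m) (auto simp: BX)
  have A1: "norm (A x) \<le> norm x" for x
  proof -
    have "(norm (A x))\<^sup>2 = (norm x)\<^sup>2 - 2 / t * inner x (Q x) + (norm (Q x))\<^sup>2 / t\<^sup>2"
      unfolding A_def power2_norm_eq_inner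
      by (simp add: inner_diff_left inner_diff_right inner_commute[of "Q x" x] power2_eq_square
          diff_divide_distrib)
    also have "\<dots> \<le> (norm x)\<^sup>2 - 2 / t * inner x (Q x) + (t * inner x (Q x)) / t\<^sup>2"
      using positive_symmetric_norm_bound[OF Q symQ posQ t(2), of x] t(1)
      by (intro add_left_mono divide_right_mono) auto
    also have "\<dots> = (norm x)\<^sup>2 - inner x (Q x) / t"
      using t(1) by (simp add: power2_eq_square field_simps)
    also have "\<dots> \<le> (norm x)\<^sup>2" using posQ[of x] t(1) by simp
    finally show ?thesis by (rule power2_le_imp_le) simp
  qed
  have Am: "norm ((A ^^ m) x) \<le> norm x" for m x
    by (induction m) (auto intro: order_trans[OF A1])
  have Binner: "inner (B x) (P (B x)) \<ge> inner x (P x)" for x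
  proof -
    have "inner (B x) (P (B x)) = inner x (P x) + 2 / t * (norm (P x))\<^sup>2 + inner (P x) (P (P x)) / t\<^sup>2"
      unfolding B_def power2_norm_eq_inner
      by (simp add: P.add P.scaleR inner_add_left inner_add_right power2_eq_square symP
          add_divide_distrib)
    then show ?thesis using posP[of "P x"] t(1) by simp
  qed
  have Bnorm: "(norm (B x))\<^sup>2 \<ge> (norm x)\<^sup>2 + 2 / t * inner x (P x)" for x
  proof -
    have "(norm (B x))\<^sup>2 = (norm x)\<^sup>2 + 2 / t * inner x (P x) + (norm (P x))\<^sup>2 / t\<^sup>2"
      unfolding B_def power2_norm_eq_inner
      by (simp add: inner_add_left inner_add_right inner_commute[of "P x" x] power2_eq_square
          add_divide_distrib)
    moreover have "(norm (P x))\<^sup>2 / t\<^sup>2 \<ge> 0" by simp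
    ultimately show ?thesis by linarith
  qed
  have Bminner: "inner ((B ^^ m) x) (P ((B ^^ m) x)) \<ge> inner x (P x)" for m x
  proof (induction m)
    case (Suc m)
    then show ?case using Binner[of "(B ^^ m) x"] by simp
  qed simp
  have Bmnorm: "(norm ((B ^^ m) x))\<^sup>2 \<ge> real m * (2 / t * inner x (P x))" for m x
  proof (induction m)
    case (Suc m)
    have "real (Suc m) * (2 / t * inner x (P x)) = real m * (2 / t * inner x (P x)) + 2 / t * inner x (P x)"
      by (simp add: algebra_simps add_divide_distrib)
    also have "\<dots> \<le> (norm ((B ^^ m) x))\<^sup>2 + 2 / t * inner ((B ^^ m) x) (P ((B ^^ m) x))"
      using Suc Bminner[of x m] t(1) by (intro add_mono mult_left_mono) auto
    also have "\<dots> \<le> (norm ((B ^^ Suc m) x))\<^sup>2" using Bnorm[of "(B ^^ m) x"] by simp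
    finally show ?case .
  qed simp
  define c where "c = 2 / t * inner (X f) (P (X f))"
  have "real m * c \<le> (onorm X * norm f)\<^sup>2" for m
  proof -
    have "real m * c \<le> (norm ((B ^^ m) (X f)))\<^sup>2" unfolding c_def by (rule Bmnorm)
    also have "\<dots> = (norm (X ((A ^^ m) f)))\<^sup>2" by (simp add: BXm)
    also have "\<dots> \<le> (onorm X * norm f)\<^sup>2"
      by (intro power_mono order_trans[OF onorm[OF X]] mult_left_mono Am onorm_pos_le[OF X]) auto
    finally show ?thesis .
  qed
  then have "c \<le> 0"
    by (metis reals_Archimedean3 not_le)
  then have "inner (X f) (P (X f)) = 0" using posP[of "X f"] t(1)
    by (simp add: c_def mult_le_0_iff divide_le_0_iff)
  then show ?thesis by (rule positive_kernel[OF P symP posP])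
qed

text \<open>The difference \<open>X = P - Q\<close> satisfies \<open>P X = - X Q\<close> and \<open>Q X = - X P\<close>.\<close>

lemma positive_square_root_unique:
  fixes P Q :: "'a::real_inner \<Rightarrow> 'a"
  assumes P: "bounded_linear P" and symP: "\<And>x y. inner (P x) y = inner x (P y)"
    and posP: "\<And>x. inner x (P x) \<ge> 0"
    and Q: "bounded_linear Q" and symQ: "\<And>x y. inner (Q x) y = inner x (Q y)"
    and posQ: "\<And>x. inner x (Q x) \<ge> 0"
    and eq: "\<And>x. P (P x) = Q (Q x)"
  shows "P f = Q f"
proof -
  interpret P: bounded_linear P by (rule P)
  interpret Q: bounded_linear Q by (rule Q)
  have X: "bounded_linear (\<lambda>x. P x - Q x)" using P Q by (rule bounded_linear_sub)
  have a: "P (P x - Q x) = - (P (Q x) - Q (Q x))" for x by (simp add: P.diff eq)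
  have b: "Q (P x - Q x) = - (P (P x) - Q (P x))" for x by (simp add: Q.diff eq)
  have "P (P f - Q f) = 0" by (rule anticommuting_positive[OF P symP posP Q symQ posQ X a])
  moreover have "Q (P f - Q f) = 0"
    by (rule anticommuting_positive[OF Q symQ posQ P symP posP X b])
  ultimately have "inner (P f - Q f) (P f - Q f) = 0"
    by (metis inner_diff_left inner_zero_right diff_self symP symQ)
  then show ?thesis by simp
qed

text \<open>The commutator \<open>C = P R - R P\<close> satisfies \<open>P C = - C P\<close>.\<close>

lemma positive_square_root_commutes:
  fixes P R :: "'a::real_inner \<Rightarrow> 'a"
  assumes P: "bounded_linear P" and symP: "\<And>x y. inner (P x) y = inner x (P y)"
    and posP: "\<And>x. inner x (P x) \<ge> 0"
    and R: "bounded_linear R" and symR: "\<And>x y. inner (R x) y = inner x (R y)"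
    and eq: "\<And>x. P (P x) = R (R x)"
  shows "P (R f) = R (P f)"
proof -
  interpret P: bounded_linear P by (rule P)
  interpret R: bounded_linear R by (rule R)
  define C where "C = (\<lambda>x. P (R x) - R (P x))"
  have C: "bounded_linear C"
    unfolding C_def by (intro bounded_linear_sub bounded_linear_compose[OF P R] bounded_linear_compose[OF R P])
  have a: "P (C x) = - C (P x)" for x by (simp add: C_def P.diff eq)
  have PC: "P (C f) = 0"
    by (rule anticommuting_positive[OF P symP posP P symP posP C a])
  have "inner (R (C f)) (R (C f)) = inner (P (C f)) (P (C f))"
    by (simp add: symR symP eq)
  then have RC: "R (C f) = 0" using PC by simp
  have "inner (C f) (C f) = inner (P (R f)) (C f) - inner (R (P f)) (C f)"
    unfolding C_def[of ] by (simp add: inner_diff_left)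
  also have "\<dots> = 0" by (simp add: symP symR PC RC)
  finally show ?thesis by (simp add: C_def)
qed

text \<open>The iteration \<open>f \<mapsto> f - A (A f) / a\<^sup>2\<close> with \<open>a > \<parallel>A\<parallel>\<close> makes \<open>A f\<close> tend to \<open>0\<close> and only subtracts elements of the
  range of \<open>A\<close>. It replaces the orthogonal projection onto the kernel, which needs completeness.\<close>

lemma nonneg_on_range_imp_nonneg:
  fixes A :: "'a::real_inner \<Rightarrow> 'a"
  assumes A: "bounded_linear A" and sym: "\<And>x y. inner (A x) y = inner x (A y)"
    and pos: "\<And>x. inner (A x) (A (A x)) \<ge> 0"
  shows "inner f (A f) \<ge> 0"
proof -
  interpret A: bounded_linear A by (rule A)
  define a where "a = onorm A + 1"
  have a: "a > 0" "\<And>x. norm (A x) \<le> a * norm x"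
    using onorm_pos_le[OF A] onorm[OF A]
    by (auto simp: a_def algebra_simps intro: add_increasing)
  define S where "S = (\<lambda>x. x - (1 / a\<^sup>2) *\<^sub>R A (A x))"
  have S: "(norm (S x))\<^sup>2 \<le> (norm x)\<^sup>2 - (1 / a\<^sup>2) * (norm (A x))\<^sup>2" for x
  proof -
    have "(norm (S x))\<^sup>2 = (norm x)\<^sup>2 - 2 / a\<^sup>2 * (norm (A x))\<^sup>2 + (norm (A (A x)))\<^sup>2 / (a\<^sup>2)\<^sup>2"
      unfolding S_def power2_norm_eq_inner
      by (simp add: inner_diff_left inner_diff_right inner_commute[of "A (A x)" x] power2_eq_square sym
          diff_divide_distrib)
    also have "\<dots> \<le> (norm x)\<^sup>2 - 2 / a\<^sup>2 * (norm (A x))\<^sup>2 + (a * norm (A x))\<^sup>2 / (a\<^sup>2)\<^sup>2"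
      by (intro add_left_mono divide_right_mono power_mono a) auto
    also have "\<dots> = (norm x)\<^sup>2 - (1 / a\<^sup>2) * (norm (A x))\<^sup>2"
      using a(1) by (simp add: power2_eq_square field_simps)
    finally show ?thesis .
  qed
  define g where "g = (\<lambda>m. (S ^^ m) f)"
  have tel: "(norm (g m))\<^sup>2 + (1 / a\<^sup>2) * (\<Sum>i<m. (norm (A (g i)))\<^sup>2) \<le> (norm f)\<^sup>2" for m
  proof (induction m)
    case (Suc m)
    then show ?case using S[of "g m"] by (simp add: g_def algebra_simps)
  qed (simp add: g_def)
  have gle: "norm (g m) \<le> norm f" for m
  proof -
    have "(norm (g m))\<^sup>2 \<le> (norm f)\<^sup>2"
      using tel[of m] a(1) by (smt (verit) divide_nonneg_pos mult_nonneg_nonneg sum_nonneg zero_le_power2 zero_less_power)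
    then show ?thesis by (rule power2_le_imp_le) simp
  qed
  have "summable (\<lambda>i. (norm (A (g i)))\<^sup>2)"
  proof (rule summableI_nonneg_bounded[where x="a\<^sup>2 * (norm f)\<^sup>2"])
    fix m
    have "(1 / a\<^sup>2) * (\<Sum>i<m. (norm (A (g i)))\<^sup>2) \<le> (norm f)\<^sup>2"
      using tel[of m] by (smt (verit) zero_le_power2)
    then show "(\<Sum>i<m. (norm (A (g i)))\<^sup>2) \<le> a\<^sup>2 * (norm f)\<^sup>2" using a(1) by (simp add: field_simps)
  qed auto
  then have "(\<lambda>i. sqrt ((norm (A (g i)))\<^sup>2)) \<longlonglongrightarrow> sqrt 0"
    by (intro tendsto_real_sqrt summable_LIMSEQ_zero)
  then have lim: "(\<lambda>i. norm (A (g i))) \<longlonglongrightarrow> 0" by simp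
  have rng: "\<exists>k. f = g m + A k" for m
  proof (induction m)
    case 0
    have "f = g 0 + A 0" by (simp add: g_def A.zero)
    then show ?case by blast
  next
    case (Suc m)
    then obtain k where k: "f = g m + A k" by blast
    have "g m = g (Suc m) + A ((1 / a\<^sup>2) *\<^sub>R A (g m))" by (simp add: g_def S_def A.scaleR)
    with k have "f = g (Suc m) + A ((1 / a\<^sup>2) *\<^sub>R A (g m) + k)" by (simp add: A.add)
    then show ?case by blast
  qed
  have low: "- (5 * norm f * norm (A (g m))) \<le> inner f (A f)" for m
  proof -
    obtain k where k: "f = g m + A k" using rng by blast
    have nk: "norm (A k) \<le> 2 * norm f"
      using norm_triangle_ineq4[of f "g m"] gle[of m] k by (metis add_diff_cancel_left' mult_2 order_trans add_left_mono)
    have "inner f (A f) = inner (g m) (A (g m)) + 2 * inner (A k) (A (g m)) + inner (A k) (A (A k))"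
    proof -
      have "inner (g m) (A (A k)) = inner (A k) (A (g m))" by (metis sym inner_commute)
      then show ?thesis by (subst (1 2) k) (simp add: A.add inner_add_left inner_add_right)
    qed
    moreover have "\<bar>inner (g m) (A (g m))\<bar> \<le> norm f * norm (A (g m))"
      by (rule order_trans[OF Cauchy_Schwarz_ineq2]) (intro mult_right_mono gle norm_ge_zero)
    moreover have "\<bar>inner (A k) (A (g m))\<bar> \<le> 2 * norm f * norm (A (g m))"
      by (rule order_trans[OF Cauchy_Schwarz_ineq2]) (intro mult_right_mono nk norm_ge_zero)
    ultimately show ?thesis using pos[of k] by linarith
  qed
  have "(\<lambda>m. - (5 * norm f * norm (A (g m)))) \<longlonglongrightarrow> - (5 * norm f * 0)"
    by (intro tendsto_intros lim)
  then have "(\<lambda>m. - (5 * norm f * norm (A (g m)))) \<longlonglongrightarrow> 0" by simp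
  from LIMSEQ_le_const2[OF this] show ?thesis using low by blast
qed

text \<open>\<open>A = P - R\<close> and \<open>B = P + R\<close> satisfy \<open>A B = 0\<close> once \<open>P\<close> and \<open>R\<close> commute, so that
  \<open>A\<^sup>3 = A (A + B) A = 2 A P A\<close> is positive.\<close>

lemma abs_operator_dominates:
  fixes P R :: "'a::real_inner \<Rightarrow> 'a"
  assumes P: "bounded_linear P" and symP: "\<And>x y. inner (P x) y = inner x (P y)"
    and posP: "\<And>x. inner x (P x) \<ge> 0"
    and R: "bounded_linear R" and symR: "\<And>x y. inner (R x) y = inner x (R y)"
    and eq: "\<And>x. P (P x) = R (R x)"
  shows "\<bar>inner f (R f)\<bar> \<le> inner f (P f)"
proof -
  have *: "inner f (R f) \<le> inner f (P f)"
    if R: "bounded_linear R" and symR: "\<And>x y. inner (R x) y = inner x (R y)"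
    and eq: "\<And>x. P (P x) = R (R x)" for R
  proof -
    interpret P: bounded_linear P by (rule P)
    interpret R: bounded_linear R by (rule R)
    have comm: "P (R x) = R (P x)" for x
      by (rule positive_square_root_commutes[OF P symP posP R symR eq])
    have "inner f (P f - R f) \<ge> 0"
    proof (rule nonneg_on_range_imp_nonneg)
      show "bounded_linear (\<lambda>x. P x - R x)" using P R by (rule bounded_linear_sub)
      show "inner (P x - R x) y = inner x (P y - R y)" for x y
        by (simp add: inner_diff_left inner_diff_right symP symR)
      fix x
      define g where "g = P x - R x"
      have "P g + R g = 0" by (simp add: g_def P.diff R.diff eq comm)
      then have "P g - R g = 2 *\<^sub>R P g" by (simp add: scaleR_2 eq_neg_iff_add_eq_0[symmetric])
      then have "inner g (P g - R g) = 2 * inner g (P g)" by simp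
      then show "inner (P x - R x) (P (P x - R x) - R (P x - R x)) \<ge> 0"
        using posP[of g] by (simp add: g_def)
    qed
    then show ?thesis by (simp add: inner_diff_right)
  qed
  have "inner f (- R f) \<le> inner f (P f)"
    by (rule *) (auto simp: R bounded_linear_minus symR eq bounded_linear.linear[OF R] linear_neg)
  with *[OF R symR eq] show ?thesis by (simp add: inner_minus_right)
qed

section \<open>The Hilbert space \<open>L\<^sup>2\<close> as a quotient\<close>

lemma cnj_borel_measurable [measurable]:
  "f \<in> borel_measurable M \<Longrightarrow> (\<lambda>x. cnj (f x)) \<in> borel_measurable M"
  by (rule borel_measurable_continuous_on[of cnj]) (auto intro: continuous_intros)

lemma L2_measurable: "f \<in> L2 \<Longrightarrow> f \<in> borel_measurable borel"
  by (simp add: L2_def)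

lemma L2_integrable: "f \<in> L2 \<Longrightarrow> integrable lborel (\<lambda>x. (cmod (f x))\<^sup>2)"
  by (simp add: L2_def)

lemma L2_product_integrable:
  assumes "f \<in> L2" "g \<in> L2"
  shows "integrable lborel (\<lambda>x. cnj (f x) * g x)"
proof -
  note [measurable] = assms[THEN L2_measurable]
  have "cmod (cnj (f x) * g x) \<le> norm ((cmod (f x))\<^sup>2 + (cmod (g x))\<^sup>2)" for x
  proof -
    have "0 \<le> cmod (f x) * cmod (g x)" by simp
    then have "cmod (f x) * cmod (g x) \<le> (cmod (f x))\<^sup>2 + (cmod (g x))\<^sup>2"
      using sum_squares_bound[of "cmod (f x)" "cmod (g x)"] by linarith
    then show ?thesis by (simp add: norm_mult)
  qed
  then show ?thesis
    by (intro Bochner_Integration.integrable_bound[OF Bochner_Integration.integrable_add[OF assms[THEN L2_integrable]]]) auto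
qed

lemma L2_lincomb:
  assumes "f \<in> L2" "g \<in> L2"
  shows "(\<lambda>x. a * f x + b * g x) \<in> L2"
proof -
  note [measurable] = L2_measurable[OF assms(1)] L2_measurable[OF assms(2)]
  have "integrable lborel (\<lambda>x. (cmod (a * f x + b * g x))\<^sup>2)"
  proof (rule Bochner_Integration.integrable_bound)
    show "integrable lborel (\<lambda>x. 2 * (cmod a)\<^sup>2 * (cmod (f x))\<^sup>2 + 2 * (cmod b)\<^sup>2 * (cmod (g x))\<^sup>2)"
      using assms by (intro Bochner_Integration.integrable_add integrable_mult_right L2_integrable)
    have "(cmod (a * f x + b * g x))\<^sup>2 \<le> 2 * (cmod a)\<^sup>2 * (cmod (f x))\<^sup>2 + 2 * (cmod b)\<^sup>2 * (cmod (g x))\<^sup>2" for x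
    proof -
      have "(cmod (a * f x + b * g x))\<^sup>2 \<le> (cmod (a * f x) + cmod (b * g x))\<^sup>2"
        by (intro power_mono norm_triangle_ineq) auto
      also have "\<dots> \<le> 2 * (cmod (a * f x))\<^sup>2 + 2 * (cmod (b * g x))\<^sup>2"
        using sum_squares_bound[of "cmod (a * f x)" "cmod (b * g x)"] by (simp add: power2_sum)
      finally show ?thesis by (simp add: norm_mult power_mult_distrib mult_ac)
    qed
    then show "AE x in lborel. norm ((cmod (a * f x + b * g x))\<^sup>2) \<le>
        norm (2 * (cmod a)\<^sup>2 * (cmod (f x))\<^sup>2 + 2 * (cmod b)\<^sup>2 * (cmod (g x))\<^sup>2)" by simp
  qed measurable
  then show ?thesis by (simp add: L2_def)
qed

lemma L2_add: "f \<in> L2 \<Longrightarrow> g \<in> L2 \<Longrightarrow> (\<lambda>x. f x + g x) \<in> L2"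
  using L2_lincomb[of f g 1 1] by simp

lemma L2_diff: "f \<in> L2 \<Longrightarrow> g \<in> L2 \<Longrightarrow> (\<lambda>x. f x - g x) \<in> L2"
  using L2_lincomb[of f g 1 "-1"] by simp

lemma L2_scale: "f \<in> L2 \<Longrightarrow> (\<lambda>x. a * f x) \<in> L2"
  using L2_lincomb[of f f a 0] by simp

lemma L2_zero: "(\<lambda>x. 0) \<in> L2"
  by (simp add: L2_def)

lemma L2_inner_lincomb_right:
  assumes "f \<in> L2" "g \<in> L2" "k \<in> L2"
  shows "L2_inner k (\<lambda>x. a * f x + b * g x) = a * L2_inner k f + b * L2_inner k g"
proof -
  have "L2_inner k (\<lambda>x. a * f x + b * g x) = (\<integral>x. a * (cnj (k x) * f x) + b * (cnj (k x) * g x) \<partial>lborel)"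
    unfolding L2_inner_def by (rule Bochner_Integration.integral_cong) (auto simp: algebra_simps)
  also have "\<dots> = a * L2_inner k f + b * L2_inner k g"
    unfolding L2_inner_def using L2_product_integrable[OF assms(3,1)] L2_product_integrable[OF assms(3,2)]
    by simp
  finally show ?thesis .
qed

lemma L2_inner_commute: "L2_inner f g = cnj (L2_inner g f)"
proof -
  have "cnj (L2_inner g f) = (\<integral>x. cnj (cnj (g x) * f x) \<partial>lborel)"
    unfolding L2_inner_def by (rule Bochner_Integration.integral_cnj[symmetric])
  also have "(\<lambda>x. cnj (cnj (g x) * f x)) = (\<lambda>x. cnj (f x) * g x)" by (auto simp: mult.commute)
  finally show ?thesis by (simp add: L2_inner_def)
qed

lemma L2_inner_lincomb_left:
  assumes "f \<in> L2" "g \<in> L2" "k \<in> L2"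
  shows "L2_inner (\<lambda>x. a * f x + b * g x) k = cnj a * L2_inner f k + cnj b * L2_inner g k"
proof -
  have "L2_inner (\<lambda>x. a * f x + b * g x) k = cnj (L2_inner k (\<lambda>x. a * f x + b * g x))"
    by (rule L2_inner_commute)
  also have "\<dots> = cnj a * cnj (L2_inner k f) + cnj b * cnj (L2_inner k g)"
    by (simp add: L2_inner_lincomb_right[OF assms])
  finally show ?thesis by (simp only: L2_inner_commute[symmetric])
qed

lemma Re_L2_inner_commute: "Re (L2_inner f g) = Re (L2_inner g f)"
  using arg_cong[OF L2_inner_commute[of f g], of Re] by (simp only: cnj.sel)

lemma L2_inner_cong_AE:
  assumes "f \<in> L2" "f' \<in> L2" "g \<in> L2" "g' \<in> L2"
  assumes "AE x in lborel. f x = f' x" "AE x in lborel. g x = g' x"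
  shows "L2_inner f g = L2_inner f' g'"
proof -
  note [measurable] = assms(1-4)[THEN L2_measurable]
  show ?thesis unfolding L2_inner_def
  proof (rule integral_cong_AE)
    show "AE x in lborel. cnj (f x) * g x = cnj (f' x) * g' x"
      using assms(5,6) by eventually_elim simp
  qed measurable
qed

lemma L2_inner_self: "L2_inner f f = complex_of_real (\<integral>x. (cmod (f x))\<^sup>2 \<partial>lborel)"
proof -
  have "(\<lambda>x. cnj (f x) * f x) = (\<lambda>x. complex_of_real ((cmod (f x))\<^sup>2))"
    by (rule ext) (simp only: complex_norm_square mult.commute)
  then show ?thesis by (simp only: L2_inner_def integral_complex_of_real)
qed

text \<open>Almost everywhere equality, as a partial equivalence relation on functions: its domain is \<open>L\<^sup>2\<close>.\<close>

definition L2_rel :: "(real \<Rightarrow> complex) \<Rightarrow> (real \<Rightarrow> complex) \<Rightarrow> bool" where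
  "L2_rel f g \<longleftrightarrow> f \<in> L2 \<and> g \<in> L2 \<and> (AE x in lborel. f x = g x)"

text \<open>The space \<open>L\<^sup>2(\<real>)\<close> as a real inner product space, with the real part of the complex inner product.
  Only real scalars are needed: complex self-adjointness and positivity imply their real counterparts.\<close>

quotient_type l2 = "real \<Rightarrow> complex" / partial: L2_rel
proof (rule part_equivpI)
  show "\<exists>x. L2_rel x x" using L2_zero by (auto simp: L2_rel_def)
  show "symp L2_rel" by (auto simp: symp_def L2_rel_def elim: eventually_mono)
  show "transp L2_rel"
  proof (rule transpI)
    fix f g h assume "L2_rel f g" "L2_rel g h"
    then have "AE x in lborel. f x = g x" "AE x in lborel. g x = h x" "f \<in> L2" "h \<in> L2"
      by (auto simp: L2_rel_def)
    moreover from this(1,2) have "AE x in lborel. f x = h x" by eventually_elim simp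
    ultimately show "L2_rel f h" by (simp add: L2_rel_def)
  qed
qed

instantiation l2 :: real_inner
begin

lift_definition zero_l2 :: l2 is "\<lambda>x. 0" by (simp add: L2_rel_def L2_zero)
lift_definition plus_l2 :: "l2 \<Rightarrow> l2 \<Rightarrow> l2" is "\<lambda>f g x. f x + g x"
  unfolding L2_rel_def by (auto intro!: L2_add)
lift_definition minus_l2 :: "l2 \<Rightarrow> l2 \<Rightarrow> l2" is "\<lambda>f g x. f x - g x"
  unfolding L2_rel_def by (auto intro!: L2_diff)
lift_definition uminus_l2 :: "l2 \<Rightarrow> l2" is "\<lambda>f x. - f x"
  unfolding L2_rel_def using L2_scale[where a="-1"] by auto
lift_definition scaleR_l2 :: "real \<Rightarrow> l2 \<Rightarrow> l2" is "\<lambda>r f x. complex_of_real r * f x"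
  unfolding L2_rel_def by (auto intro!: L2_scale)
lift_definition inner_l2 :: "l2 \<Rightarrow> l2 \<Rightarrow> real" is "\<lambda>f g. Re (L2_inner f g)"
  unfolding L2_rel_def by (auto intro!: arg_cong[where f=Re] L2_inner_cong_AE)
definition norm_l2 :: "l2 \<Rightarrow> real" where "norm_l2 = (\<lambda>x::l2. sqrt (inner x x))"
definition sgn_l2 :: "l2 \<Rightarrow> l2" where "sgn_l2 = (\<lambda>x::l2. scaleR (inverse (norm x)) x)"
definition dist_l2 :: "l2 \<Rightarrow> l2 \<Rightarrow> real" where "dist_l2 = (\<lambda>(x::l2) y. norm (x - y))"
definition uniformity_l2 :: "(l2 \<times> l2) filter" where
  "uniformity_l2 = (INF e\<in>{0 <..}. principal {(x, y). dist x y < e})"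
definition open_l2 :: "l2 set \<Rightarrow> bool" where
  "open_l2 U \<longleftrightarrow> (\<forall>x\<in>U. eventually (\<lambda>(x', y). x' = x \<longrightarrow> y \<in> U) uniformity)"

instance
proof
  fix x y z :: l2 and a b :: real
  show "x + y + z = x + (y + z)"
    by transfer (auto simp: L2_rel_def add_ac intro!: L2_add)
  show "x + y = y + x"
    by transfer (auto simp: L2_rel_def add_ac intro!: L2_add)
  show "0 + x = x"
    by transfer (auto simp: L2_rel_def)
  show "- x + x = 0"
    by transfer (auto simp: L2_rel_def L2_zero)
  show "x - y = x + - y"
    by transfer (auto simp: L2_rel_def intro: L2_diff)
  show "a *\<^sub>R (x + y) = a *\<^sub>R x + a *\<^sub>R y"
    by transfer (auto simp: L2_rel_def distrib_left distrib_right intro!: L2_add L2_scale)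
  show "(a + b) *\<^sub>R x = a *\<^sub>R x + b *\<^sub>R x"
    by transfer (auto simp: L2_rel_def distrib_left distrib_right intro!: L2_add L2_scale)
  show "a *\<^sub>R b *\<^sub>R x = (a * b) *\<^sub>R x"
    by transfer (auto simp: L2_rel_def mult.assoc intro!: L2_scale)
  show "1 *\<^sub>R x = x"
    by transfer (auto simp: L2_rel_def)
  show "inner x y = inner y x"
    by transfer (rule Re_L2_inner_commute)
  show "inner (x + y) z = inner x z + inner y z"
  proof transfer
    fix x y z assume "L2_rel x x" "L2_rel y y" "L2_rel z z"
    then have "x \<in> L2" "y \<in> L2" "z \<in> L2" by (auto simp: L2_rel_def)
    from L2_inner_lincomb_right[OF this, of 1 1]
    show "Re (L2_inner (\<lambda>a. x a + y a) z) = Re (L2_inner x z) + Re (L2_inner y z)"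
      by (simp add: Re_L2_inner_commute[of _ z])
  qed
  show "inner (a *\<^sub>R x) y = a * inner x y"
  proof transfer
    fix a x y assume "L2_rel x x" "L2_rel y y"
    then have "x \<in> L2" "y \<in> L2" by (auto simp: L2_rel_def)
    from L2_inner_lincomb_right[OF this(1,1,2), of "complex_of_real a" 0]
    show "Re (L2_inner (\<lambda>t. complex_of_real a * x t) y) = a * Re (L2_inner x y)"
      by (simp add: Re_L2_inner_commute[of _ y])
  qed
  show "0 \<le> inner x x"
    by transfer (auto simp: L2_rel_def L2_inner_self)
  show "inner x x = 0 \<longleftrightarrow> x = 0"
  proof transfer
    fix f assume "L2_rel f f"
    then have f: "f \<in> L2" by (auto simp: L2_rel_def)
    then show "Re (L2_inner f f) = 0 \<longleftrightarrow> L2_rel f (\<lambda>x. 0)"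
      using integral_nonneg_eq_0_iff_AE[OF L2_integrable[OF f]]
      by (simp add: L2_inner_self L2_rel_def L2_zero)
  qed
qed (simp_all add: norm_l2_def sgn_l2_def dist_l2_def uniformity_l2_def open_l2_def)

end

lemma rep_l2_L2: "rep_l2 x \<in> L2"
  using Quotient_rep_reflp[OF Quotient_l2, of x] by (simp add: L2_rel_def)

lemma abs_rep_l2: "abs_l2 (rep_l2 x) = x"
  by (rule Quotient_abs_rep[OF Quotient_l2])

lemma abs_l2_eq_iff:
  assumes "f \<in> L2" "g \<in> L2"
  shows "abs_l2 f = abs_l2 g \<longleftrightarrow> (AE x in lborel. f x = g x)"
proof -
  have "L2_rel f f" "L2_rel g g" using assms by (auto simp: L2_rel_def)
  then show ?thesis using Quotient_rel[OF Quotient_l2, of f g] assms by (auto simp: L2_rel_def)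
qed

lemma inner_abs_l2: "f \<in> L2 \<Longrightarrow> g \<in> L2 \<Longrightarrow> inner (abs_l2 f) (abs_l2 g) = Re (L2_inner f g)"
  by (rule inner_l2.abs_eq) (auto simp: L2_rel_def)

lemma plus_abs_l2: "f \<in> L2 \<Longrightarrow> g \<in> L2 \<Longrightarrow> abs_l2 f + abs_l2 g = abs_l2 (\<lambda>x. f x + g x)"
  by (rule plus_l2.abs_eq) (auto simp: L2_rel_def)

lemma scaleR_abs_l2: "f \<in> L2 \<Longrightarrow> a *\<^sub>R abs_l2 f = abs_l2 (\<lambda>x. complex_of_real a * f x)"
  by (rule scaleR_l2.abs_eq) (auto simp: L2_rel_def)

lemma norm_abs_l2: "f \<in> L2 \<Longrightarrow> norm (abs_l2 f) = L2_norm f"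
  by (simp add: norm_eq_sqrt_inner inner_abs_l2 L2_inner_self L2_norm_def)

text \<open>The operator induced on the quotient; it does not depend on representatives when \<open>T\<close> is bounded
  (lemma \<open>lift_op_abs\<close>).\<close>

definition lift_op :: "L2_op \<Rightarrow> l2 \<Rightarrow> l2" where
  "lift_op T x = abs_l2 (T (rep_l2 x))"

lemma bounded_operator_L2: "bounded_operator T \<Longrightarrow> f \<in> L2 \<Longrightarrow> T f \<in> L2"
  by (simp add: bounded_operator_def)

lemma bounded_operator_cong_AE:
  assumes T: "bounded_operator T" and f: "f \<in> L2" and g: "g \<in> L2"
    and eq: "AE x in lborel. f x = g x"
  shows "AE x in lborel. T f x = T g x"
proof -
  obtain B where B: "\<And>f. f \<in> L2 \<Longrightarrow> L2_norm (T f) \<le> B * L2_norm f"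
    using T unfolding bounded_operator_def by blast
  let ?d = "\<lambda>x. 1 * f x + (-1) * g x"
  have d: "?d \<in> L2" by (rule L2_lincomb[OF f g])
  have "L2_norm ?d = 0"
  proof -
    note [measurable] = L2_measurable[OF f] L2_measurable[OF g]
    have "(\<integral>x. (cmod (?d x))\<^sup>2 \<partial>lborel) = (\<integral>x. 0 \<partial>(lborel :: real measure))"
    proof (rule integral_cong_AE)
      show "AE x in lborel. (cmod (?d x))\<^sup>2 = 0" using eq by eventually_elim simp
    qed measurable
    then show ?thesis by (simp add: L2_norm_def)
  qed
  with B[OF d] have "L2_norm (T ?d) \<le> 0" by simp
  then have "norm (abs_l2 (T ?d)) = 0"
    using norm_abs_l2[OF bounded_operator_L2[OF T d]] norm_ge_zero[of "abs_l2 (T ?d)"] by linarith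
  then have "abs_l2 (T ?d) = abs_l2 (\<lambda>x. 0)" by (simp add: zero_l2_def[symmetric])
  then have "AE x in lborel. T ?d x = 0"
    using abs_l2_eq_iff[OF bounded_operator_L2[OF T d] L2_zero] by simp
  moreover have "AE x in lborel. T ?d x = 1 * T f x + (-1) * T g x"
    using T f g unfolding bounded_operator_def by blast
  ultimately show ?thesis by eventually_elim simp
qed

lemma lift_op_abs:
  assumes "bounded_operator T" "f \<in> L2"
  shows "lift_op T (abs_l2 f) = abs_l2 (T f)"
proof -
  have "AE x in lborel. rep_l2 (abs_l2 f) x = f x"
    using abs_l2_eq_iff[OF rep_l2_L2 assms(2), of "abs_l2 f"] by (simp add: abs_rep_l2)
  then have "AE x in lborel. T (rep_l2 (abs_l2 f)) x = T f x"
    by (rule bounded_operator_cong_AE[OF assms(1) rep_l2_L2 assms(2)])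
  then show ?thesis unfolding lift_op_def
    by (subst abs_l2_eq_iff) (auto intro: bounded_operator_L2 assms rep_l2_L2)
qed

lemma l2_cases: "\<exists>f. f \<in> L2 \<and> x = abs_l2 f"
  by (rule exI[of _ "rep_l2 x"]) (simp add: rep_l2_L2 abs_rep_l2)

lemma bounded_linear_lift_op:
  assumes T: "bounded_operator T"
  shows "bounded_linear (lift_op T)"
proof -
  obtain B where B: "\<And>f. f \<in> L2 \<Longrightarrow> L2_norm (T f) \<le> B * L2_norm f"
    using T unfolding bounded_operator_def by blast
  have lin: "AE x in lborel. T (\<lambda>x. a * f x + b * g x) x = a * T f x + b * T g x"
    if "f \<in> L2" "g \<in> L2" for f g a b
    using T that unfolding bounded_operator_def by blast
  note TL = bounded_operator_L2[OF T]
  show ?thesis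
  proof (rule bounded_linear_intro[where K=B])
    fix x y :: l2 and r :: real
    obtain f g where f: "f \<in> L2" "x = abs_l2 f" and g: "g \<in> L2" "y = abs_l2 g"
      by (metis l2_cases)
    have "abs_l2 (T (\<lambda>x. f x + g x)) = abs_l2 (\<lambda>x. T f x + T g x)"
      using lin[OF f(1) g(1), of 1 1]
      by (subst abs_l2_eq_iff) (auto intro!: TL L2_add f g)
    then show "lift_op T (x + y) = lift_op T x + lift_op T y"
      by (simp add: f g plus_abs_l2 lift_op_abs T TL L2_add)
    have "abs_l2 (T (\<lambda>x. complex_of_real r * f x)) = abs_l2 (\<lambda>x. complex_of_real r * T f x)"
      using lin[OF f(1) f(1), of "complex_of_real r" 0]
      by (subst abs_l2_eq_iff) (auto intro!: TL L2_scale f)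
    then show "lift_op T (r *\<^sub>R x) = r *\<^sub>R lift_op T x"
      by (simp add: f scaleR_abs_l2 lift_op_abs T TL L2_scale)
    show "norm (lift_op T x) \<le> norm x * B"
      using B[OF f(1)] by (simp add: f lift_op_abs T norm_abs_l2 TL mult.commute)
  qed
qed

text \<open>A complex sesquilinear form with real diagonal values is symmetric, by polarization.\<close>

lemma positive_operator_symmetric:
  assumes P: "positive_operator P" and f: "f \<in> L2" and g: "g \<in> L2"
  shows "Re (L2_inner f (P g)) = Re (L2_inner g (P f))"
proof -
  have b: "bounded_operator P" using P by (simp add: positive_operator_def)
  note PL = bounded_operator_L2[OF b]
  have real: "Im (L2_inner k (P k)) = 0" if "k \<in> L2" for k
    using P that by (auto simp: positive_operator_def complex_nonneg_Reals_iff)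
  let ?k = "\<lambda>x. 1 * f x + \<i> * g x"
  have k: "?k \<in> L2" by (rule L2_lincomb[OF f g])
  have "L2_inner ?k (P ?k) = L2_inner ?k (\<lambda>x. 1 * P f x + \<i> * P g x)"
  proof (rule L2_inner_cong_AE)
    show "AE x in lborel. P ?k x = 1 * P f x + \<i> * P g x"
      using b f g unfolding bounded_operator_def by blast
    show "(\<lambda>x. 1 * P f x + \<i> * P g x) \<in> L2" by (intro L2_lincomb PL f g)
  qed (simp_all only: k PL[OF k] simp_thms eventually_True)
  also have "\<dots> = 1 * L2_inner ?k (P f) + \<i> * L2_inner ?k (P g)"
    by (rule L2_inner_lincomb_right[OF PL[OF f] PL[OF g] k])
  also have "L2_inner ?k (P f) = L2_inner f (P f) - \<i> * L2_inner g (P f)"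
    using L2_inner_lincomb_left[OF f g PL[OF f], of 1 "\<i>"] by simp
  also have "L2_inner ?k (P g) = L2_inner f (P g) - \<i> * L2_inner g (P g)"
    using L2_inner_lincomb_left[OF f g PL[OF g], of 1 "\<i>"] by simp
  finally have "Im (L2_inner ?k (P ?k)) = Re (L2_inner f (P g)) - Re (L2_inner g (P f))
      + Im (L2_inner f (P f)) + Im (L2_inner g (P g))"
    by simp
  then show ?thesis using real[OF k] real[OF f] real[OF g] by simp
qed

lemma lift_positive_operator:
  assumes P: "positive_operator P"
  shows "bounded_linear (lift_op P)" "inner (lift_op P x) y = inner x (lift_op P y)"
    "inner x (lift_op P x) \<ge> 0"
proof -
  have b: "bounded_operator P" using P by (simp add: positive_operator_def)
  then show "bounded_linear (lift_op P)" by (rule bounded_linear_lift_op)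
  obtain f g where f: "f \<in> L2" "x = abs_l2 f" and g: "g \<in> L2" "y = abs_l2 g"
    by (metis l2_cases)
  have "inner (lift_op P x) y = Re (L2_inner g (P f))"
    by (subst inner_commute) (simp add: f g inner_abs_l2 lift_op_abs b bounded_operator_L2)
  also have "\<dots> = Re (L2_inner f (P g))" by (rule positive_operator_symmetric[OF P g(1) f(1)])
  also have "\<dots> = inner x (lift_op P y)" by (simp add: f g inner_abs_l2 lift_op_abs b bounded_operator_L2)
  finally show "inner (lift_op P x) y = inner x (lift_op P y)" .
  show "inner x (lift_op P x) \<ge> 0"
    using P f(1) by (auto simp: f inner_abs_l2 lift_op_abs b bounded_operator_L2 positive_operator_def complex_nonneg_Reals_iff)
qed

lemma lift_self_adjoint:
  assumes "self_adjoint R"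
  shows "bounded_linear (lift_op R)" "inner (lift_op R x) y = inner x (lift_op R y)"
proof -
  have b: "bounded_operator R" using assms by (simp add: self_adjoint_def is_adjoint_def)
  then show "bounded_linear (lift_op R)" by (rule bounded_linear_lift_op)
  obtain f g where f: "f \<in> L2" "x = abs_l2 f" and g: "g \<in> L2" "y = abs_l2 g"
    by (metis l2_cases)
  show "inner (lift_op R x) y = inner x (lift_op R y)"
    using assms by (simp add: f g inner_abs_l2 lift_op_abs b bounded_operator_L2 self_adjoint_def is_adjoint_def)
qed

text \<open>The adjoint in the definition of \<open>|R|\<close> is \<open>R\<close> itself, so \<open>|R|\<^sup>2 = R\<^sup>2\<close> on the quotient.\<close>

lemma lift_operator_abs_square:
  assumes R: "self_adjoint R" and P: "is_operator_abs P R"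
  shows "lift_op P (lift_op P x) = lift_op R (lift_op R x)"
proof -
  obtain S where S: "is_adjoint S R" and PS: "\<And>f. f \<in> L2 \<Longrightarrow> AE x in lborel. P (P f) x = S (R f) x"
    using P by (auto simp: is_operator_abs_def)
  have bP: "bounded_operator P" using P by (simp add: is_operator_abs_def positive_operator_def)
  have bR: "bounded_operator R" using R by (simp add: self_adjoint_def is_adjoint_def)
  have bS: "bounded_operator S" using S by (simp add: is_adjoint_def)
  have SR: "lift_op S y = lift_op R y" for y
  proof -
    have "inner (lift_op S y) z = inner (lift_op R y) z" for z
    proof -
      obtain f g where f: "f \<in> L2" "y = abs_l2 f" and g: "g \<in> L2" "z = abs_l2 g"
        by (metis l2_cases)
      show ?thesis using S R
        by (simp add: f g inner_abs_l2 lift_op_abs bS bR bounded_operator_L2 self_adjoint_def is_adjoint_def)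
    qed
    then have "inner (lift_op S y - lift_op R y) (lift_op S y - lift_op R y) = 0"
      by (simp add: inner_diff_left)
    then show ?thesis by simp
  qed
  obtain f where f: "f \<in> L2" "x = abs_l2 f" by (metis l2_cases)
  have "lift_op P (lift_op P x) = abs_l2 (P (P f))" by (simp add: f lift_op_abs bP bounded_operator_L2)
  also have "\<dots> = abs_l2 (S (R f))"
    using PS[OF f(1)] f(1) bP bS bR by (subst abs_l2_eq_iff) (auto intro: bounded_operator_L2)
  also have "\<dots> = lift_op S (lift_op R x)" by (simp add: f lift_op_abs bS bR bounded_operator_L2)
  finally show ?thesis by (simp add: SR)
qed

section \<open>The trace norm of a self-adjoint operator\<close>

text \<open>The existence of an orthonormal basis is essential: without one, every number would be a
  trace.\<close>

lemma has_trace_norm_unique: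
  assumes R: "self_adjoint R" and e: "orthonormal_basis e"
    and s: "has_trace_norm R s" and t: "has_trace_norm R t"
  shows "s = t"
proof -
  obtain P where P: "is_operator_abs P R" "has_trace P (complex_of_real s)"
    using s by (auto simp: has_trace_norm_def)
  obtain Q where Q: "is_operator_abs Q R" "has_trace Q (complex_of_real t)"
    using t by (auto simp: has_trace_norm_def)
  have pP: "positive_operator P" and pQ: "positive_operator Q"
    using P Q by (auto simp: is_operator_abs_def)
  then have b: "bounded_operator P" "bounded_operator Q" by (auto simp: positive_operator_def)
  have eq: "lift_op P x = lift_op Q x" for x
  proof (rule positive_square_root_unique[where P="lift_op P" and Q="lift_op Q"])
    show "lift_op P (lift_op P x) = lift_op Q (lift_op Q x)" for x
      by (simp add: lift_operator_abs_square[OF R P(1)] lift_operator_abs_square[OF R Q(1)])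
  qed (simp_all add: lift_positive_operator pP pQ)
  have eL: "e k \<in> L2" for k using e by (simp add: orthonormal_basis_def)
  have "L2_inner (e k) (P (e k)) = L2_inner (e k) (Q (e k))" for k
  proof (rule L2_inner_cong_AE)
    have "abs_l2 (P (e k)) = abs_l2 (Q (e k))"
      using eq[of "abs_l2 (e k)"] by (simp add: lift_op_abs b eL)
    then show "AE x in lborel. P (e k) x = Q (e k) x"
      by (simp add: abs_l2_eq_iff bounded_operator_L2 b eL)
  qed (auto intro: eL bounded_operator_L2 b)
  then have "complex_of_real s = complex_of_real t"
    using P(2) Q(2) e unfolding has_trace_def by (metis (no_types, lifting) sums_cong sums_unique2)
  then show ?thesis by simp
qed

lemma sum_diagonal_le_trace_norm:
  assumes R: "self_adjoint R" and tc: "trace_class R" and e: "orthonormal_basis e" and J: "finite J"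
  shows "(\<Sum>k\<in>J. cmod (L2_inner (e k) (R (e k)))) \<le> trace_norm R"
proof -
  obtain t where t: "has_trace_norm R t" using tc by (auto simp: trace_class_def)
  have "trace_norm R = t" unfolding trace_norm_def
    using t has_trace_norm_unique[OF R e] by (intro the_equality) auto
  obtain P where P: "is_operator_abs P R" "has_trace P (complex_of_real t)"
    using t by (auto simp: has_trace_norm_def)
  have pP: "positive_operator P" using P by (auto simp: is_operator_abs_def)
  then have b: "bounded_operator P" by (auto simp: positive_operator_def)
  have bR: "bounded_operator R" using R by (simp add: self_adjoint_def is_adjoint_def)
  have eL: "e k \<in> L2" for k using e by (simp add: orthonormal_basis_def)
  define p where "p k = Re (L2_inner (e k) (P (e k)))" for k
  have p0: "p k \<ge> 0" for k
    using pP eL[of k] by (auto simp: p_def positive_operator_def complex_nonneg_Reals_iff)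
  have le: "cmod (L2_inner (e k) (R (e k))) \<le> p k" for k
  proof -
    have "L2_inner (R (e k)) (e k) = L2_inner (e k) (R (e k))"
      using R eL by (simp add: self_adjoint_def is_adjoint_def)
    then have "cnj (L2_inner (e k) (R (e k))) = L2_inner (e k) (R (e k))"
      by (metis L2_inner_commute)
    then have "Im (L2_inner (e k) (R (e k))) = 0" by (metis Reals_cnj_iff complex_is_Real_iff)
    then have "cmod (L2_inner (e k) (R (e k))) = \<bar>Re (L2_inner (e k) (R (e k)))\<bar>"
      by (simp add: cmod_eq_Re)
    also have "\<dots> = \<bar>inner (abs_l2 (e k)) (lift_op R (abs_l2 (e k)))\<bar>"
      by (simp add: inner_abs_l2 lift_op_abs bR eL bounded_operator_L2)
    also have "\<dots> \<le> inner (abs_l2 (e k)) (lift_op P (abs_l2 (e k)))"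
      by (rule abs_operator_dominates[where P="lift_op P" and R="lift_op R"])
        (simp_all add: lift_positive_operator pP lift_self_adjoint R lift_operator_abs_square[OF R P(1)])
    also have "\<dots> = p k" by (simp add: p_def inner_abs_l2 lift_op_abs b eL bounded_operator_L2)
    finally show ?thesis .
  qed
  have "(\<lambda>k. L2_inner (e k) (P (e k))) sums complex_of_real t" using P(2) e by (simp add: has_trace_def)
  then have ps: "p sums t" unfolding p_def using sums_Re by fastforce
  have "(\<Sum>k\<in>J. cmod (L2_inner (e k) (R (e k)))) \<le> (\<Sum>k\<in>J. p k)" by (intro sum_mono le)
  also have "\<dots> \<le> suminf p" using p0 ps J by (intro sum_le_suminf) (auto simp: sums_iff)
  also have "\<dots> = t" using ps by (simp add: sums_iff)
  finally show ?thesis by (simp add: \<open>trace_norm R = t\<close>)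
qed

section \<open>The Haar basis\<close>

text \<open>The dyadic interval \<open>[k 2\<^sup>-\<^sup>l, (k + 1) 2\<^sup>-\<^sup>l)\<close>, encoded by a floor function so that disjointness and nesting
  are statements about integers.\<close>

definition dyadic :: "nat \<Rightarrow> int \<Rightarrow> real set" where
  "dyadic l k = {x. \<lfloor>2 ^ l * x\<rfloor> = k}"

lemma dyadic_eq: "dyadic l k = {real_of_int k / 2 ^ l..<(real_of_int k + 1) / 2 ^ l}"
proof -
  have "\<lfloor>2 ^ l * x\<rfloor> = k \<longleftrightarrow> real_of_int k / 2 ^ l \<le> x \<and> x < (real_of_int k + 1) / 2 ^ l" for x :: real
    by (simp add: floor_eq_iff field_simps)
  then show ?thesis by (intro set_eqI) (simp only: dyadic_def mem_Collect_eq atLeastLessThan_iff)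
qed

lemma dyadic_sets [measurable, simp]: "dyadic l k \<in> sets borel"
  by (simp add: dyadic_eq)

lemma emeasure_dyadic: "emeasure lborel (dyadic l k) = ennreal (1 / 2 ^ l)"
proof -
  have "(real_of_int k + 1) / 2 ^ l - real_of_int k / 2 ^ l = 1 / 2 ^ l"
    by (simp add: add_divide_distrib)
  moreover have "real_of_int k / 2 ^ l \<le> (real_of_int k + 1) / 2 ^ l"
    by (simp add: divide_right_mono)
  ultimately show ?thesis by (simp only: dyadic_eq emeasure_lborel_Ico)
qed

lemma measure_dyadic: "measure lborel (dyadic l k) = 1 / 2 ^ l"
  by (simp add: measure_def emeasure_dyadic)

lemma floor_double_cases: "\<lfloor>2 * y\<rfloor> = 2 * \<lfloor>y\<rfloor> \<or> \<lfloor>2 * y\<rfloor> = 2 * \<lfloor>y\<rfloor> + 1" for y :: real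
  by linarith

lemma dyadic_halves: "dyadic l k = dyadic (Suc l) (2 * k) \<union> dyadic (Suc l) (2 * k + 1)"
proof -
  have "\<lfloor>2 ^ l * x\<rfloor> = k \<longleftrightarrow> \<lfloor>2 ^ Suc l * x\<rfloor> = 2 * k \<or> \<lfloor>2 ^ Suc l * x\<rfloor> = 2 * k + 1" for x :: real
    using floor_double_cases[of "2 ^ l * x"] by (auto simp: mult.assoc; presburger)
  then show ?thesis by (intro set_eqI) (simp only: dyadic_def mem_Collect_eq Un_iff)
qed

lemma dyadic_disjoint: "k \<noteq> k' \<Longrightarrow> dyadic l k \<inter> dyadic l k' = {}"
  by (auto simp: dyadic_def)

lemma indicator_dyadic_mult:
  "indicator (dyadic l k) x * indicator (dyadic l k') x = (if k = k' then indicator (dyadic l k) x else (0::real))"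
  by (auto simp: dyadic_def indicator_def)

lemma dyadic_nested:
  assumes "l \<le> m" "x \<in> dyadic m j" "y \<in> dyadic m j"
  shows "x \<in> dyadic l k \<longleftrightarrow> y \<in> dyadic l k"
proof -
  have *: "\<lfloor>2 ^ l * z\<rfloor> = j div 2 ^ (m - l)" if "z \<in> dyadic m j" for z :: real
  proof -
    have "2 ^ l * z = (2 ^ m * z) / real_of_int (2 ^ (m - l))"
    proof -
      have "(2::real) ^ m = 2 ^ l * 2 ^ (m - l)" using assms(1) by (simp flip: power_add)
      then show ?thesis by (simp add: field_simps)
    qed
    then show ?thesis using floor_divide_real_eq_div[of "2 ^ (m - l)" "2 ^ m * z"] that
      by (simp add: dyadic_def)
  qed
  show ?thesis using *[OF assms(2)] *[OF assms(3)] by (simp add: dyadic_def)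
qed

text \<open>The Haar system that starts at scale \<open>2\<^sup>-\<^sup>N\<close>: index \<open>(0, k)\<close> is a normalized indicator
  function, index \<open>(m + 1, k)\<close> the wavelet on the \<open>k\<close>-th dyadic interval of level \<open>N + m\<close>.\<close>

fun haar :: "nat \<Rightarrow> nat \<times> int \<Rightarrow> real \<Rightarrow> real" where
  "haar N (0, k) x = sqrt (2 ^ N) * indicator (dyadic N k) x"
| "haar N (Suc m, k) x = sqrt (2 ^ (N + m)) *
     (indicator (dyadic (Suc (N + m)) (2 * k)) x - indicator (dyadic (Suc (N + m)) (2 * k + 1)) x)"

lemma haar_measurable [measurable]: "haar N i \<in> borel_measurable borel"
proof (cases i)
  case (Pair l k)
  then show ?thesis
  proof (cases l)
    case 0
    have "haar N (0, k) = (\<lambda>x. sqrt (2 ^ N) * indicator (dyadic N k) x)" by (rule ext) simp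
    then show ?thesis using Pair 0 by simp
  next
    case (Suc m)
    have "haar N (Suc m, k) = (\<lambda>x. sqrt (2 ^ (N + m)) *
     (indicator (dyadic (Suc (N + m)) (2 * k)) x - indicator (dyadic (Suc (N + m)) (2 * k + 1)) x))"
      by (rule ext) simp
    then show ?thesis using Pair Suc by simp
  qed
qed

lemma wavelet_sq: "haar N (Suc m, k) x * haar N (Suc m, k') x =
    (if k = k' then 2 ^ (N + m) * indicator (dyadic (N + m) k) x else 0)"
proof -
  define j where "j = \<lfloor>2 ^ Suc (N + m) * x\<rfloor>"
  let ?s = "sqrt (2 ^ (N + m))" and ?I = "\<lambda>i. (if j = i then 1 else 0 :: real)"
  have I: "indicator (dyadic (Suc (N + m)) i) x = ?I i" for i
    by (simp add: indicator_def dyadic_def j_def)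
  have D: "indicator (dyadic (N + m) i) x = ?I (2 * i) + ?I (2 * i + 1)" for i
    unfolding dyadic_halves[of "N + m" i] by (auto simp: indicator_def dyadic_def j_def)
  have prod: "(?I (2*k) - ?I (2*k+1)) * (?I (2*k') - ?I (2*k'+1)) =
     (if k = k' then ?I (2 * k) + ?I (2 * k + 1) else 0)"
  proof -
    have "2 * a \<noteq> 2 * b + 1" "2 * a + 1 \<noteq> 2 * b" for a b :: int by presburger+
    then show ?thesis by (cases "k = k'") auto
  qed
  have "haar N (Suc m, k) x * haar N (Suc m, k') x =
     (?s * (?I (2*k) - ?I (2*k+1))) * (?s * (?I (2*k') - ?I (2*k'+1)))"
    by (simp only: haar.simps I)
  also have "\<dots> = (?s * ?s) * ((?I (2*k) - ?I (2*k+1)) * (?I (2*k') - ?I (2*k'+1)))"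
    by (simp only: mult_ac)
  also have "?s * ?s = 2 ^ (N + m)" by simp
  finally show ?thesis unfolding prod D by simp
qed

lemma wavelet_support: "x \<notin> dyadic (N + m) k \<Longrightarrow> haar N (Suc m, k) x = 0"
  using wavelet_sq[of N m k x k] by simp

lemma wavelet_has_integral: "has_bochner_integral lborel (haar N (Suc m, k)) 0"
proof -
  let ?I = "\<lambda>j. indicator (dyadic (Suc (N + m)) j) :: real \<Rightarrow> real"
  have I: "has_bochner_integral lborel (?I j) (1 / 2 ^ Suc (N + m))" for j
    using has_bochner_integral_real_indicator[of "dyadic (Suc (N + m)) j" lborel]
    by (simp add: emeasure_dyadic measure_dyadic)
  have "has_bochner_integral lborel (\<lambda>x. sqrt (2 ^ (N + m)) * (?I (2 * k) x - ?I (2 * k + 1) x))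
      (sqrt (2 ^ (N + m)) * (1 / 2 ^ Suc (N + m) - 1 / 2 ^ Suc (N + m)))"
    by (intro has_bochner_integral_mult_right has_bochner_integral_diff I)
  moreover have "haar N (Suc m, k) = (\<lambda>x. sqrt (2 ^ (N + m)) * (?I (2 * k) x - ?I (2 * k + 1) x))"
    by (rule ext) simp
  ultimately show ?thesis by simp
qed

lemmas wavelet_integral = has_bochner_integral_integral_eq[OF wavelet_has_integral]

lemma wavelet_orthogonal_to_coarse:
  assumes "\<And>x y. x \<in> dyadic (N + m) k \<Longrightarrow> y \<in> dyadic (N + m) k \<Longrightarrow> g x = g y"
  shows "(\<integral>x. g x * haar N (Suc m, k) x \<partial>lborel) = 0"
proof -
  define c where "c = g (real_of_int k / 2 ^ (N + m))"
  have "real_of_int k / 2 ^ (N + m) \<in> dyadic (N + m) k" by (simp add: dyadic_def)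
  then have "g x * haar N (Suc m, k) x = c * haar N (Suc m, k) x" for x
    using assms[of x] wavelet_support[of x N m k] unfolding c_def by (cases "x \<in> dyadic (N + m) k") auto
  then have "(\<lambda>x. g x * haar N (Suc m, k) x) = (\<lambda>x. c * haar N (Suc m, k) x)" by (rule ext)
  then have "(\<integral>x. g x * haar N (Suc m, k) x \<partial>lborel) = c * (\<integral>x. haar N (Suc m, k) x \<partial>lborel)"
    by (simp only: integral_mult_right_zero)
  then show ?thesis by (simp only: wavelet_integral mult_zero_right)
qed

text \<open>Together with \<open>wavelet_orthogonal_to_coarse\<close> this gives orthogonality across levels.\<close>

lemma haar_constant_on_fine:
  assumes "l \<le> m" "x \<in> dyadic (N + m) k" "y \<in> dyadic (N + m) k"
  shows "haar N (l, j) x = haar N (l, j) y"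
proof (cases l)
  case 0
  then show ?thesis using dyadic_nested[of N "N + m" x k y j] assms(2,3)
    by (simp add: indicator_def)
next
  case (Suc p)
  then have le: "Suc (N + p) \<le> N + m" using assms(1) by simp
  show ?thesis unfolding Suc
    using dyadic_nested[OF le assms(2,3), of "2 * j"] dyadic_nested[OF le assms(2,3), of "2 * j + 1"]
    by (simp add: indicator_def)
qed

lemma haar_orthonormal: "(\<integral>x. haar N i x * haar N j x \<partial>lborel) = (if i = j then 1 else 0)"
proof -
  have lt: "(\<integral>x. haar N (l, k) x * haar N (l', k') x \<partial>lborel) = 0" if "l < l'" for l k l' k'
  proof -
    obtain m where m: "l' = Suc m" "l \<le> m" using \<open>l < l'\<close> by (cases l') auto
    show ?thesis unfolding m(1)
      by (rule wavelet_orthogonal_to_coarse) (rule haar_constant_on_fine[OF m(2)])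
  qed
  obtain l k where i: "i = (l, k)" by (cases i) auto
  obtain l' k' where j: "j = (l', k')" by (cases j) auto
  consider "l < l'" | "l' < l" | "l = l'" by linarith
  then show ?thesis
  proof cases
    case 1
    then show ?thesis using lt[of l l' k k'] by (simp add: i j)
  next
    case 2
    then show ?thesis using lt[of l' l k' k] by (simp add: i j mult.commute)
  next
    case 3
    show ?thesis
    proof (cases l)
      case 0
      have "(\<lambda>x. haar N (0, k) x * haar N (0, k') x) = (\<lambda>x. 2 ^ N * (if k = k' then indicator (dyadic N k) x else 0))"
        by (rule ext) (simp add: indicator_dyadic_mult[symmetric] mult_ac flip: real_sqrt_mult)
      then have "(\<integral>x. haar N (0, k) x * haar N (0, k') x \<partial>lborel) = (if k = k' then 1 else 0)"
        by (simp only: integral_mult_right_zero) (simp add: measure_dyadic)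
      then show ?thesis using 3 0 by (simp only: i j) simp
    next
      case (Suc m)
      have "(\<integral>x. haar N (Suc m, k) x * haar N (Suc m, k') x \<partial>lborel) = (if k = k' then 1 else 0)"
        by (simp only: wavelet_sq) (simp add: measure_dyadic)
      then show ?thesis using 3 Suc by (simp only: i j) simp
    qed
  qed
qed

lemma open_Union_dyadic:
  assumes "open U"
  shows "U = \<Union> {D \<in> {dyadic (N + m) k | m k. True}. D \<subseteq> U}"
proof (rule antisym)
  show "U \<subseteq> \<Union> {D \<in> {dyadic (N + m) k | m k. True}. D \<subseteq> U}"
  proof
    fix x assume x: "x \<in> U"
    then obtain e where e: "e > 0" "ball x e \<subseteq> U" using assms open_contains_ball by blast
    obtain m where m: "(1/2) ^ m < e" using real_arch_pow_inv[OF e(1), of "1/2"] by auto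
    define k where "k = \<lfloor>2 ^ (N + m) * x\<rfloor>"
    have "(1/2 :: real) ^ (N + m) \<le> (1/2) ^ m" by (intro power_decreasing) auto
    with m have me: "1 / 2 ^ (N + m) < e" by (simp add: power_one_over)
    have "dyadic (N + m) k \<subseteq> ball x e"
    proof
      fix y assume y: "y \<in> dyadic (N + m) k"
      have "x \<in> dyadic (N + m) k" by (simp add: dyadic_def k_def)
      with y have "\<bar>y - x\<bar> \<le> (real_of_int k + 1) / 2 ^ (N + m) - real_of_int k / 2 ^ (N + m)"
        unfolding dyadic_eq atLeastLessThan_iff by linarith
      also have "\<dots> = 1 / 2 ^ (N + m)" by (simp add: add_divide_distrib)
      finally show "y \<in> ball x e" using me by (simp add: dist_real_def abs_minus_commute)
    qed
    with e have "dyadic (N + m) k \<subseteq> U" by blast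
    moreover have "x \<in> dyadic (N + m) k" by (simp add: dyadic_def k_def)
    ultimately show "x \<in> \<Union> {D \<in> {dyadic (N + m) k | m k. True}. D \<subseteq> U}" by blast
  qed
qed blast

lemma borel_eq_sigma_dyadic:
  "sets (borel :: real measure) = sigma_sets UNIV (insert {} {dyadic (N + m) k | m k. True})"
proof -
  let ?E = "{dyadic (N + m) k | m k. True}"
  have cnt: "countable ?E"
  proof -
    have "?E = (\<lambda>(m, k). dyadic (N + m) k) ` UNIV" by auto
    then show ?thesis by (simp only:) (intro countable_image, simp)
  qed
  have "sigma_sets UNIV {S. open (S :: real set)} = sigma_sets UNIV (insert {} ?E)"
  proof (rule sigma_sets_eqI)
    fix U :: "real set" assume "U \<in> {S. open S}"
    then have U: "U = \<Union> {D \<in> ?E. D \<subseteq> U}" using open_Union_dyadic[of U N] by simp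
    have "countable {D \<in> ?E. D \<subseteq> U}" by (rule countable_subset[OF _ cnt]) auto
    then have "\<Union> {D \<in> ?E. D \<subseteq> U} \<in> sigma_sets UNIV (insert {} ?E)"
      by (rule sigma_sets_UNION) (auto intro: sigma_sets.Basic)
    then show "U \<in> sigma_sets UNIV (insert {} ?E)" using U by simp
  next
    fix D assume "D \<in> insert {} ?E"
    then have "D \<in> sets (borel :: real measure)" by auto
    then show "D \<in> sigma_sets UNIV {S. open S}" by (simp add: borel_def)
  qed
  then show ?thesis by (simp add: borel_def)
qed

text \<open>The measures with densities \<open>max 0 f\<close> and \<open>max 0 (- f)\<close> agree on the dyadic intervals of level at
  least \<open>N\<close>, which form an intersection-stable generator of the Borel sets.\<close>

lemma zero_integral_dyadic_imp_zero:
  fixes f :: "real \<Rightarrow> real"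
  assumes int: "\<And>m k. integrable lborel (\<lambda>x. f x * indicator (dyadic (N + m) k) x)"
    and zero: "\<And>m k. (\<integral>x. f x * indicator (dyadic (N + m) k) x \<partial>lborel) = 0"
    and f [measurable]: "f \<in> borel_measurable borel"
  shows "AE x in lborel. f x = 0"
proof -
  let ?E = "{dyadic (N + m) k | m k. True}"
  let ?p = "\<lambda>x. ennreal (f x)" and ?n = "\<lambda>x. ennreal (- f x)"
  have fin: "emeasure (density lborel ?p) (dyadic (N + m) k) = emeasure (density lborel ?n) (dyadic (N + m) k)"
      "emeasure (density lborel ?p) (dyadic (N + m) k) \<noteq> \<infinity>" for m k
  proof -
    let ?g = "\<lambda>x. f x * indicator (dyadic (N + m) k) x"
    have p: "emeasure (density lborel ?p) (dyadic (N + m) k) = (\<integral>\<^sup>+x. ennreal (?g x) \<partial>lborel)"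
      by (subst emeasure_density) (auto intro!: nn_integral_cong simp: indicator_def)
    have n: "emeasure (density lborel ?n) (dyadic (N + m) k) = (\<integral>\<^sup>+x. ennreal (- ?g x) \<partial>lborel)"
      by (subst emeasure_density) (auto intro!: nn_integral_cong simp: indicator_def)
    have fin: "(\<integral>\<^sup>+x. ennreal (?g x) \<partial>lborel) \<noteq> \<infinity>" "(\<integral>\<^sup>+x. ennreal (- ?g x) \<partial>lborel) \<noteq> \<infinity>"
      using int[of m k] unfolding real_integrable_def by auto
    have e: "enn2real (\<integral>\<^sup>+x. ennreal (?g x) \<partial>lborel) = enn2real (\<integral>\<^sup>+x. ennreal (- ?g x) \<partial>lborel)"
      using zero[of m k] unfolding real_lebesgue_integral_def[OF int[of m k]] by simp
    have "(\<integral>\<^sup>+x. ennreal (?g x) \<partial>lborel) = ennreal (enn2real (\<integral>\<^sup>+x. ennreal (?g x) \<partial>lborel))"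
      using fin(1) by (intro ennreal_enn2real[symmetric]) (simp add: less_top)
    also have "\<dots> = (\<integral>\<^sup>+x. ennreal (- ?g x) \<partial>lborel)"
      unfolding e using fin(2) by (intro ennreal_enn2real) (simp add: less_top)
    finally have "(\<integral>\<^sup>+x. ennreal (?g x) \<partial>lborel) = (\<integral>\<^sup>+x. ennreal (- ?g x) \<partial>lborel)" .
    then show "emeasure (density lborel ?p) (dyadic (N + m) k) = emeasure (density lborel ?n) (dyadic (N + m) k)"
      "emeasure (density lborel ?p) (dyadic (N + m) k) \<noteq> \<infinity>"
      using p n fin by auto
  qed
  have inter: "dyadic (N + m) j \<inter> dyadic (N + l) k \<in> insert {} ?E" if "m \<le> l" for m j l k
  proof (cases "dyadic (N + m) j \<inter> dyadic (N + l) k = {}")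
    case False
    then obtain x where x: "x \<in> dyadic (N + m) j" "x \<in> dyadic (N + l) k" by blast
    have "dyadic (N + l) k \<subseteq> dyadic (N + m) j"
    proof
      fix y assume "y \<in> dyadic (N + l) k"
      from dyadic_nested[OF add_left_mono[OF that] x(2) this] x(1)
      show "y \<in> dyadic (N + m) j" by blast
    qed
    then have "dyadic (N + m) j \<inter> dyadic (N + l) k = dyadic (N + l) k" by blast
    then show ?thesis by auto
  qed auto
  have "density lborel ?p = density lborel ?n"
  proof (rule measure_eqI_generator_eq_countable[where E="insert {} ?E" and \<Omega>=UNIV and A="range (dyadic (N + 0))"])
    show "Int_stable (insert {} ?E)"
    proof (rule Int_stableI)
      fix a b assume "a \<in> insert {} ?E" "b \<in> insert {} ?E"
      then consider "a = {} \<or> b = {}"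
        | m j l k where "a = dyadic (N + m) j" "b = dyadic (N + l) k" by blast
      then show "a \<inter> b \<in> insert {} ?E"
      proof cases
        case 2
        show ?thesis
        proof (cases "m \<le> l")
          case True
          then show ?thesis using inter[of m l j k] 2 by simp
        next
          case False
          then show ?thesis using inter[of l m k j] 2 by (simp add: Int_commute)
        qed
      qed auto
    qed
    show "insert {} ?E \<subseteq> Pow UNIV" by simp
    show "emeasure (density lborel ?p) X = emeasure (density lborel ?n) X" if "X \<in> insert {} ?E" for X
    proof (cases "X = {}")
      case False
      then have "X \<in> ?E" using that by simp
      then obtain m k where "X = dyadic (N + m) k" by blast
      then show ?thesis using fin(1) by simp
    qed simp
    show "sets (density lborel ?p) = sigma_sets UNIV (insert {} ?E)"
      "sets (density lborel ?n) = sigma_sets UNIV (insert {} ?E)"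
      by (simp_all only: sets_density sets_lborel borel_eq_sigma_dyadic)
    show "range (dyadic (N + 0)) \<subseteq> insert {} ?E" by blast
    show "\<Union> (range (dyadic (N + 0))) = UNIV" by (auto simp: dyadic_def)
    show "countable (range (dyadic (N + 0)))" by simp
    show "emeasure (density lborel ?p) a \<noteq> \<infinity>" if "a \<in> range (dyadic (N + 0))" for a
      using that fin(2)[of 0] by auto
  qed
  then have "AE x in lborel. ?p x = ?n x"
    by (intro sigma_finite_measure.density_unique[OF sigma_finite_lborel]) auto
  then show ?thesis
  proof eventually_elim
    case (elim x)
    show ?case
    proof (cases "f x \<ge> 0")
      case True
      then have "?n x = 0" by (intro ennreal_neg) simp
      then show ?thesis using elim True ennreal_eq_0_iff[of "f x"] by simp
    next
      case False
      then have "?p x = 0" by (intro ennreal_neg) simp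
      then show ?thesis using elim False ennreal_eq_0_iff[of "- f x"] by simp
    qed
  qed
qed

lemma L2_integrable_on_finite:
  assumes f: "f \<in> L2" and A: "A \<in> sets borel" "emeasure lborel A < \<infinity>"
  shows "integrable lborel (\<lambda>x. indicator A x * f x)"
proof -
  have "(\<lambda>x. complex_of_real (indicator A x)) \<in> L2"
  proof -
    have "(\<lambda>x. (cmod (complex_of_real (indicator A x)))\<^sup>2) = (indicator A :: _ \<Rightarrow> real)"
      by (auto simp: indicator_def)
    moreover have "integrable lborel (indicator A :: _ \<Rightarrow> real)"
      using A by (simp add: integrable_indicator_iff)
    ultimately show ?thesis unfolding L2_def using A by simp
  qed
  moreover have "cnj (complex_of_real (indicator A x)) * f x = indicator A x * f x" for x
    by (simp add: indicator_def)
  ultimately show ?thesis using L2_product_integrable[OF _ f, of "\<lambda>x. complex_of_real (indicator A x)"]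
    by (simp only:)
qed

text \<open>The Haar system as a complex sequence; the order of the enumeration is irrelevant.\<close>

definition haar_seq :: "nat \<Rightarrow> nat \<Rightarrow> real \<Rightarrow> complex" where
  "haar_seq N n = (\<lambda>x. complex_of_real (haar N (from_nat_into UNIV n) x))"

lemma bij_from_nat_into_nat_int: "bij (from_nat_into (UNIV :: (nat \<times> int) set))"
proof -
  have "infinite (UNIV :: (nat \<times> int) set)" by (simp add: finite_prod)
  then show ?thesis using bij_betw_from_nat_into[of "UNIV :: (nat \<times> int) set"] by simp
qed

lemma haar_complex_L2: "(\<lambda>x. complex_of_real (haar N i x)) \<in> L2"
proof -
  have "(\<integral>x. haar N i x * haar N i x \<partial>lborel) = 1" by (simp add: haar_orthonormal)
  then have "integrable lborel (\<lambda>x. haar N i x * haar N i x)"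
    using not_integrable_integral_eq by fastforce
  then show ?thesis by (simp add: L2_def power2_eq_square)
qed

lemma L2_inner_haar:
  "L2_inner (\<lambda>x. complex_of_real (haar N i x)) (\<lambda>x. complex_of_real (haar N j x)) = (if i = j then 1 else 0)"
proof -
  have "L2_inner (\<lambda>x. complex_of_real (haar N i x)) (\<lambda>x. complex_of_real (haar N j x))
     = (\<integral>x. complex_of_real (haar N i x * haar N j x) \<partial>lborel)" by (simp add: L2_inner_def)
  also have "\<dots> = complex_of_real (\<integral>x. haar N i x * haar N j x \<partial>lborel)" by (rule integral_complex_of_real)
  finally show ?thesis by (simp add: haar_orthonormal)
qed

text \<open>Orthogonality to the wavelets says that the integrals of \<open>f\<close> over the two halves of a dyadic
  interval agree, so all integrals over dyadic intervals vanish by induction on the level.\<close>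

lemma haar_complete:
  assumes f: "f \<in> L2" and orth: "\<And>i. L2_inner (\<lambda>x. complex_of_real (haar N i x)) f = 0"
  shows "AE x in lborel. f x = 0"
proof -
  note [measurable] = L2_measurable[OF f]
  define I where "I l k = (\<integral>x. indicator (dyadic l k) x * f x \<partial>lborel)" for l k
  have int: "integrable lborel (\<lambda>x. indicator (dyadic l k) x * f x)" for l k
    by (rule L2_integrable_on_finite[OF f]) (simp_all add: emeasure_dyadic)
  have base: "I N k = 0" for k
  proof -
    have "L2_inner (\<lambda>x. complex_of_real (haar N (0, k) x)) f =
       (\<integral>x. complex_of_real (sqrt (2 ^ N)) * (indicator (dyadic N k) x * f x) \<partial>lborel)"
      unfolding L2_inner_def by (rule Bochner_Integration.integral_cong) (auto simp: indicator_def)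
    also have "\<dots> = complex_of_real (sqrt (2 ^ N)) * I N k" by (simp add: I_def)
    finally show ?thesis using orth[of "(0, k)"] by simp
  qed
  have diff: "I (Suc (N + m)) (2 * k) = I (Suc (N + m)) (2 * k + 1)" for m k
  proof -
    let ?i = "\<lambda>j x. indicator (dyadic (Suc (N + m)) j) x * f x"
    have "L2_inner (\<lambda>x. complex_of_real (haar N (Suc m, k) x)) f =
       (\<integral>x. complex_of_real (sqrt (2 ^ (N + m))) * (?i (2 * k) x - ?i (2 * k + 1) x) \<partial>lborel)"
      unfolding L2_inner_def by (rule Bochner_Integration.integral_cong) (auto simp: indicator_def)
    also have "\<dots> = complex_of_real (sqrt (2 ^ (N + m))) * (I (Suc (N + m)) (2 * k) - I (Suc (N + m)) (2 * k + 1))"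
      unfolding I_def integral_mult_right_zero by (subst Bochner_Integration.integral_diff[OF int int]) simp
    finally show ?thesis using orth[of "(Suc m, k)"] by simp
  qed
  have split: "I l k = I (Suc l) (2 * k) + I (Suc l) (2 * k + 1)" for l k
  proof -
    have "indicator (dyadic l k) x * f x = indicator (dyadic (Suc l) (2 * k)) x * f x
       + indicator (dyadic (Suc l) (2 * k + 1)) x * f x" for x
      using dyadic_halves[of l k] dyadic_disjoint[of "2 * k" "2 * k + 1" "Suc l"]
      by (auto simp: indicator_def)
    then show ?thesis unfolding I_def
      by (simp only: Bochner_Integration.integral_add[OF int int])
  qed
  have zero: "I (N + m) k = 0" for m k
  proof (induction m arbitrary: k)
    case (Suc m)
    have "I (Suc (N + m)) (2 * j) = 0 \<and> I (Suc (N + m)) (2 * j + 1) = 0" for j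
      using split[of "N + m" j] Suc[of j] diff[of m j] by simp
    moreover have "k = 2 * (k div 2) \<or> k = 2 * (k div 2) + 1" by presburger
    ultimately show ?case by (metis add_Suc_right)
  qed (simp add: base)
  have "AE x in lborel. g (f x) = 0" if g: "bounded_linear g" "g \<in> borel_measurable borel" for g :: "complex \<Rightarrow> real"
  proof (rule zero_integral_dyadic_imp_zero[where N=N])
    fix m k
    interpret g: bounded_linear g by (rule g(1))
    have eq: "(\<lambda>x. g (f x) * indicator (dyadic (N + m) k) x) = (\<lambda>x. g (indicator (dyadic (N + m) k) x * f x))"
      by (auto simp: indicator_def g.zero)
    show "integrable lborel (\<lambda>x. g (f x) * indicator (dyadic (N + m) k) x)"
      unfolding eq by (rule integrable_bounded_linear[OF g(1) int])
    show "(\<integral>x. g (f x) * indicator (dyadic (N + m) k) x \<partial>lborel) = 0"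
      unfolding eq integral_bounded_linear[OF g(1) int] using zero[of m k] by (simp add: I_def g.zero)
    show "(\<lambda>x. g (f x)) \<in> borel_measurable borel" using g(2) by measurable
  qed
  from this[OF bounded_linear_Re] this[OF bounded_linear_Im]
  have "AE x in lborel. Re (f x) = 0" "AE x in lborel. Im (f x) = 0" by auto
  then show ?thesis by eventually_elim (simp add: complex_eq_iff)
qed

lemma orthonormal_basis_haar: "orthonormal_basis (haar_seq N)"
  unfolding orthonormal_basis_def
proof (intro conjI allI ballI impI)
  let ?b = "from_nat_into (UNIV :: (nat \<times> int) set)"
  note bij = bij_from_nat_into_nat_int
  show "haar_seq N k \<in> L2" for k unfolding haar_seq_def by (rule haar_complex_L2)
  show "L2_inner (haar_seq N j) (haar_seq N k) = (if j = k then 1 else 0)" for j k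
    unfolding haar_seq_def L2_inner_haar using bij by (auto simp: bij_def inj_eq)
  fix f assume f: "f \<in> L2" and "\<forall>k. L2_inner (haar_seq N k) f = 0"
  then have "L2_inner (\<lambda>x. complex_of_real (haar N (?b k) x)) f = 0" for k by (simp add: haar_seq_def)
  then have "L2_inner (\<lambda>x. complex_of_real (haar N i x)) f = 0" for i
    by (metis bij bij_pointE)
  then show "AE x in lborel. f x = 0" by (rule haar_complete[OF f])
qed

section \<open>The diagonal of a trace class kernel\<close>

text \<open>The diagonal blocks of the kernel, averaged over dyadic squares, are diagonal matrix
  coefficients of the operator in the Haar basis.\<close>

lemma sum_dyadic_blocks_le_trace_norm:
  assumes R: "self_adjoint R" and tc: "trace_class R" and J: "finite J"
    and G: "\<And>j. G j = (\<lambda>x. complex_of_real (haar N (0, j) x))"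
  shows "(\<Sum>j\<in>J. cmod (L2_inner (G j) (R (G j)))) \<le> trace_norm R"
proof -
  let ?b = "from_nat_into (UNIV :: (nat \<times> int) set)"
  note bij = bij_from_nat_into_nat_int
  define n where "n j = inv ?b (0, j)" for j
  have bn: "?b (n j) = (0, j)" for j unfolding n_def
    by (rule surj_f_inv_f) (use bij in \<open>simp add: bij_def\<close>)
  have inj: "inj_on n J" by (rule inj_onI) (metis bn prod.inject)
  have "haar_seq N (n j) = G j" for j by (simp add: haar_seq_def bn G)
  then have "(\<Sum>j\<in>J. cmod (L2_inner (G j) (R (G j)))) =
      (\<Sum>k\<in>n ` J. cmod (L2_inner (haar_seq N k) (R (haar_seq N k))))"
    by (simp add: sum.reindex[OF inj])
  also have "\<dots> \<le> trace_norm R"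
    by (rule sum_diagonal_le_trace_norm[OF R tc orthonormal_basis_haar]) (simp add: J)
  finally show ?thesis .
qed

lemma kernel_measurable: "is_kernel T K \<Longrightarrow> K \<in> borel_measurable borel"
  by (simp add: is_kernel_def L2_def)

lemma dyadic_diameter: "x \<in> dyadic N j \<Longrightarrow> y \<in> dyadic N j \<Longrightarrow> \<bar>y - x\<bar> < 1 / 2 ^ N"
proof -
  assume "x \<in> dyadic N j" "y \<in> dyadic N j"
  then have "\<bar>y - x\<bar> < (real_of_int j + 1) / 2 ^ N - real_of_int j / 2 ^ N"
    unfolding dyadic_eq atLeastLessThan_iff by linarith
  then show ?thesis by (simp add: add_divide_distrib)
qed

text \<open>The substitution \<open>Y = X + z\<close> and Tonelli's theorem turn a neighbourhood of the diagonal into a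
  short integral over shifts.\<close>

lemma nn_integral_near_diagonal:
  fixes K :: "real \<times> real \<Rightarrow> complex"
  assumes K [measurable]: "K \<in> borel_measurable borel"
    and near: "\<And>z. \<bar>z\<bar> < r \<Longrightarrow> (\<integral>\<^sup>+X. ennreal (cmod (K (X, X + z) - K (X, X))) \<partial>lborel) \<le> ennreal \<eta>"
    and r: "r > 0" and "\<eta> \<ge> 0"
  shows "(\<integral>\<^sup>+X. \<integral>\<^sup>+Y. indicator {Y. \<bar>Y - X\<bar> < r} Y * ennreal (cmod (K (X, Y) - K (X, X))) \<partial>lborel \<partial>lborel)
     \<le> ennreal (2 * r * \<eta>)"
proof -
  have "(\<integral>\<^sup>+X. \<integral>\<^sup>+Y. indicator {Y. \<bar>Y - X\<bar> < r} Y * ennreal (cmod (K (X, Y) - K (X, X))) \<partial>lborel \<partial>lborel)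
    = (\<integral>\<^sup>+X. \<integral>\<^sup>+z. indicator {z. \<bar>z\<bar> < r} z * ennreal (cmod (K (X, X + z) - K (X, X))) \<partial>lborel \<partial>lborel)"
  proof (rule nn_integral_cong)
    fix X :: real
    show "(\<integral>\<^sup>+Y. indicator {Y. \<bar>Y - X\<bar> < r} Y * ennreal (cmod (K (X, Y) - K (X, X))) \<partial>lborel)
      = (\<integral>\<^sup>+z. indicator {z. \<bar>z\<bar> < r} z * ennreal (cmod (K (X, X + z) - K (X, X))) \<partial>lborel)"
      by (subst nn_integral_real_affine[of _ 1 X]) (auto simp: indicator_def)
  qed
  also have "\<dots> = (\<integral>\<^sup>+z. \<integral>\<^sup>+X. indicator {z. \<bar>z\<bar> < r} z * ennreal (cmod (K (X, X + z) - K (X, X))) \<partial>lborel \<partial>lborel)"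
    by (rule lborel_pair.Fubini'[symmetric]) (simp add: split_beta' borel_prod)
  also have "\<dots> \<le> (\<integral>\<^sup>+z. indicator {-r<..<r} z * ennreal \<eta> \<partial>lborel)"
  proof (rule nn_integral_mono)
    fix z :: real
    show "(\<integral>\<^sup>+X. indicator {z. \<bar>z\<bar> < r} z * ennreal (cmod (K (X, X + z) - K (X, X))) \<partial>lborel)
        \<le> indicator {-r<..<r} z * ennreal \<eta>"
      using near[of z] by (cases "\<bar>z\<bar> < r") (auto simp: indicator_def)
  qed
  also have "\<dots> = ennreal (2 * r * \<eta>)"
    using r \<open>\<eta> \<ge> 0\<close> by (subst nn_integral_multc) (auto simp flip: ennreal_mult')
  finally show ?thesis .
qed

text \<open>Where the right-hand side is finite, the slice \<open>K(X, \<cdot>)\<close> is integrable on the dyadic interval, and the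
  estimate is the triangle inequality; where it is infinite there is nothing to prove.\<close>

lemma block_average_near_diagonal:
  fixes K :: "real \<times> real \<Rightarrow> complex" and N :: nat and j :: int
  assumes K [measurable]: "K \<in> borel_measurable borel"
  defines "D \<equiv> dyadic N j"
  shows "ennreal (cmod (indicator D X * (2 ^ N * (\<integral>Y. indicator D Y * K (X, Y) \<partial>lborel)) - indicator D X * K (X, X)))
     \<le> indicator D X * (2 ^ N * (\<integral>\<^sup>+Y. indicator {Y. \<bar>Y - X\<bar> < 1 / 2 ^ N} Y * ennreal (cmod (K (X, Y) - K (X, X))) \<partial>lborel))"
    (is "?l \<le> indicator D X * (2 ^ N * ?r)")
proof (cases "X \<in> D \<and> ?r < \<infinity>")
  case True
  have le: "(\<integral>\<^sup>+Y. indicator D Y * ennreal (cmod (K (X, Y) - K (X, X))) \<partial>lborel) \<le> ?r"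
    using True dyadic_diameter[of X N j] by (intro nn_integral_mono) (auto simp: indicator_def D_def)
  have eq: "(\<lambda>Y. ennreal (norm (indicator D Y * (K (X, Y) - K (X, X))))) = (\<lambda>Y. indicator D Y * ennreal (cmod (K (X, Y) - K (X, X))))"
    by (auto simp: indicator_def)
  have i1: "integrable lborel (\<lambda>Y. indicator D Y * (K (X, Y) - K (X, X)))"
    unfolding integrable_iff_bounded
  proof
    show "(\<integral>\<^sup>+Y. ennreal (norm (indicator D Y * (K (X, Y) - K (X, X)))) \<partial>lborel) < \<infinity>"
      unfolding eq using le True by (meson le_less_trans)
  qed (simp add: D_def)
  have i2: "has_bochner_integral lborel (\<lambda>Y. complex_of_real (indicator D Y) * K (X, X)) (complex_of_real (1 / 2 ^ N) * K (X, X))"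
    by (intro has_bochner_integral_mult_left has_bochner_integral_of_real)
       (use has_bochner_integral_real_indicator[of D lborel] in \<open>simp add: D_def emeasure_dyadic measure_dyadic\<close>)
  have "(\<integral>Y. indicator D Y * K (X, Y) \<partial>lborel)
      = (\<integral>Y. indicator D Y * (K (X, Y) - K (X, X)) + complex_of_real (indicator D Y) * K (X, X) \<partial>lborel)"
    by (intro Bochner_Integration.integral_cong) (auto simp: indicator_def)
  also have "\<dots> = (\<integral>Y. indicator D Y * (K (X, Y) - K (X, X)) \<partial>lborel) + complex_of_real (1 / 2 ^ N) * K (X, X)"
    using i1 i2 by (subst Bochner_Integration.integral_add) (auto dest: has_bochner_integral_integral_eq integrable.intros)
  finally have "2 ^ N * (\<integral>Y. indicator D Y * K (X, Y) \<partial>lborel) - K (X, X)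
      = 2 ^ N * (\<integral>Y. indicator D Y * (K (X, Y) - K (X, X)) \<partial>lborel)"
    by (simp add: algebra_simps)
  then have "?l = ennreal (2 ^ N * cmod (\<integral>Y. indicator D Y * (K (X, Y) - K (X, X)) \<partial>lborel))"
    using True by (simp add: norm_mult norm_power)
  also have "\<dots> = 2 ^ N * ennreal (cmod (\<integral>Y. indicator D Y * (K (X, Y) - K (X, X)) \<partial>lborel))"
    by (simp add: ennreal_mult' ennreal_power[symmetric])
  also have "\<dots> \<le> 2 ^ N * (\<integral>\<^sup>+Y. ennreal (norm (indicator D Y * (K (X, Y) - K (X, X)))) \<partial>lborel)"
    by (intro mult_left_mono integral_norm_bound_ennreal i1) auto
  also have "\<dots> \<le> 2 ^ N * ?r" unfolding eq by (intro mult_left_mono le) auto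
  finally show ?thesis using True by simp
next
  case False
  then have "X \<notin> D \<or> ?r = \<infinity>" by (auto simp: not_less top_unique)
  then show ?thesis by (auto simp: indicator_def ennreal_mult_top)
qed

text \<open>Integrals of the diagonal against dyadic step functions with values in the unit disc. The error
  term \<open>E j\<close> is the difference between a block average of the kernel and the diagonal.\<close>

lemma dyadic_step_diagonal_bound:
  assumes R: "self_adjoint R" and tc: "trace_class R" and K: "is_kernel R K"
    and \<rho>: "integrable lborel (\<lambda>X. K (X, X))" and J: "finite J"
    and W: "\<And>j. cmod (W j) \<le> 1" and "\<eta> \<ge> 0"
    and near: "\<And>z. \<bar>z\<bar> < 1 / 2 ^ N \<Longrightarrow> (\<integral>\<^sup>+X. ennreal (cmod (K (X, X + z) - K (X, X))) \<partial>lborel) \<le> ennreal \<eta>"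
  shows "cmod (\<Sum>j\<in>J. W j * (\<integral>X. indicator (dyadic N j) X * K (X, X) \<partial>lborel)) \<le> trace_norm R + 2 * \<eta>"
proof -
  have [measurable]: "K \<in> borel_measurable borel" by (rule kernel_measurable[OF K])
  have bR: "bounded_operator R" using R by (simp add: self_adjoint_def is_adjoint_def)
  define G where "G j = (\<lambda>x. complex_of_real (haar N (0, j) x))" for j
  have GL: "G j \<in> L2" for j unfolding G_def by (rule haar_complex_L2)
  define A where "A j X = indicator (dyadic N j) X * (2 ^ N * (\<integral>Y. indicator (dyadic N j) Y * K (X, Y) \<partial>lborel))" for j X
  have Am [measurable]: "A j \<in> borel_measurable borel" for j
    unfolding A_def by measurable
  have GA: "AE X in lborel. cnj (G j X) * R (G j) X = A j X" for j
  proof -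
    have "AE X in lborel. R (G j) X = (\<integral>Y. K (X, Y) * G j Y \<partial>lborel)"
      using K GL by (auto simp: is_kernel_def)
    then show ?thesis
    proof eventually_elim
      case (elim X)
      have "(\<integral>Y. K (X, Y) * G j Y \<partial>lborel) = (\<integral>Y. complex_of_real (sqrt (2 ^ N)) * (indicator (dyadic N j) Y * K (X, Y)) \<partial>lborel)"
        by (intro Bochner_Integration.integral_cong) (auto simp: G_def indicator_def)
      also have "\<dots> = complex_of_real (sqrt (2 ^ N)) * (\<integral>Y. indicator (dyadic N j) Y * K (X, Y) \<partial>lborel)" by simp
      finally have e: "R (G j) X = complex_of_real (sqrt (2 ^ N)) * (\<integral>Y. indicator (dyadic N j) Y * K (X, Y) \<partial>lborel)"
        using elim by simp
      have "complex_of_real (sqrt (2 ^ N)) * complex_of_real (sqrt (2 ^ N)) = 2 ^ N"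
        by (simp flip: of_real_mult)
      then show ?case unfolding e A_def by (auto simp: G_def indicator_def mult.assoc[symmetric])
    qed
  qed
  have RGm [measurable]: "R (G j) \<in> borel_measurable borel" "G j \<in> borel_measurable borel" for j
    using GL bounded_operator_L2[OF bR GL] by (auto intro: L2_measurable)
  have Aint: "integrable lborel (A j)" for j
    using L2_product_integrable[OF GL bounded_operator_L2[OF bR GL], of j j] GA[of j]
    by (subst (asm) integrable_cong_AE[OF _ _ GA]) auto
  have AI: "(\<integral>X. A j X \<partial>lborel) = L2_inner (G j) (R (G j))" for j
    unfolding L2_inner_def by (rule integral_cong_AE[symmetric]) (use GA in auto)
  define E where "E j X = A j X - indicator (dyadic N j) X * K (X, X)" for j X
  have I\<rho>: "integrable lborel (\<lambda>X. indicator (dyadic N j) X * K (X, X))" for j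
  proof -
    have "(\<lambda>X. indicator (dyadic N j) X *\<^sub>R K (X, X)) = (\<lambda>X. indicator (dyadic N j) X * K (X, X))"
      by (auto simp: indicator_def)
    then show ?thesis using integrable_mult_indicator[OF _ \<rho>, of "dyadic N j"] by simp
  qed
  have Eint: "integrable lborel (E j)" for j unfolding E_def by (intro Bochner_Integration.integrable_diff Aint I\<rho>)
  have EI: "(\<integral>X. indicator (dyadic N j) X * K (X, X) \<partial>lborel) = L2_inner (G j) (R (G j)) - (\<integral>X. E j X \<partial>lborel)" for j
    unfolding E_def by (subst Bochner_Integration.integral_diff[OF Aint I\<rho>]) (simp add: AI)
  let ?H = "\<lambda>X. 2 ^ N * (\<integral>\<^sup>+Y. indicator {Y. \<bar>Y - X\<bar> < 1 / 2 ^ N} Y * ennreal (cmod (K (X, Y) - K (X, X))) \<partial>lborel)"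
  have "ennreal (\<Sum>j\<in>J. cmod (\<integral>X. E j X \<partial>lborel)) = (\<Sum>j\<in>J. ennreal (cmod (\<integral>X. E j X \<partial>lborel)))"
    by (simp add: sum_ennreal)
  also have "\<dots> \<le> (\<Sum>j\<in>J. \<integral>\<^sup>+X. ennreal (cmod (E j X)) \<partial>lborel)"
    by (intro sum_mono integral_norm_bound_ennreal Eint)
  also have "\<dots> \<le> (\<Sum>j\<in>J. \<integral>\<^sup>+X. indicator (dyadic N j) X * ?H X \<partial>lborel)"
    unfolding E_def A_def by (intro sum_mono nn_integral_mono block_average_near_diagonal) measurable
  also have "\<dots> = (\<integral>\<^sup>+X. (\<Sum>j\<in>J. indicator (dyadic N j) X * ?H X) \<partial>lborel)"
    by (rule nn_integral_sum[symmetric]) measurable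
  also have "\<dots> \<le> (\<integral>\<^sup>+X. ?H X \<partial>lborel)"
  proof (rule nn_integral_mono)
    fix X
    have "(\<Sum>j\<in>J. indicator (dyadic N j) X * ?H X) = (\<Sum>j\<in>J \<inter> {\<lfloor>2 ^ N * X\<rfloor>}. ?H X)"
      using J by (intro sum.mono_neutral_cong_right) (auto simp: dyadic_def indicator_def split: if_splits)
    also have "\<dots> \<le> (\<Sum>j\<in>{\<lfloor>2 ^ N * X\<rfloor>}. ?H X)"
      by (intro sum_mono2) auto
    finally show "(\<Sum>j\<in>J. indicator (dyadic N j) X * ?H X) \<le> ?H X" by simp
  qed
  also have "\<dots> = 2 ^ N * (\<integral>\<^sup>+X. \<integral>\<^sup>+Y. indicator {Y. \<bar>Y - X\<bar> < 1 / 2 ^ N} Y * ennreal (cmod (K (X, Y) - K (X, X))) \<partial>lborel \<partial>lborel)"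
    by (rule nn_integral_cmult) measurable
  also have "\<dots> \<le> 2 ^ N * ennreal (2 * (1 / 2 ^ N) * \<eta>)"
    using near \<open>\<eta> \<ge> 0\<close> by (intro mult_left_mono nn_integral_near_diagonal) auto
  also have "\<dots> = ennreal (2 ^ N * (2 * (1 / 2 ^ N) * \<eta>))"
    using \<open>\<eta> \<ge> 0\<close> by (subst ennreal_mult') (auto simp: ennreal_power[symmetric])
  finally have Ebound: "(\<Sum>j\<in>J. cmod (\<integral>X. E j X \<partial>lborel)) \<le> 2 * \<eta>"
    using \<open>\<eta> \<ge> 0\<close> by (simp add: ennreal_le_iff)
  have "cmod (\<Sum>j\<in>J. W j * (\<integral>X. indicator (dyadic N j) X * K (X, X) \<partial>lborel))
     \<le> (\<Sum>j\<in>J. cmod (W j * (\<integral>X. indicator (dyadic N j) X * K (X, X) \<partial>lborel)))" by (rule norm_sum)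
  also have "\<dots> \<le> (\<Sum>j\<in>J. cmod (L2_inner (G j) (R (G j))) + cmod (\<integral>X. E j X \<partial>lborel))"
  proof (rule sum_mono)
    fix j
    have "cmod (W j * (\<integral>X. indicator (dyadic N j) X * K (X, X) \<partial>lborel)) \<le> 1 * cmod (\<integral>X. indicator (dyadic N j) X * K (X, X) \<partial>lborel)"
      unfolding norm_mult by (intro mult_right_mono W) auto
    also have "\<dots> \<le> cmod (L2_inner (G j) (R (G j))) + cmod (\<integral>X. E j X \<partial>lborel)"
      unfolding EI by (simp add: norm_triangle_ineq4)
    finally show "cmod (W j * (\<integral>X. indicator (dyadic N j) X * K (X, X) \<partial>lborel)) \<le> \<dots>" .
  qed
  also have "\<dots> \<le> trace_norm R + 2 * \<eta>"
    unfolding sum.distrib using sum_dyadic_blocks_le_trace_norm[OF R tc J G_def] Ebound by (intro add_mono)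
  finally show ?thesis .
qed


lemma cmod_iexp_diff_le:
  "cmod (exp (\<i> * complex_of_real a) - exp (\<i> * complex_of_real b)) \<le> \<bar>a - b\<bar>"
proof -
  have "exp (\<i> * complex_of_real a) - exp (\<i> * complex_of_real b)
      = exp (\<i> * complex_of_real b) * (exp (\<i> * complex_of_real (a - b)) - 1)"
    by (simp add: algebra_simps flip: exp_add)
  also have "cmod \<dots> = cmod (exp (\<i> * complex_of_real (a - b)) - 1)"
    by (simp only: norm_mult norm_exp_i_times mult_1)
  also have "\<dots> \<le> \<bar>a - b\<bar>" using iexp_approx1[of "a - b" 0] by simp
  finally show ?thesis .
qed

text \<open>The exponential is approximated by a step function on dyadic intervals of length \<open>2\<^sup>-\<^sup>N\<close>, which is first
  truncated to a bounded interval.\<close>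

lemma diagonal_fourier_le_trace_norm:
  assumes R: "self_adjoint R" and tc: "trace_class R" and K: "is_continuous_kernel R K"
  shows "cmod (\<integral>X. exp (- \<i> * complex_of_real (\<xi> * X)) * K (X, X) \<partial>lborel) \<le> trace_norm R"
proof -
  have ker: "is_kernel R K" using K by (simp add: is_continuous_kernel_def)
  have [measurable]: "K \<in> borel_measurable borel" by (rule kernel_measurable[OF ker])
  have Cb: "(\<lambda>z X. K (X, X + z)) \<in> Cb_L1" using K by (simp add: is_continuous_kernel_def)
  have Fint: "integrable lborel (\<lambda>X. K (X, X + z))" for z using Cb by (auto simp: Cb_L1_def)
  have \<rho>: "integrable lborel (\<lambda>X. K (X, X))" using Fint[of 0] by simp
  have cont: "((\<lambda>w. \<integral>x. cmod (K (x, x + w) - K (x, x)) \<partial>lborel) \<longlongrightarrow> 0) (at 0)"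
  proof -
    have "((\<lambda>w. \<integral>x. cmod (K (x, x + w) - K (x, x + 0)) \<partial>lborel) \<longlongrightarrow> 0) (at 0)"
      using Cb unfolding Cb_L1_def mem_Collect_eq by blast
    then show ?thesis by simp
  qed
  define r where "r = (\<integral>X. cmod (K (X, X)) \<partial>lborel)"
  have r0: "r \<ge> 0" by (simp add: r_def)
  let ?e = "\<lambda>X. exp (- \<i> * complex_of_real (\<xi> * X))"
  have "cmod (\<integral>X. ?e X * K (X, X) \<partial>lborel) \<le> trace_norm R + 3 * \<eta>" if eta: "\<eta> > 0" for \<eta>
  proof -
    obtain d where d: "d > 0" "\<And>w. w \<noteq> 0 \<Longrightarrow> \<bar>w\<bar> < d \<Longrightarrow> (\<integral>x. cmod (K (x, x + w) - K (x, x)) \<partial>lborel) < \<eta>"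
      using order_tendstoD(2)[OF cont eta] unfolding eventually_at by (auto simp: dist_real_def)
    \<comment> \<open>The second bound on the mesh makes the oscillation of the exponential cost at most \<open>\<eta>\<close>.\<close>
    define d' where "d' = min d (\<eta> / (\<bar>\<xi>\<bar> * r + 1))"
    have d': "d' > 0" using d(1) eta r0 by (auto simp: d'_def intro!: divide_pos_pos add_nonneg_pos)
    obtain N where "(1/2) ^ N < d'" using real_arch_pow_inv[OF d', of "1/2"] by auto
    then have N: "1 / 2 ^ N < d" "1 / 2 ^ N < \<eta> / (\<bar>\<xi>\<bar> * r + 1)" by (auto simp: d'_def power_one_over)
    have near: "(\<integral>\<^sup>+X. ennreal (cmod (K (X, X + z) - K (X, X))) \<partial>lborel) \<le> ennreal \<eta>" if "\<bar>z\<bar> < 1 / 2 ^ N" for z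
    proof (cases "z = 0")
      case False
      have "integrable lborel (\<lambda>X. cmod (K (X, X + z) - K (X, X)))"
        by (intro integrable_norm Bochner_Integration.integrable_diff Fint \<rho>)
      then have "(\<integral>\<^sup>+X. ennreal (cmod (K (X, X + z) - K (X, X))) \<partial>lborel) = ennreal (\<integral>X. cmod (K (X, X + z) - K (X, X)) \<partial>lborel)"
        by (rule nn_integral_eq_integral) simp
      also have "\<dots> \<le> ennreal \<eta>" using d(2)[OF False] that N(1) by (intro ennreal_leI) simp
      finally show ?thesis .
    qed simp
    define W where "W j = ?e (real_of_int j / 2 ^ N)" for j :: int
    have W1: "cmod (W j) \<le> 1" for j by (simp add: W_def)
    define w where "w X = W \<lfloor>2 ^ N * X\<rfloor>" for X :: real
    have wm [measurable]: "w \<in> borel_measurable borel" unfolding w_def W_def by measurable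
    define B where "B m = {X :: real. \<lfloor>2 ^ N * X\<rfloor> \<in> {- int m..int m}}" for m
    have Bm [measurable]: "B m \<in> sets borel" for m
    proof -
      have "B m = {X \<in> space borel. \<lfloor>2 ^ N * X\<rfloor> \<in> {- int m..int m}}" by (simp add: B_def)
      then show ?thesis by simp
    qed
    have I\<rho>: "integrable lborel (\<lambda>X. indicator (dyadic N j) X * K (X, X))" for j
    proof -
      have "(\<lambda>X. indicator (dyadic N j) X *\<^sub>R K (X, X)) = (\<lambda>X. indicator (dyadic N j) X * K (X, X))"
        by (auto simp: indicator_def)
      then show ?thesis using integrable_mult_indicator[OF _ \<rho>, of "dyadic N j"] by simp
    qed
    have step: "cmod (\<integral>X. indicator (B m) X * (w X * K (X, X)) \<partial>lborel) \<le> trace_norm R + 2 * \<eta>" for m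
    proof -
      have "indicator (B m) X * (w X * K (X, X)) = (\<Sum>j\<in>{- int m..int m}. W j * (indicator (dyadic N j) X * K (X, X)))" for X
      proof -
        have "(\<Sum>j\<in>{- int m..int m}. W j * (indicator (dyadic N j) X * K (X, X)))
          = (\<Sum>j\<in>{- int m..int m} \<inter> {\<lfloor>2 ^ N * X\<rfloor>}. W j * K (X, X))"
          by (intro sum.mono_neutral_cong_right) (auto simp: dyadic_def indicator_def split: if_splits)
        also have "\<dots> = indicator (B m) X * (w X * K (X, X))"
          by (cases "\<lfloor>2 ^ N * X\<rfloor> \<in> {- int m..int m}") (simp_all add: B_def w_def)
        finally show ?thesis by simp
      qed
      then have "(\<integral>X. indicator (B m) X * (w X * K (X, X)) \<partial>lborel)
         = (\<integral>X. (\<Sum>j\<in>{- int m..int m}. W j * (indicator (dyadic N j) X * K (X, X))) \<partial>lborel)" by simp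
      also have "\<dots> = (\<Sum>j\<in>{- int m..int m}. W j * (\<integral>X. indicator (dyadic N j) X * K (X, X) \<partial>lborel))"
        by (subst Bochner_Integration.integral_sum) (auto intro!: integrable_mult_right I\<rho>)
      finally show ?thesis
        using dyadic_step_diagonal_bound[OF R tc ker \<rho> _ W1, of "{- int m..int m}" \<eta> N] near \<open>\<eta> > 0\<close> by simp
    qed
    have wle: "cmod (w X) \<le> 1" for X by (simp add: w_def W1)
    have int_w: "integrable lborel (\<lambda>X. w X * K (X, X))"
      by (rule Bochner_Integration.integrable_bound[OF \<rho>]) (auto simp: norm_mult intro!: mult_left_le_one_le wle)
    have int_e: "integrable lborel (\<lambda>X. ?e X * K (X, X))"
      by (rule Bochner_Integration.integrable_bound[OF \<rho>]) (auto simp: norm_mult)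
    have lim: "(\<lambda>m. \<integral>X. indicator (B m) X * (w X * K (X, X)) \<partial>lborel) \<longlonglongrightarrow> (\<integral>X. w X * K (X, X) \<partial>lborel)"
    proof (rule integral_dominated_convergence[where w="\<lambda>X. cmod (w X * K (X, X))"])
      show "integrable lborel (\<lambda>X. cmod (w X * K (X, X)))" by (intro integrable_norm int_w)
      show "AE X in lborel. (\<lambda>m. indicator (B m) X * (w X * K (X, X))) \<longlonglongrightarrow> w X * K (X, X)"
      proof (rule AE_I2)
        fix X :: real
        have "eventually (\<lambda>m. indicator (B m) X * (w X * K (X, X)) = w X * K (X, X)) sequentially"
          using eventually_ge_at_top[of "nat \<bar>\<lfloor>2 ^ N * X\<rfloor>\<bar>"]
          by eventually_elim (auto simp: B_def indicator_def)
        then show "(\<lambda>m. indicator (B m) X * (w X * K (X, X))) \<longlonglongrightarrow> w X * K (X, X)"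
          by (rule tendsto_eventually)
      qed
    qed (auto simp: indicator_def)
    have bw: "cmod (\<integral>X. w X * K (X, X) \<partial>lborel) \<le> trace_norm R + 2 * \<eta>"
      by (rule LIMSEQ_le_const2[OF tendsto_norm[OF lim]]) (use step in blast)
    have ew: "cmod (?e X - w X) \<le> \<bar>\<xi>\<bar> / 2 ^ N" for X
    proof -
      define a where "a = real_of_int \<lfloor>2 ^ N * X\<rfloor> / 2 ^ N"
      have "\<bar>X - a\<bar> \<le> 1 / 2 ^ N"
      proof -
        have "X \<in> dyadic N \<lfloor>2 ^ N * X\<rfloor>" "a \<in> dyadic N \<lfloor>2 ^ N * X\<rfloor>"
          by (simp_all add: dyadic_def a_def)
        from dyadic_diameter[OF this(2,1)] show ?thesis by simp
      qed
      have "?e X - w X = exp (\<i> * complex_of_real (- (\<xi> * X))) - exp (\<i> * complex_of_real (- (\<xi> * a)))"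
        by (simp add: w_def W_def a_def)
      also have "cmod \<dots> \<le> \<bar>- (\<xi> * X) - - (\<xi> * a)\<bar>"
        by (rule cmod_iexp_diff_le)
      also have "\<dots> = \<bar>\<xi>\<bar> * \<bar>X - a\<bar>" by (simp add: abs_mult[symmetric] algebra_simps abs_minus_commute)
      also have "\<dots> \<le> \<bar>\<xi>\<bar> * (1 / 2 ^ N)" using \<open>\<bar>X - a\<bar> \<le> 1 / 2 ^ N\<close> by (rule mult_left_mono) simp
      finally show ?thesis by simp
    qed
    have "cmod ((\<integral>X. ?e X * K (X, X) \<partial>lborel) - (\<integral>X. w X * K (X, X) \<partial>lborel))
       = cmod (\<integral>X. (?e X - w X) * K (X, X) \<partial>lborel)"
      by (subst Bochner_Integration.integral_diff[OF int_e int_w, symmetric]) (simp add: algebra_simps)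
    also have "\<dots> \<le> (\<integral>X. \<bar>\<xi>\<bar> / 2 ^ N * cmod (K (X, X)) \<partial>lborel)"
    proof (rule Bochner_Integration.integral_norm_bound_integral)
      show "integrable lborel (\<lambda>X. (?e X - w X) * K (X, X))"
        using Bochner_Integration.integrable_diff[OF int_e int_w] by (simp add: algebra_simps)
      show "integrable lborel (\<lambda>X. \<bar>\<xi>\<bar> / 2 ^ N * cmod (K (X, X)))"
        by (intro integrable_mult_right integrable_norm \<rho>)
      show "cmod ((?e X - w X) * K (X, X)) \<le> \<bar>\<xi>\<bar> / 2 ^ N * cmod (K (X, X))" for X
        unfolding norm_mult by (intro mult_right_mono ew) simp
    qed
    also have "\<dots> = \<bar>\<xi>\<bar> * r * (1 / 2 ^ N)" by (simp add: r_def)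
    also have "\<dots> \<le> \<bar>\<xi>\<bar> * r * (\<eta> / (\<bar>\<xi>\<bar> * r + 1))"
      using N(2) r0 by (intro mult_left_mono) auto
    also have "\<dots> \<le> \<eta>"
    proof -
      have "\<bar>\<xi>\<bar> * r + 1 > 0" using r0 by (intro add_nonneg_pos) auto
      then show ?thesis using \<open>\<eta> > 0\<close> by (simp add: field_simps)
    qed
    finally show ?thesis using bw norm_triangle_sub[of "\<integral>X. ?e X * K (X, X) \<partial>lborel" "\<integral>X. w X * K (X, X) \<partial>lborel"] by linarith
  qed
  note bound = this
  show ?thesis
  proof (rule field_le_epsilon)
    fix \<eta> :: real assume "\<eta> > 0"
    then show "cmod (\<integral>X. ?e X * K (X, X) \<partial>lborel) \<le> trace_norm R + \<eta>" using bound[of "\<eta> / 3"] by simp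
  qed
qed

section \<open>The Fourier transform on the line\<close>

text \<open>The Fourier transform without the factor \<open>1 / sqrt (2 \<pi>)\<close>. It is \<open>0\<close> wherever the integrand is not
  integrable, by the convention for the Bochner integral.\<close>

definition ft :: "(real \<Rightarrow> complex) \<Rightarrow> real \<Rightarrow> complex" where
  "ft f \<xi> = (\<integral>x. exp (- \<i> * complex_of_real (\<xi> * x)) * f x \<partial>lborel)"

lemma ft_measurable [measurable]:
  assumes [measurable]: "f \<in> borel_measurable borel"
  shows "ft f \<in> borel_measurable borel"
  unfolding ft_def by measurable

lemma ft_integrand_integrable:
  "integrable lborel f \<Longrightarrow> integrable lborel (\<lambda>x. exp (- \<i> * complex_of_real (\<xi> * x)) * f x)"
  by (rule Bochner_Integration.integrable_bound[where f="\<lambda>x. f x"]) (auto simp: norm_mult)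

lemma ft_bound: "integrable lborel f \<Longrightarrow> cmod (ft f \<xi>) \<le> (\<integral>x. cmod (f x) \<partial>lborel)"
proof -
  assume "integrable lborel f"
  have "cmod (ft f \<xi>) \<le> (\<integral>x. cmod (exp (- \<i> * complex_of_real (\<xi> * x)) * f x) \<partial>lborel)"
    unfolding ft_def by (rule integral_norm_bound)
  then show ?thesis by (simp add: norm_mult)
qed

lemma ft_multiplication_formula:
  assumes f: "integrable lborel f" and h: "integrable lborel h"
  shows "(\<integral>\<xi>. h \<xi> * ft f \<xi> \<partial>lborel) = (\<integral>x. ft h x * f x \<partial>lborel)"
proof -
  have [measurable]: "f \<in> borel_measurable borel" "h \<in> borel_measurable borel"
    using borel_measurable_integrable[OF f] borel_measurable_integrable[OF h] by simp_all
  let ?F = "\<lambda>(\<xi>, x). h \<xi> * (exp (- \<i> * complex_of_real (\<xi> * x)) * f x)"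
  have "integrable (lborel \<Otimes>\<^sub>M lborel) ?F"
  proof (rule lborel_pair.Fubini_integrable)
    show "?F \<in> borel_measurable (lborel \<Otimes>\<^sub>M lborel)" by measurable
    have "(\<lambda>\<xi>. \<integral>x. norm (?F (\<xi>, x)) \<partial>lborel) = (\<lambda>\<xi>. cmod (h \<xi>) * (\<integral>x. cmod (f x) \<partial>lborel))"
      by (simp add: norm_mult)
    then show "integrable lborel (\<lambda>\<xi>. \<integral>x. norm (?F (\<xi>, x)) \<partial>lborel)"
      using h by simp
    show "AE \<xi> in lborel. integrable lborel (\<lambda>x. ?F (\<xi>, x))"
      using ft_integrand_integrable[OF f] by simp
  qed
  then have "(\<integral>x. (\<integral>\<xi>. h \<xi> * (exp (- \<i> * complex_of_real (\<xi> * x)) * f x) \<partial>lborel) \<partial>lborel)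
    = (\<integral>\<xi>. (\<integral>x. h \<xi> * (exp (- \<i> * complex_of_real (\<xi> * x)) * f x) \<partial>lborel) \<partial>lborel)"
    by (rule lborel_pair.Fubini_integral)
  moreover have "(\<integral>\<xi>. h \<xi> * (exp (- \<i> * complex_of_real (\<xi> * x)) * f x) \<partial>lborel) = ft h x * f x" for x
  proof -
    have "(\<lambda>\<xi>. h \<xi> * (exp (- \<i> * complex_of_real (\<xi> * x)) * f x)) = (\<lambda>\<xi>. (exp (- \<i> * complex_of_real (x * \<xi>)) * h \<xi>) * f x)"
      by (auto simp: mult_ac)
    then show ?thesis by (simp only: integral_mult_left_zero ft_def)
  qed
  ultimately show ?thesis by (simp add: ft_def)
qed

text \<open>The Gaussian regularizer \<open>exp (- (\<delta> \<xi>)\<^sup>2 / 2)\<close>, which tends to \<open>1\<close> as \<open>\<delta> \<rightarrow> 0\<close>.\<close>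

definition gauss :: "real \<Rightarrow> real \<Rightarrow> real" where
  "gauss \<delta> \<xi> = exp (- ((\<delta> * \<xi>)\<^sup>2) / 2)"

lemma gauss_measurable [measurable]: "gauss \<delta> \<in> borel_measurable borel"
  unfolding gauss_def by measurable

lemma gauss_pos: "gauss \<delta> \<xi> > 0" and gauss_le_1: "gauss \<delta> \<xi> \<le> 1"
  by (simp_all add: gauss_def)

lemma gauss_density: "gauss 1 u = sqrt (2 * pi) * std_normal_density u"
  by (simp add: gauss_def std_normal_density_def)

lemma gauss_integrable: "\<delta> > 0 \<Longrightarrow> integrable lborel (gauss \<delta>)"
proof -
  assume \<delta>: "\<delta> > 0"
  have "integrable lborel (\<lambda>u. gauss 1 u)" unfolding gauss_density by (intro integrable_mult_right integrable_normal_density) simp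
  from lborel_integrable_real_affine[OF this, of \<delta> 0] \<delta>
  show ?thesis by (simp add: gauss_def[abs_def])
qed

lemma std_normal_char:
  "(\<integral>u. exp (\<i> * complex_of_real (t * u)) * complex_of_real (std_normal_density u) \<partial>lborel) = complex_of_real (gauss 1 t)"
proof -
  have "char std_normal_distribution t = (\<integral>u. std_normal_density u *\<^sub>R exp (\<i> * complex_of_real (t * u)) \<partial>lborel)"
    unfolding char_def by (subst integral_density) auto
  then show ?thesis
    by (simp add: char_std_normal_distribution gauss_def scaleR_conv_of_real mult.commute)
qed

lemma ft_gauss:
  assumes \<delta>: "\<delta> > 0"
  shows "ft (\<lambda>\<xi>. complex_of_real (gauss \<delta> \<xi>)) x = complex_of_real (2 * pi / \<delta> * std_normal_density (x / \<delta>))"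
proof -
  have "ft (\<lambda>\<xi>. complex_of_real (gauss \<delta> \<xi>)) x =
     (\<integral>u. (1 / \<delta>) *\<^sub>R (exp (- \<i> * complex_of_real (x * (u / \<delta>))) * complex_of_real (gauss \<delta> (u / \<delta>))) \<partial>lborel)"
    unfolding ft_def
    by (subst lborel_integral_real_affine[where c="1/\<delta>" and t=0]) (use \<delta> in auto)
  also have "\<dots> = (\<integral>u. complex_of_real (sqrt (2 * pi) / \<delta>) * (exp (\<i> * complex_of_real ((- x / \<delta>) * u)) * complex_of_real (std_normal_density u)) \<partial>lborel)"
  proof (rule Bochner_Integration.integral_cong)
    fix u
    have "gauss \<delta> (u / \<delta>) = sqrt (2 * pi) * std_normal_density u"
      using \<delta> by (simp add: gauss_density[symmetric] gauss_def)
    then show "(1 / \<delta>) *\<^sub>R (exp (- \<i> * complex_of_real (x * (u / \<delta>))) * complex_of_real (gauss \<delta> (u / \<delta>)))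
       = complex_of_real (sqrt (2 * pi) / \<delta>) * (exp (\<i> * complex_of_real ((- x / \<delta>) * u)) * complex_of_real (std_normal_density u))"
      by (simp add: scaleR_conv_of_real)
  qed simp
  also have "\<dots> = complex_of_real (sqrt (2 * pi) / \<delta>) * complex_of_real (gauss 1 (- x / \<delta>))"
    by (simp only: integral_mult_right_zero std_normal_char)
  also have "gauss 1 (- x / \<delta>) = sqrt (2 * pi) * std_normal_density (x / \<delta>)"
    by (simp add: gauss_density[symmetric] gauss_def)
  also have "complex_of_real (sqrt (2 * pi) / \<delta>) * complex_of_real (sqrt (2 * pi) * std_normal_density (x / \<delta>))
     = complex_of_real ((sqrt (2 * pi) / \<delta>) * (sqrt (2 * pi) * std_normal_density (x / \<delta>)))"
    by (rule of_real_mult[symmetric])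
  also have "(sqrt (2 * pi) / \<delta>) * (sqrt (2 * pi) * std_normal_density (x / \<delta>)) = 2 * pi / \<delta> * std_normal_density (x / \<delta>)"
  proof -
    have "(s / \<delta>) * (s * n) = (s * s) / \<delta> * n" for s n :: real by simp
    then show ?thesis by (simp only: real_sqrt_mult_self) simp
  qed
  finally show ?thesis .
qed

lemma std_normal_density_even: "std_normal_density (- x) = std_normal_density x"
  by (simp add: std_normal_density_def)

text \<open>Parseval's identity with a Gaussian regularizer, valid for all integrable functions.\<close>

lemma ft_gauss_parseval:
  assumes f: "integrable lborel f" and g: "integrable lborel g" and \<delta>: "\<delta> > 0"
  shows "(\<integral>\<xi>. complex_of_real (gauss \<delta> \<xi>) * cnj (ft g \<xi>) * ft f \<xi> \<partial>lborel) =
    (\<integral>x. cnj (\<integral>y. complex_of_real (2 * pi / \<delta> * std_normal_density ((x - y) / \<delta>)) * g y \<partial>lborel) * f x \<partial>lborel)"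
proof -
  have [measurable]: "f \<in> borel_measurable borel" "g \<in> borel_measurable borel"
    using borel_measurable_integrable[OF f] borel_measurable_integrable[OF g] by simp_all
  define c where "c = (\<integral>x. cmod (g x) \<partial>lborel)"
  have gc: "cmod (ft g \<xi>) \<le> c" for \<xi> unfolding c_def by (rule ft_bound[OF g])
  have c0: "c \<ge> 0" by (simp add: c_def)
  have gi: "integrable lborel (\<lambda>\<xi>. c * gauss \<delta> \<xi>)" by (intro integrable_mult_right gauss_integrable \<delta>)
  have h: "integrable lborel (\<lambda>\<xi>. complex_of_real (gauss \<delta> \<xi>) * cnj (ft g \<xi>))"
  proof (rule Bochner_Integration.integrable_bound[OF gi])
    have "cmod (complex_of_real (gauss \<delta> \<xi>) * cnj (ft g \<xi>)) \<le> norm (c * gauss \<delta> \<xi>)" for \<xi>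
      using mult_right_mono[OF gc[of \<xi>] less_imp_le[OF gauss_pos[of \<delta> \<xi>]]] c0 gauss_pos[of \<delta> \<xi>]
      by (simp add: norm_mult abs_mult mult.commute)
    then show "AE \<xi> in lborel. cmod (complex_of_real (gauss \<delta> \<xi>) * cnj (ft g \<xi>)) \<le> norm (c * gauss \<delta> \<xi>)" by simp
  qed measurable
  have conj: "ft (\<lambda>\<xi>. complex_of_real (gauss \<delta> \<xi>) * cnj (ft g \<xi>)) x =
      cnj (\<integral>y. complex_of_real (2 * pi / \<delta> * std_normal_density ((x - y) / \<delta>)) * g y \<partial>lborel)" for x
  proof -
    let ?k = "\<lambda>\<xi>. exp (\<i> * complex_of_real (x * \<xi>)) * complex_of_real (gauss \<delta> \<xi>)"
    have ki: "integrable lborel ?k"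
      by (rule Bochner_Integration.integrable_bound[OF gauss_integrable[OF \<delta>]]) (auto simp: norm_mult)
    have ky: "ft ?k y = complex_of_real (2 * pi / \<delta> * std_normal_density ((x - y) / \<delta>))" for y
    proof -
      have "ft ?k y = ft (\<lambda>\<xi>. complex_of_real (gauss \<delta> \<xi>)) (y - x)"
        unfolding ft_def
      proof (rule Bochner_Integration.integral_cong[OF refl])
        fix \<xi>
        have "exp (- \<i> * complex_of_real (y * \<xi>)) * exp (\<i> * complex_of_real (x * \<xi>)) = exp (- \<i> * complex_of_real ((y - x) * \<xi>))"
          unfolding exp_add[symmetric] by (simp add: algebra_simps)
        then show "exp (- \<i> * complex_of_real (y * \<xi>)) * (exp (\<i> * complex_of_real (x * \<xi>)) * complex_of_real (gauss \<delta> \<xi>))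
          = exp (- \<i> * complex_of_real ((y - x) * \<xi>)) * complex_of_real (gauss \<delta> \<xi>)"
          by (simp only: mult.assoc[symmetric])
      qed
      also have "\<dots> = complex_of_real (2 * pi / \<delta> * std_normal_density ((y - x) / \<delta>))" by (rule ft_gauss[OF \<delta>])
      also have "std_normal_density ((y - x) / \<delta>) = std_normal_density ((x - y) / \<delta>)"
        using std_normal_density_even[of "(y - x) / \<delta>"] by (simp add: minus_divide_left)
      finally show ?thesis .
    qed
    have "ft (\<lambda>\<xi>. complex_of_real (gauss \<delta> \<xi>) * cnj (ft g \<xi>)) x = (\<integral>\<xi>. cnj (?k \<xi> * ft g \<xi>) \<partial>lborel)"
      unfolding ft_def[of "\<lambda>\<xi>. complex_of_real (gauss \<delta> \<xi>) * cnj (ft g \<xi>)"]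
      by (simp add: exp_cnj mult_ac)
    also have "\<dots> = cnj (\<integral>\<xi>. ?k \<xi> * ft g \<xi> \<partial>lborel)" by (rule Bochner_Integration.integral_cnj)
    also have "(\<integral>\<xi>. ?k \<xi> * ft g \<xi> \<partial>lborel) = (\<integral>y. ft ?k y * g y \<partial>lborel)"
      by (rule ft_multiplication_formula[OF g ki])
    also have "\<dots> = (\<integral>y. complex_of_real (2 * pi / \<delta> * std_normal_density ((x - y) / \<delta>)) * g y \<partial>lborel)"
      by (simp only: ky)
    finally show ?thesis .
  qed
  show ?thesis
    using ft_multiplication_formula[OF f h] by (simp only: conj)
qed

lemma nn_integral_gauss_kernel:
  assumes \<delta>: "\<delta> > 0"
  shows "(\<integral>\<^sup>+y. ennreal (2 * pi / \<delta> * std_normal_density ((x - y) / \<delta>)) \<partial>lborel) = ennreal (2 * pi)"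
proof -
  have "(\<integral>\<^sup>+y. ennreal (2 * pi / \<delta> * std_normal_density ((x - y) / \<delta>)) \<partial>lborel)
     = ennreal \<bar>\<delta>\<bar> * (\<integral>\<^sup>+u. ennreal (2 * pi / \<delta> * std_normal_density ((x - (x + \<delta> * u)) / \<delta>)) \<partial>lborel)"
    by (rule nn_integral_real_affine) (use \<delta> in auto)
  also have "(\<integral>\<^sup>+u. ennreal (2 * pi / \<delta> * std_normal_density ((x - (x + \<delta> * u)) / \<delta>)) \<partial>lborel)
     = (\<integral>\<^sup>+u. ennreal (2 * pi / \<delta>) * ennreal (std_normal_density u) \<partial>lborel)"
    using \<delta> by (intro nn_integral_cong, subst ennreal_mult'[symmetric]) (simp_all add: std_normal_density_even)
  also have "\<dots> = ennreal (2 * pi / \<delta>) * (\<integral>\<^sup>+u. ennreal (std_normal_density u) \<partial>lborel)"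
    by (rule nn_integral_cmult) simp
  also have "(\<integral>\<^sup>+u. ennreal (std_normal_density u) \<partial>lborel) = 1"
    by (subst nn_integral_eq_integral) auto
  also have "ennreal \<bar>\<delta>\<bar> * (ennreal (2 * pi / \<delta>) * 1) = ennreal (\<bar>\<delta>\<bar> * (2 * pi / \<delta>))"
    using \<delta> by (subst ennreal_mult') auto
  also have "\<bar>\<delta>\<bar> * (2 * pi / \<delta>) = 2 * pi" using \<delta> by simp
  finally show ?thesis .
qed

lemma gauss_tendsto_1: "(\<lambda>n. gauss (1 / real (Suc n)) \<xi>) \<longlonglongrightarrow> 1"
proof -
  have "(\<lambda>n. exp (- ((1 / real (Suc n) * \<xi>)\<^sup>2) / 2)) \<longlonglongrightarrow> exp (- ((0 * \<xi>)\<^sup>2) / 2)"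
    by (intro tendsto_intros LIMSEQ_Suc lim_1_over_n) auto
  then show ?thesis by (simp add: gauss_def)
qed

text \<open>By the regularized Parseval identity and \<open>|f(x) f(y)| \<le> (|f(x)|\<^sup>2 + |f(y)|\<^sup>2) / 2\<close>, the Gaussian weighted integral
  is at most \<open>2 \<pi> \<integral>|f|\<^sup>2\<close>; Fatou's lemma removes the weight.\<close>

lemma plancherel_le:
  assumes f: "integrable lborel f"
  shows "(\<integral>\<^sup>+\<xi>. ennreal ((cmod (ft f \<xi>))\<^sup>2) \<partial>lborel) \<le> ennreal (2 * pi) * (\<integral>\<^sup>+x. ennreal ((cmod (f x))\<^sup>2) \<partial>lborel)"
proof -
  have [measurable]: "f \<in> borel_measurable borel"
    using borel_measurable_integrable[OF f] by simp
  let ?S = "\<integral>\<^sup>+x. ennreal ((cmod (f x))\<^sup>2) \<partial>lborel"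
  have reg: "(\<integral>\<^sup>+\<xi>. ennreal (gauss \<delta> \<xi> * (cmod (ft f \<xi>))\<^sup>2) \<partial>lborel) \<le> ennreal (2 * pi) * ?S" if \<delta>: "\<delta> > 0" for \<delta>
  proof (cases "?S = \<infinity>")
    case False
    define \<Gamma> where "\<Gamma> x y = 2 * pi / \<delta> * std_normal_density ((x - y) / \<delta>)" for x y
    have [measurable]: "(\<lambda>(x, y). \<Gamma> x y) \<in> borel_measurable (borel \<Otimes>\<^sub>M borel)" unfolding \<Gamma>_def by measurable
    have \<Gamma>0: "\<Gamma> x y \<ge> 0" for x y using \<delta> by (simp add: \<Gamma>_def)
    have \<Gamma>sym: "\<Gamma> x y = \<Gamma> y x" for x y
      unfolding \<Gamma>_def using std_normal_density_even[of "(x - y) / \<delta>"] by (simp add: minus_divide_left)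
    have \<Gamma>1: "(\<integral>\<^sup>+y. ennreal (\<Gamma> x y) \<partial>lborel) = ennreal (2 * pi)" for x
      unfolding \<Gamma>_def by (rule nn_integral_gauss_kernel[OF \<delta>])
    define G where "G x = (\<integral>y. complex_of_real (\<Gamma> x y) * f y \<partial>lborel)" for x
    have Gm [measurable]: "G \<in> borel_measurable borel" unfolding G_def by measurable
    define c where "c = (\<integral>x. cmod (f x) \<partial>lborel)"
    have fc: "cmod (ft f \<xi>) \<le> c" for \<xi> unfolding c_def by (rule ft_bound[OF f])
    have c0: "c \<ge> 0" by (simp add: c_def)
    have gi: "integrable lborel (\<lambda>\<xi>. c\<^sup>2 * gauss \<delta> \<xi>)" by (intro integrable_mult_right gauss_integrable \<delta>)
    have gle: "gauss \<delta> \<xi> * (cmod (ft f \<xi>))\<^sup>2 \<le> c\<^sup>2 * gauss \<delta> \<xi>" for \<xi>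
      using mult_left_mono[OF power_mono[OF fc[of \<xi>] norm_ge_zero, of 2] less_imp_le[OF gauss_pos[of \<delta> \<xi>]]]
      by (simp add: mult.commute)
    have int: "integrable lborel (\<lambda>\<xi>. gauss \<delta> \<xi> * (cmod (ft f \<xi>))\<^sup>2)"
      by (rule Bochner_Integration.integrable_bound[OF gi])
         (auto simp: abs_mult abs_of_pos[OF gauss_pos] intro: gle)
    have "complex_of_real (\<integral>\<xi>. gauss \<delta> \<xi> * (cmod (ft f \<xi>))\<^sup>2 \<partial>lborel) = (\<integral>\<xi>. complex_of_real (gauss \<delta> \<xi>) * cnj (ft f \<xi>) * ft f \<xi> \<partial>lborel)"
      unfolding integral_complex_of_real[symmetric]
      by (intro Bochner_Integration.integral_cong) (auto simp: complex_norm_square mult_ac simp flip: of_real_power)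
    also have "\<dots> = (\<integral>x. cnj (G x) * f x \<partial>lborel)"
      unfolding ft_gauss_parseval[OF f f \<delta>] G_def \<Gamma>_def ..
    finally have eq0: "complex_of_real (\<integral>\<xi>. gauss \<delta> \<xi> * (cmod (ft f \<xi>))\<^sup>2 \<partial>lborel) = (\<integral>x. cnj (G x) * f x \<partial>lborel)" .
    have "(\<integral>\<xi>. gauss \<delta> \<xi> * (cmod (ft f \<xi>))\<^sup>2 \<partial>lborel) \<ge> 0"
      by (intro Bochner_Integration.integral_nonneg mult_nonneg_nonneg less_imp_le[OF gauss_pos]) auto
    then have eq: "(\<integral>\<xi>. gauss \<delta> \<xi> * (cmod (ft f \<xi>))\<^sup>2 \<partial>lborel) = cmod (\<integral>x. cnj (G x) * f x \<partial>lborel)"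
      unfolding eq0[symmetric] by simp
    have "(\<integral>\<^sup>+\<xi>. ennreal (gauss \<delta> \<xi> * (cmod (ft f \<xi>))\<^sup>2) \<partial>lborel) = ennreal (cmod (\<integral>x. cnj (G x) * f x \<partial>lborel))"
      unfolding eq[symmetric]
      by (rule nn_integral_eq_integral[OF int]) (auto intro!: mult_nonneg_nonneg less_imp_le[OF gauss_pos])
    also have "\<dots> \<le> (\<integral>\<^sup>+x. ennreal (cmod (cnj (G x) * f x)) \<partial>lborel)"
    proof (cases "integrable lborel (\<lambda>x. cnj (G x) * f x)")
      case True
      then show ?thesis by (rule integral_norm_bound_ennreal)
    qed (simp add: not_integrable_integral_eq)
    also have "\<dots> \<le> (\<integral>\<^sup>+x. \<integral>\<^sup>+y. ennreal (\<Gamma> x y) * (ennreal (cmod (f x)) * ennreal (cmod (f y))) \<partial>lborel \<partial>lborel)"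
    proof (rule nn_integral_mono)
      fix x
      have "ennreal (cmod (G x)) \<le> (\<integral>\<^sup>+y. ennreal (cmod (complex_of_real (\<Gamma> x y) * f y)) \<partial>lborel)"
      proof (cases "integrable lborel (\<lambda>y. complex_of_real (\<Gamma> x y) * f y)")
        case True
        then show ?thesis unfolding G_def by (rule integral_norm_bound_ennreal)
      qed (simp add: not_integrable_integral_eq G_def)
      then have "ennreal (cmod (cnj (G x) * f x)) \<le> (\<integral>\<^sup>+y. ennreal (cmod (complex_of_real (\<Gamma> x y) * f y)) \<partial>lborel) * ennreal (cmod (f x))"
        by (simp add: norm_mult ennreal_mult' mult_right_mono)
      also have "\<dots> = (\<integral>\<^sup>+y. ennreal (cmod (complex_of_real (\<Gamma> x y) * f y)) * ennreal (cmod (f x)) \<partial>lborel)"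
        by (rule nn_integral_multc[symmetric]) measurable
      also have "\<dots> = (\<integral>\<^sup>+y. ennreal (\<Gamma> x y) * (ennreal (cmod (f x)) * ennreal (cmod (f y))) \<partial>lborel)"
        by (intro nn_integral_cong) (simp add: norm_mult abs_of_nonneg[OF \<Gamma>0] ennreal_mult' mult_ac \<Gamma>0)
      finally show "ennreal (cmod (cnj (G x) * f x)) \<le> \<dots>" .
    qed
    also have "\<dots> \<le> (\<integral>\<^sup>+x. \<integral>\<^sup>+y. ennreal (\<Gamma> x y) * ennreal ((cmod (f x))\<^sup>2 / 2) + ennreal (\<Gamma> x y) * ennreal ((cmod (f y))\<^sup>2 / 2) \<partial>lborel \<partial>lborel)"
    proof (intro nn_integral_mono)
      fix x y
      have "cmod (f x) * cmod (f y) \<le> (cmod (f x))\<^sup>2 / 2 + (cmod (f y))\<^sup>2 / 2"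
        using sum_squares_bound[of "cmod (f x)" "cmod (f y)"] by simp
      then have "ennreal (cmod (f x)) * ennreal (cmod (f y)) \<le> ennreal ((cmod (f x))\<^sup>2 / 2) + ennreal ((cmod (f y))\<^sup>2 / 2)"
        by (simp add: ennreal_mult'[symmetric] ennreal_plus[symmetric] ennreal_leI del: ennreal_plus)
      then show "ennreal (\<Gamma> x y) * (ennreal (cmod (f x)) * ennreal (cmod (f y))) \<le> ennreal (\<Gamma> x y) * ennreal ((cmod (f x))\<^sup>2 / 2) + ennreal (\<Gamma> x y) * ennreal ((cmod (f y))\<^sup>2 / 2)"
        unfolding distrib_left[symmetric] by (rule mult_left_mono) simp
    qed
    also have "\<dots> = (\<integral>\<^sup>+x. \<integral>\<^sup>+y. ennreal (\<Gamma> x y) * ennreal ((cmod (f x))\<^sup>2 / 2) \<partial>lborel \<partial>lborel)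
        + (\<integral>\<^sup>+x. \<integral>\<^sup>+y. ennreal (\<Gamma> x y) * ennreal ((cmod (f y))\<^sup>2 / 2) \<partial>lborel \<partial>lborel)"
      by (simp add: nn_integral_add)
    also have "(\<integral>\<^sup>+x. \<integral>\<^sup>+y. ennreal (\<Gamma> x y) * ennreal ((cmod (f y))\<^sup>2 / 2) \<partial>lborel \<partial>lborel)
       = (\<integral>\<^sup>+y. \<integral>\<^sup>+x. ennreal (\<Gamma> x y) * ennreal ((cmod (f y))\<^sup>2 / 2) \<partial>lborel \<partial>lborel)"
      by (rule lborel_pair.Fubini'[symmetric]) (simp add: split_beta' borel_prod)
    also have "\<dots> = (\<integral>\<^sup>+y. \<integral>\<^sup>+x. ennreal (\<Gamma> y x) * ennreal ((cmod (f y))\<^sup>2 / 2) \<partial>lborel \<partial>lborel)"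
      by (simp only: \<Gamma>sym)
    also have "(\<integral>\<^sup>+x. \<integral>\<^sup>+y. ennreal (\<Gamma> x y) * ennreal ((cmod (f x))\<^sup>2 / 2) \<partial>lborel \<partial>lborel)
       = (\<integral>\<^sup>+x. ennreal (2 * pi) * ennreal ((cmod (f x))\<^sup>2 / 2) \<partial>lborel)"
      by (subst nn_integral_multc) (auto simp: \<Gamma>1)
    also have "\<dots> + \<dots> = ennreal (2 * pi) * ?S"
    proof -
      have "(\<integral>\<^sup>+x. ennreal (2 * pi) * ennreal ((cmod (f x))\<^sup>2 / 2) \<partial>lborel) + (\<integral>\<^sup>+x. ennreal (2 * pi) * ennreal ((cmod (f x))\<^sup>2 / 2) \<partial>lborel)
        = (\<integral>\<^sup>+x. ennreal (2 * pi) * ennreal ((cmod (f x))\<^sup>2 / 2) + ennreal (2 * pi) * ennreal ((cmod (f x))\<^sup>2 / 2) \<partial>lborel)"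
        by (rule nn_integral_add[symmetric]) auto
      also have "\<dots> = (\<integral>\<^sup>+x. ennreal (2 * pi) * ennreal ((cmod (f x))\<^sup>2) \<partial>lborel)"
        unfolding distrib_left[symmetric] by (simp add: ennreal_plus[symmetric] del: ennreal_plus)
      finally show ?thesis by (simp add: nn_integral_cmult)
    qed
    finally show ?thesis .
  qed (simp add: ennreal_mult_top)
  have "(\<integral>\<^sup>+\<xi>. ennreal ((cmod (ft f \<xi>))\<^sup>2) \<partial>lborel)
     = (\<integral>\<^sup>+\<xi>. liminf (\<lambda>n. ennreal (gauss (1 / real (Suc n)) \<xi> * (cmod (ft f \<xi>))\<^sup>2)) \<partial>lborel)"
  proof (rule nn_integral_cong)
    fix \<xi>
    have "(\<lambda>n. ennreal (gauss (1 / real (Suc n)) \<xi> * (cmod (ft f \<xi>))\<^sup>2)) \<longlonglongrightarrow> ennreal (1 * (cmod (ft f \<xi>))\<^sup>2)"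
      by (intro tendsto_ennrealI tendsto_intros gauss_tendsto_1)
    then show "ennreal ((cmod (ft f \<xi>))\<^sup>2) = liminf (\<lambda>n. ennreal (gauss (1 / real (Suc n)) \<xi> * (cmod (ft f \<xi>))\<^sup>2))"
      by (simp add: lim_imp_Liminf)
  qed
  also have "\<dots> \<le> liminf (\<lambda>n. \<integral>\<^sup>+\<xi>. ennreal (gauss (1 / real (Suc n)) \<xi> * (cmod (ft f \<xi>))\<^sup>2) \<partial>lborel)"
    by (rule nn_integral_liminf) measurable
  also have "\<dots> \<le> liminf (\<lambda>n::nat. ennreal (2 * pi) * ?S)"
    by (intro Liminf_mono always_eventually allI reg) simp
  finally show ?thesis by (simp add: Liminf_const)
qed

text \<open>Gaussian means of a bounded continuous function converge pointwise, boundedly.\<close>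

lemma gauss_mean_tendsto:
  fixes g :: "real \<Rightarrow> complex"
  assumes g: "continuous_on UNIV g" and m: "\<And>x. cmod (g x) \<le> m"
  shows "(\<lambda>n. \<integral>y. complex_of_real (2 * pi / (1 / real (Suc n)) * std_normal_density ((x - y) / (1 / real (Suc n)))) * g y \<partial>lborel)
      \<longlonglongrightarrow> 2 * pi * g x"
    and "cmod (\<integral>y. complex_of_real (2 * pi / (1 / real (Suc n)) * std_normal_density ((x - y) / (1 / real (Suc n)))) * g y \<partial>lborel)
      \<le> 2 * pi * m"
proof -
  have gm [measurable]: "g \<in> borel_measurable borel" by (rule borel_measurable_continuous_onI[OF g])
  have m0: "m \<ge> 0" using m[of 0] norm_ge_zero[of "g 0"] by linarith
  have eq: "(\<integral>y. complex_of_real (2 * pi / \<delta> * std_normal_density ((x - y) / \<delta>)) * g y \<partial>lborel)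
      = (\<integral>u. complex_of_real (2 * pi * std_normal_density u) * g (x - \<delta> * u) \<partial>lborel)" if "\<delta> > 0" for \<delta>
  proof -
    let ?k = "\<lambda>y. complex_of_real (2 * pi / \<delta> * std_normal_density ((x - y) / \<delta>)) * g y"
    have "(\<integral>y. ?k y \<partial>lborel) = \<bar>- \<delta>\<bar> *\<^sub>R (\<integral>u. ?k (x + (- \<delta>) * u) \<partial>lborel)"
      by (rule lborel_integral_real_affine) (use that in simp)
    also have "\<dots> = (\<integral>u. \<delta> *\<^sub>R ?k (x + (- \<delta>) * u) \<partial>lborel)"
      using that by (subst integral_scaleR_right) simp
    also have "\<dots> = (\<integral>u. complex_of_real (2 * pi * std_normal_density u) * g (x - \<delta> * u) \<partial>lborel)"
    proof (rule Bochner_Integration.integral_cong[OF refl])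
      fix u
      show "\<delta> *\<^sub>R ?k (x + (- \<delta>) * u) = complex_of_real (2 * pi * std_normal_density u) * g (x - \<delta> * u)"
        using that by (simp add: scaleR_conv_of_real)
    qed
    finally show ?thesis .
  qed
  have bnd: "cmod (complex_of_real (2 * pi * std_normal_density u) * g y) \<le> 2 * pi * m * std_normal_density u" for u y
  proof -
    have "cmod (complex_of_real (2 * pi * std_normal_density u) * g y) = 2 * pi * std_normal_density u * cmod (g y)"
      by (simp add: norm_mult)
    also have "\<dots> \<le> 2 * pi * std_normal_density u * m" by (intro mult_left_mono m) simp
    finally show ?thesis by (simp add: mult_ac)
  qed
  have ni: "integrable lborel (\<lambda>u. 2 * pi * m * std_normal_density u)" by (intro integrable_mult_right integrable_normal_density) simp
  have "(\<lambda>n. \<integral>u. complex_of_real (2 * pi * std_normal_density u) * g (x - (1 / real (Suc n)) * u) \<partial>lborel)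
      \<longlonglongrightarrow> (\<integral>u. complex_of_real (2 * pi * std_normal_density u) * g x \<partial>lborel)"
  proof (rule integral_dominated_convergence[OF _ _ ni])
    show "AE u in lborel. (\<lambda>n. complex_of_real (2 * pi * std_normal_density u) * g (x - (1 / real (Suc n)) * u))
       \<longlonglongrightarrow> complex_of_real (2 * pi * std_normal_density u) * g x"
    proof (rule AE_I2)
      fix u
      have "(\<lambda>n. x - (1 / real (Suc n)) * u) \<longlonglongrightarrow> x - 0 * u"
        by (intro tendsto_intros LIMSEQ_Suc lim_1_over_n)
      moreover have "isCont g x" using g by (simp add: continuous_on_eq_continuous_at)
      ultimately have "(\<lambda>n. g (x - (1 / real (Suc n)) * u)) \<longlonglongrightarrow> g x"
        by (intro isCont_tendsto_compose[where g=g and l=x]) simp_all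
      then show "(\<lambda>n. complex_of_real (2 * pi * std_normal_density u) * g (x - (1 / real (Suc n)) * u))
       \<longlonglongrightarrow> complex_of_real (2 * pi * std_normal_density u) * g x" by (intro tendsto_intros)
    qed
    show "AE u in lborel. cmod (complex_of_real (2 * pi * std_normal_density u) * g (x - 1 / real (Suc n) * u)) \<le> 2 * pi * m * std_normal_density u" for n
      using bnd by blast
  qed measurable
  also have "(\<integral>u. complex_of_real (2 * pi * std_normal_density u) * g x \<partial>lborel) = 2 * pi * g x"
    by (simp only: integral_mult_left_zero integral_complex_of_real integral_mult_right_zero integral_normal_density) simp
  finally show "(\<lambda>n. \<integral>y. complex_of_real (2 * pi / (1 / real (Suc n)) * std_normal_density ((x - y) / (1 / real (Suc n)))) * g y \<partial>lborel)
      \<longlonglongrightarrow> 2 * pi * g x" by (subst eq) simp_all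
  have "cmod (\<integral>u. complex_of_real (2 * pi * std_normal_density u) * g (x - (1 / real (Suc n)) * u) \<partial>lborel)
      \<le> (\<integral>u. 2 * pi * m * std_normal_density u \<partial>lborel)"
    by (rule Bochner_Integration.integral_norm_bound_integral[OF Bochner_Integration.integrable_bound[OF ni] ni])
       (use bnd m0 in \<open>auto simp: abs_mult\<close>)
  then show "cmod (\<integral>y. complex_of_real (2 * pi / (1 / real (Suc n)) * std_normal_density ((x - y) / (1 / real (Suc n)))) * g y \<partial>lborel)
      \<le> 2 * pi * m" by (subst eq) simp_all
qed

text \<open>Parseval's identity with \<open>2 |a b| \<le> |a|\<^sup>2 + |b|\<^sup>2\<close> in place of the Cauchy--Schwarz inequality. For \<open>g\<close> close to
  a truncation of \<open>f\<close> the last term can be absorbed in the left-hand side.\<close>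

lemma ft_duality_bound:
  assumes f: "integrable lborel f" and ftf: "integrable lborel (\<lambda>\<xi>. (cmod (ft f \<xi>))\<^sup>2)"
    and gc: "continuous_on UNIV g" and m: "\<And>x. cmod (g x) \<le> m" and g: "integrable lborel g"
    and g2: "integrable lborel (\<lambda>x. (cmod (g x))\<^sup>2)"
  shows "2 * pi * cmod (\<integral>x. cnj (g x) * f x \<partial>lborel)
     \<le> (\<integral>\<xi>. (cmod (ft f \<xi>))\<^sup>2 \<partial>lborel) / 2 + pi * (\<integral>x. (cmod (g x))\<^sup>2 \<partial>lborel)"
proof -
  have [measurable]: "f \<in> borel_measurable borel" "g \<in> borel_measurable borel"
    using borel_measurable_integrable[OF f] borel_measurable_integrable[OF g] by simp_all
  let ?A = "\<integral>\<xi>. (cmod (ft f \<xi>))\<^sup>2 \<partial>lborel" and ?S = "\<integral>x. (cmod (g x))\<^sup>2 \<partial>lborel"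
  have pg: "(\<integral>\<^sup>+\<xi>. ennreal ((cmod (ft g \<xi>))\<^sup>2) \<partial>lborel) \<le> ennreal (2 * pi * ?S)"
    using plancherel_le[OF g] nn_integral_eq_integral[OF g2]
    by (simp add: ennreal_mult' flip: ennreal_mult')
  have ftg: "integrable lborel (\<lambda>\<xi>. (cmod (ft g \<xi>))\<^sup>2)"
    by (rule integrableI_nonneg) (use pg in \<open>auto intro: le_less_trans\<close>)
  have ftgS: "(\<integral>\<xi>. (cmod (ft g \<xi>))\<^sup>2 \<partial>lborel) \<le> 2 * pi * ?S"
    using pg nn_integral_eq_integral[OF ftg] by (simp add: ennreal_le_iff)
  define d where "d n = 1 / real (Suc n)" for n
  have d: "d n > 0" for n by (simp add: d_def)
  define G where "G n x = (\<integral>y. complex_of_real (2 * pi / d n * std_normal_density ((x - y) / d n)) * g y \<partial>lborel)" for n x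
  have [measurable]: "G n \<in> borel_measurable borel" for n unfolding G_def by measurable
  have le: "cmod (\<integral>x. cnj (G n x) * f x \<partial>lborel) \<le> ?A / 2 + pi * ?S" for n
  proof -
    have "cmod (\<integral>x. cnj (G n x) * f x \<partial>lborel) = cmod (\<integral>\<xi>. complex_of_real (gauss (d n) \<xi>) * cnj (ft g \<xi>) * ft f \<xi> \<partial>lborel)"
      unfolding ft_gauss_parseval[OF f g d] G_def ..
    also have "\<dots> \<le> (\<integral>\<xi>. (cmod (ft f \<xi>))\<^sup>2 / 2 + (cmod (ft g \<xi>))\<^sup>2 / 2 \<partial>lborel)"
    proof -
      have b: "cmod (complex_of_real (gauss (d n) \<xi>) * cnj (ft g \<xi>) * ft f \<xi>) \<le> (cmod (ft f \<xi>))\<^sup>2 / 2 + (cmod (ft g \<xi>))\<^sup>2 / 2" for \<xi>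
      proof -
        have "cmod (complex_of_real (gauss (d n) \<xi>) * cnj (ft g \<xi>) * ft f \<xi>) = gauss (d n) \<xi> * (cmod (ft g \<xi>) * cmod (ft f \<xi>))"
          by (simp add: norm_mult abs_of_pos[OF gauss_pos])
        also have "\<dots> \<le> 1 * (cmod (ft g \<xi>) * cmod (ft f \<xi>))" by (intro mult_right_mono gauss_le_1) auto
        also have "\<dots> \<le> (cmod (ft f \<xi>))\<^sup>2 / 2 + (cmod (ft g \<xi>))\<^sup>2 / 2"
          using sum_squares_bound[of "cmod (ft f \<xi>)" "cmod (ft g \<xi>)"] by (simp add: mult_ac)
        finally show ?thesis .
      qed
      have i: "integrable lborel (\<lambda>\<xi>. (cmod (ft f \<xi>))\<^sup>2 / 2 + (cmod (ft g \<xi>))\<^sup>2 / 2)"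
        using ftf ftg by simp
      show ?thesis
        by (rule Bochner_Integration.integral_norm_bound_integral[OF Bochner_Integration.integrable_bound[OF i] i])
           (use b in \<open>auto intro: order_trans[OF b]\<close>)
    qed
    also have "\<dots> = ?A / 2 + (\<integral>\<xi>. (cmod (ft g \<xi>))\<^sup>2 \<partial>lborel) / 2"
      using ftf ftg by simp
    finally show ?thesis using ftgS by simp
  qed
  have lim: "(\<lambda>n. \<integral>x. cnj (G n x) * f x \<partial>lborel) \<longlonglongrightarrow> (\<integral>x. cnj (2 * pi * g x) * f x \<partial>lborel)"
  proof (rule integral_dominated_convergence[where w="\<lambda>x. 2 * pi * m * cmod (f x)"])
    show "integrable lborel (\<lambda>x. 2 * pi * m * cmod (f x))" using f by simp
    show "AE x in lborel. (\<lambda>n. cnj (G n x) * f x) \<longlonglongrightarrow> cnj (2 * pi * g x) * f x"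
      unfolding G_def d_def by (intro AE_I2 tendsto_mult_right tendsto_cnj gauss_mean_tendsto(1)[OF gc m])
    show "AE x in lborel. cmod (cnj (G n x) * f x) \<le> 2 * pi * m * cmod (f x)" for n
      unfolding norm_mult complex_mod_cnj G_def d_def by (intro AE_I2 mult_right_mono gauss_mean_tendsto(2)[OF gc m]) simp
  qed measurable
  have "(\<integral>x. cnj (2 * pi * g x) * f x \<partial>lborel) = 2 * pi * (\<integral>x. cnj (g x) * f x \<partial>lborel)"
    by (simp add: mult.assoc)
  then have "cmod (\<integral>x. cnj (2 * pi * g x) * f x \<partial>lborel) = 2 * pi * cmod (\<integral>x. cnj (g x) * f x \<partial>lborel)"
    by (simp add: norm_mult)
  moreover have "cmod (\<integral>x. cnj (2 * pi * g x) * f x \<partial>lborel) \<le> ?A / 2 + pi * ?S"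
    by (rule LIMSEQ_le_const2[OF tendsto_norm[OF lim]]) (use le in blast)
  ultimately show ?thesis by simp
qed

text \<open>A function bounded by \<open>m\<close> and supported in \<open>[-m, m]\<close> is an almost everywhere limit of
  uniformly bounded continuous functions with uniformly bounded supports.\<close>

lemma bounded_approx_continuous:
  fixes \<phi> :: "real \<Rightarrow> complex"
  assumes \<phi> [measurable]: "\<phi> \<in> borel_measurable borel" and m: "m > 0" "\<And>x. cmod (\<phi> x) \<le> m"
    and supp: "\<And>x. \<bar>x\<bar> > m \<Longrightarrow> \<phi> x = 0"
  shows "\<exists>h. (\<forall>k::nat. continuous_on UNIV (h k)) \<and> (\<forall>k x. cmod (h k x) \<le> m) \<and>
    (\<forall>k x. \<bar>x\<bar> > m + 1 \<longrightarrow> h k x = 0) \<and> (AE x in lborel. (\<lambda>k. h k x) \<longlonglongrightarrow> \<phi> x)"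
proof -
  have "\<phi> \<in> borel_measurable lebesgue" using \<phi> by (intro measurable_completion) simp
  then have "\<phi> measurable_on UNIV" by (rule lebesgue_measurable_imp_measurable_on) simp
  then obtain N g where N: "negligible N" and g: "\<And>k. continuous_on UNIV (g k)"
    and lim: "\<And>x. x \<notin> N \<Longrightarrow> (\<lambda>k. g k x) \<longlonglongrightarrow> \<phi> x"
    unfolding measurable_on_def by auto
  \<comment> \<open>Clamp the values to the disc of radius \<open>m\<close> and cut off outside \<open>[-m - 1, m + 1]\<close>; neither changes the limit.\<close>
  define cut where "cut x = max 0 (min 1 (m + 1 - \<bar>x\<bar>))" for x :: real
  define cl where "cl z = (m / max m (cmod z)) *\<^sub>R z" for z :: complex
  have clc: "continuous_on UNIV cl" unfolding cl_def using m(1)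
    by (intro continuous_intros) (auto simp: max_def)
  have clm: "cmod (cl z) \<le> m" for z
  proof (cases "cmod z \<le> m")
    case True
    then show ?thesis using m(1) by (simp add: cl_def max_def)
  next
    case False
    then show ?thesis using m(1) by (simp add: cl_def max_def)
  qed
  have cl_id: "cl z = z" if "cmod z \<le> m" for z using that m(1) by (simp add: cl_def max_def)
  have cut01: "0 \<le> cut x" "cut x \<le> 1" for x by (auto simp: cut_def)
  define h where "h k x = cut x *\<^sub>R cl (g k x)" for k x
  show ?thesis
  proof (intro exI[of _ h] conjI allI impI)
    show "continuous_on UNIV (h k)" for k
      unfolding h_def cut_def
      by (intro continuous_intros continuous_on_compose2[OF clc] g) auto
    show "cmod (h k x) \<le> m" for k x
    proof -
      have "cmod (h k x) = cut x * cmod (cl (g k x))" by (simp add: h_def cut01)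
      also have "\<dots> \<le> 1 * m" by (intro mult_mono cut01 clm) auto
      finally show ?thesis by simp
    qed
    show "h k x = 0" if "\<bar>x\<bar> > m + 1" for k x using that by (simp add: h_def cut_def)
    have "AE x in lebesgue. x \<notin> N"
      using N by (intro AE_not_in) (simp add: negligible_iff_null_sets)
    then have "AE x in lborel. x \<notin> N" by (simp add: AE_completion_iff)
    then show "AE x in lborel. (\<lambda>k. h k x) \<longlonglongrightarrow> \<phi> x"
    proof eventually_elim
      case (elim x)
      have "isCont cl (\<phi> x)" using clc by (simp add: continuous_on_eq_continuous_at)
      then have "(\<lambda>k. cl (g k x)) \<longlonglongrightarrow> cl (\<phi> x)" by (rule isCont_tendsto_compose[OF _ lim[OF elim]])
      then have "(\<lambda>k. h k x) \<longlonglongrightarrow> cut x *\<^sub>R cl (\<phi> x)" unfolding h_def by (intro tendsto_intros)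
      also have "cut x *\<^sub>R cl (\<phi> x) = \<phi> x"
      proof (cases "\<bar>x\<bar> > m")
        case True
        then show ?thesis using supp m(1) by (simp add: cl_def)
      next
        case False
        then have "cut x = 1" by (simp add: cut_def)
        then show ?thesis by (simp add: cl_id m)
      qed
      finally show ?case .
    qed
  qed
qed

text \<open>The duality bound with \<open>g = \<phi>\<close>, the truncation of \<open>f\<close> in size and support, reads
  \<open>2 \<pi> \<integral>|\<phi>|\<^sup>2 \<le> \<integral>|ft f|\<^sup>2 / 2 + \<pi> \<integral>|\<phi>|\<^sup>2\<close>.\<close>

lemma ft_L2_imp_L2:
  assumes f: "integrable lborel f" and ftf: "integrable lborel (\<lambda>\<xi>. (cmod (ft f \<xi>))\<^sup>2)"
  shows "f \<in> L2"
proof -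
  have fm [measurable]: "f \<in> borel_measurable borel" using borel_measurable_integrable[OF f] by simp
  let ?A = "\<integral>\<xi>. (cmod (ft f \<xi>))\<^sup>2 \<partial>lborel"
  define B where "B n = {x. \<bar>x\<bar> \<le> real (Suc n) \<and> cmod (f x) \<le> real (Suc n)}" for n
  have Bm [measurable]: "B n \<in> sets borel" for n
  proof -
    have "B n = {x \<in> space borel. \<bar>x\<bar> \<le> real (Suc n) \<and> cmod (f x) \<le> real (Suc n)}" by (simp add: B_def)
    then show ?thesis by simp
  qed
  have bound: "(\<integral>\<^sup>+x. ennreal (indicator (B n) x * (cmod (f x))\<^sup>2) \<partial>lborel) \<le> ennreal (?A / (2 * pi))" for n
  proof -
    define m where "m = real (Suc n)"
    have m0: "m > 0" by (simp add: m_def)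
    define \<phi> where "\<phi> x = indicator (B n) x * f x" for x
    have \<phi>b [measurable]: "\<phi> \<in> borel_measurable borel" unfolding \<phi>_def by measurable
    have \<phi>m: "cmod (\<phi> x) \<le> m" for x by (auto simp: \<phi>_def indicator_def B_def m_def)
    have \<phi>s: "\<phi> x = 0" if "\<bar>x\<bar> > m" for x using that by (auto simp: \<phi>_def indicator_def B_def m_def)
    obtain h where hc: "\<And>k::nat. continuous_on UNIV (h k)" and hm: "\<And>k x. cmod (h k x) \<le> m"
      and hs: "\<And>k x. \<bar>x\<bar> > m + 1 \<Longrightarrow> h k x = 0" and hl: "AE x in lborel. (\<lambda>k. h k x) \<longlonglongrightarrow> \<phi> x"
      using bounded_approx_continuous[OF \<phi>b m0 \<phi>m \<phi>s] by blast
    have [measurable]: "h k \<in> borel_measurable borel" for k by (rule borel_measurable_continuous_onI[OF hc])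
    let ?I = "indicator {- (m + 1)..m + 1} :: real \<Rightarrow> real"
    have Ii: "integrable lborel ?I" by (rule integrable_real_indicator) (use m0 in auto)
    have hI: "cmod (h k x) \<le> m * ?I x" for k x using hm[of k x] hs[of x k] by (auto simp: indicator_def abs_if split: if_splits)
    have hI2: "(cmod (h k x))\<^sup>2 \<le> m\<^sup>2 * ?I x" for k x
      using power_mono[OF hI[of k x] norm_ge_zero, of 2] by (auto simp: power_mult_distrib indicator_def)
    have hi: "integrable lborel (h k)" for k
      by (rule Bochner_Integration.integrable_bound[OF integrable_mult_right[OF Ii, of m]])
         (use hI m0 in \<open>auto simp: abs_mult\<close>)
    have hi2: "integrable lborel (\<lambda>x. (cmod (h k x))\<^sup>2)" for k
      by (rule Bochner_Integration.integrable_bound[OF integrable_mult_right[OF Ii, of "m\<^sup>2"]])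
         (use hI2 in \<open>auto simp: abs_mult\<close>)
    have l1: "(\<lambda>k. \<integral>x. cnj (h k x) * f x \<partial>lborel) \<longlonglongrightarrow> (\<integral>x. cnj (\<phi> x) * f x \<partial>lborel)"
    proof (rule integral_dominated_convergence[where w="\<lambda>x. m * cmod (f x)"])
      show "integrable lborel (\<lambda>x. m * cmod (f x))" using f by simp
      show "AE x in lborel. (\<lambda>k. cnj (h k x) * f x) \<longlonglongrightarrow> cnj (\<phi> x) * f x"
        using hl by eventually_elim (intro tendsto_mult_right tendsto_cnj)
      show "AE x in lborel. cmod (cnj (h k x) * f x) \<le> m * cmod (f x)" for k
        unfolding norm_mult complex_mod_cnj by (intro AE_I2 mult_right_mono hm) simp
    qed measurable
    have l2: "(\<lambda>k. \<integral>x. (cmod (h k x))\<^sup>2 \<partial>lborel) \<longlonglongrightarrow> (\<integral>x. (cmod (\<phi> x))\<^sup>2 \<partial>lborel)"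
    proof (rule integral_dominated_convergence[where w="\<lambda>x. m\<^sup>2 * ?I x"])
      show "integrable lborel (\<lambda>x. m\<^sup>2 * ?I x)" by (rule integrable_mult_right[OF Ii])
      show "AE x in lborel. (\<lambda>k. (cmod (h k x))\<^sup>2) \<longlonglongrightarrow> (cmod (\<phi> x))\<^sup>2"
        using hl by eventually_elim (intro tendsto_intros)
      show "AE x in lborel. norm ((cmod (h k x))\<^sup>2) \<le> m\<^sup>2 * ?I x" for k
        using hI2 by simp
    qed measurable
    have "2 * pi * cmod (\<integral>x. cnj (\<phi> x) * f x \<partial>lborel) \<le> ?A / 2 + pi * (\<integral>x. (cmod (\<phi> x))\<^sup>2 \<partial>lborel)"
    proof (rule LIMSEQ_le)
      show "(\<lambda>k. 2 * pi * cmod (\<integral>x. cnj (h k x) * f x \<partial>lborel)) \<longlonglongrightarrow> 2 * pi * cmod (\<integral>x. cnj (\<phi> x) * f x \<partial>lborel)"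
        by (intro tendsto_intros l1)
      show "(\<lambda>k. ?A / 2 + pi * (\<integral>x. (cmod (h k x))\<^sup>2 \<partial>lborel)) \<longlonglongrightarrow> ?A / 2 + pi * (\<integral>x. (cmod (\<phi> x))\<^sup>2 \<partial>lborel)"
        by (intro tendsto_intros l2)
      show "\<exists>N. \<forall>k\<ge>N. 2 * pi * cmod (\<integral>x. cnj (h k x) * f x \<partial>lborel) \<le> ?A / 2 + pi * (\<integral>x. (cmod (h k x))\<^sup>2 \<partial>lborel)"
        using ft_duality_bound[OF f ftf hc hm hi hi2] by blast
    qed
    moreover have "(\<integral>x. cnj (\<phi> x) * f x \<partial>lborel) = complex_of_real (\<integral>x. (cmod (\<phi> x))\<^sup>2 \<partial>lborel)"
    proof -
      have "(\<lambda>x. cnj (\<phi> x) * f x) = (\<lambda>x. cnj (\<phi> x) * \<phi> x)" by (auto simp: \<phi>_def indicator_def)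
      then show ?thesis using L2_inner_self[of \<phi>] by (simp add: L2_inner_def)
    qed
    ultimately have le: "(\<integral>x. (cmod (\<phi> x))\<^sup>2 \<partial>lborel) \<le> ?A / (2 * pi)"
      by (simp add: field_simps)
    have \<phi>I: "(cmod (\<phi> x))\<^sup>2 \<le> m\<^sup>2 * ?I x" for x
      using power_mono[OF \<phi>m[of x] norm_ge_zero, of 2] \<phi>s[of x] by (auto simp: indicator_def abs_if split: if_splits)
    have "integrable lborel (\<lambda>x. (cmod (\<phi> x))\<^sup>2)"
      by (rule Bochner_Integration.integrable_bound[OF integrable_mult_right[OF Ii, of "m\<^sup>2"]])
         (use \<phi>I in \<open>auto simp: abs_mult\<close>)
    then have "(\<integral>\<^sup>+x. ennreal ((cmod (\<phi> x))\<^sup>2) \<partial>lborel) = ennreal (\<integral>x. (cmod (\<phi> x))\<^sup>2 \<partial>lborel)"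
      by (rule nn_integral_eq_integral) simp
    also have "\<dots> \<le> ennreal (?A / (2 * pi))" by (rule ennreal_leI[OF le])
    also have "(\<lambda>x. (cmod (\<phi> x))\<^sup>2) = (\<lambda>x. indicator (B n) x * (cmod (f x))\<^sup>2)"
      by (auto simp: \<phi>_def indicator_def)
    finally show ?thesis .
  qed
  have "(\<integral>\<^sup>+x. ennreal ((cmod (f x))\<^sup>2) \<partial>lborel) = (\<integral>\<^sup>+x. liminf (\<lambda>n. ennreal (indicator (B n) x * (cmod (f x))\<^sup>2)) \<partial>lborel)"
  proof (rule nn_integral_cong)
    fix x
    have "eventually (\<lambda>n. ennreal (indicator (B n) x * (cmod (f x))\<^sup>2) = ennreal ((cmod (f x))\<^sup>2)) sequentially"
      using eventually_ge_at_top[of "nat \<lceil>max \<bar>x\<bar> (cmod (f x))\<rceil>"]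
      by eventually_elim (auto simp: B_def indicator_def le_nat_iff ceiling_le_iff nat_le_iff)
    then show "ennreal ((cmod (f x))\<^sup>2) = liminf (\<lambda>n. ennreal (indicator (B n) x * (cmod (f x))\<^sup>2))"
      by (intro lim_imp_Liminf[symmetric] tendsto_eventually) auto
  qed
  also have "\<dots> \<le> liminf (\<lambda>n. \<integral>\<^sup>+x. ennreal (indicator (B n) x * (cmod (f x))\<^sup>2) \<partial>lborel)"
    by (rule nn_integral_liminf) measurable
  also have "\<dots> \<le> liminf (\<lambda>n::nat. ennreal (?A / (2 * pi)))"
    by (intro Liminf_mono always_eventually allI bound)
  also have "\<dots> = ennreal (?A / (2 * pi))" by (simp add: Liminf_const)
  finally have "(\<integral>\<^sup>+x. ennreal ((cmod (f x))\<^sup>2) \<partial>lborel) < \<infinity>" by (rule le_less_trans) simp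
  then have "integrable lborel (\<lambda>x. (cmod (f x))\<^sup>2)" by (intro integrableI_nonneg) auto
  then show ?thesis by (simp add: L2_def)
qed

section \<open>Smooth functions and test functions\<close>

text \<open>\<open>k\<close> times differentiable on the whole line.\<close>

primrec times_differentiable :: "nat \<Rightarrow> (real \<Rightarrow> complex) \<Rightarrow> bool" where
  "times_differentiable 0 f = True"
| "times_differentiable (Suc k) f =
    (\<exists>f'. (\<forall>x. (f has_vector_derivative f' x) (at x)) \<and> times_differentiable k f')"

text \<open>\<open>C\<^sup>\<infinity>\<close> functions of one real variable, in a form suited to induction on the order of
  differentiability.\<close>

definition smooth_line :: "(real \<Rightarrow> complex) \<Rightarrow> bool" where
  "smooth_line f \<longleftrightarrow> (\<forall>k. times_differentiable k f)"

lemma times_differentiable_Suc_D: "times_differentiable (Suc k) f \<Longrightarrow> times_differentiable k f"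
proof (induction k arbitrary: f)
  case (Suc k)
  then obtain f' where "\<forall>x. (f has_vector_derivative f' x) (at x)" "times_differentiable (Suc k) f'" by auto
  with Suc.IH[of f'] show ?case by auto
qed simp

lemma times_differentiable_const: "times_differentiable k (\<lambda>x. c)"
proof (induction k arbitrary: c)
  case (Suc k)
  have "\<forall>x. ((\<lambda>x. c) has_vector_derivative 0) (at x)" by simp
  then show ?case using Suc[of 0] by (auto intro!: exI[of _ "\<lambda>x. 0"])
qed simp

lemma times_differentiable_add:
  "times_differentiable k f \<Longrightarrow> times_differentiable k g \<Longrightarrow> times_differentiable k (\<lambda>x. f x + g x)"
proof (induction k arbitrary: f g)
  case (Suc k)
  then obtain f' g' where "\<forall>x. (f has_vector_derivative f' x) (at x)" "times_differentiable k f'"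
    "\<forall>x. (g has_vector_derivative g' x) (at x)" "times_differentiable k g'" by auto
  with Suc.IH[of f' g'] show ?case
    by (auto intro!: exI[of _ "\<lambda>x. f' x + g' x"] has_vector_derivative_add)
qed simp

lemma times_differentiable_mult:
  "times_differentiable k f \<Longrightarrow> times_differentiable k g \<Longrightarrow> times_differentiable k (\<lambda>x. f x * g x)"
proof (induction k arbitrary: f g)
  case (Suc k)
  from Suc.prems obtain f' g' where f': "\<And>x. (f has_vector_derivative f' x) (at x)" "times_differentiable k f'"
    and g': "\<And>x. (g has_vector_derivative g' x) (at x)" "times_differentiable k g'" by auto
  have fg: "times_differentiable k f" "times_differentiable k g"
    using Suc.prems times_differentiable_Suc_D by blast+
  have "times_differentiable k (\<lambda>x. f x * g' x + f' x * g x)"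
    by (intro times_differentiable_add Suc.IH fg f' g')
  moreover have "((\<lambda>x. f x * g x) has_vector_derivative f x * g' x + f' x * g x) (at x)" for x
    by (rule has_vector_derivative_mult[OF f'(1) g'(1)])
  ultimately show ?case unfolding times_differentiable.simps
    by (intro exI[of _ "\<lambda>x. f x * g' x + f' x * g x"] conjI allI)
qed simp

lemma times_differentiable_affine:
  "times_differentiable k f \<Longrightarrow> times_differentiable k (\<lambda>x. f (a * x + b))"
proof (induction k arbitrary: f)
  case (Suc k)
  from Suc.prems obtain f' where f': "\<And>x. (f has_vector_derivative f' x) (at x)" "times_differentiable k f'" by auto
  have "((\<lambda>x. f (a * x + b)) has_vector_derivative complex_of_real a * f' (a * x + b)) (at x)" for x
  proof -
    have "((f \<circ> (\<lambda>x. a * x + b)) has_vector_derivative a *\<^sub>R f' (a * x + b)) (at x)"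
      by (rule vector_diff_chain_at[OF _ f'(1)]) (auto intro!: derivative_eq_intros simp flip: has_real_derivative_iff_has_vector_derivative)
    then show ?thesis by (simp add: o_def scaleR_conv_of_real)
  qed
  moreover have "times_differentiable k (\<lambda>x. complex_of_real a * f' (a * x + b))"
    by (intro times_differentiable_mult times_differentiable_const Suc.IH f')
  ultimately show ?case unfolding times_differentiable.simps
    by (intro exI[of _ "\<lambda>x. complex_of_real a * f' (a * x + b)"] conjI allI)
qed simp

lemma times_differentiable_exp: "times_differentiable k (\<lambda>x. exp (c * complex_of_real x))"
proof (induction k)
  case (Suc k)
  have "((\<lambda>x. exp (c * complex_of_real x)) has_vector_derivative c * exp (c * complex_of_real x)) (at x)" for x
  proof -
    have "((\<lambda>z. exp (c * z)) has_field_derivative c * exp (c * complex_of_real x)) (at (complex_of_real x))"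
      by (auto intro!: derivative_eq_intros)
    from has_vector_derivative_real_field[OF this] show ?thesis .
  qed
  moreover have "times_differentiable k (\<lambda>x. c * exp (c * complex_of_real x))"
    by (intro times_differentiable_mult times_differentiable_const Suc)
  ultimately show ?case unfolding times_differentiable.simps
    by (intro exI[of _ "\<lambda>x. c * exp (c * complex_of_real x)"] conjI allI)
qed simp

lemma smooth_line_const: "smooth_line (\<lambda>x. c)"
  and smooth_line_add: "smooth_line f \<Longrightarrow> smooth_line g \<Longrightarrow> smooth_line (\<lambda>x. f x + g x)"
  and smooth_line_mult: "smooth_line f \<Longrightarrow> smooth_line g \<Longrightarrow> smooth_line (\<lambda>x. f x * g x)"
  and smooth_line_affine: "smooth_line f \<Longrightarrow> smooth_line (\<lambda>x. f (a * x + b))"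
  and smooth_line_exp: "smooth_line (\<lambda>x. exp (k * complex_of_real x))"
  by (auto simp: smooth_line_def times_differentiable_const times_differentiable_add
      times_differentiable_mult times_differentiable_affine times_differentiable_exp)

lemma smooth_line_has_derivative:
  assumes "smooth_line f"
  shows "\<exists>f'. (\<forall>x. (f has_vector_derivative f' x) (at x)) \<and> smooth_line f'"
proof -
  have "times_differentiable (Suc 0) f" using assms by (simp add: smooth_line_def)
  then obtain f' where f': "\<And>x. (f has_vector_derivative f' x) (at x)" by auto
  have "times_differentiable k f'" for k
  proof -
    have "times_differentiable (Suc k) f" using assms unfolding smooth_line_def by blast
    then obtain g where g: "\<And>x. (f has_vector_derivative g x) (at x)" "times_differentiable k g" by auto
    have "g = f'" by (rule ext) (rule vector_derivative_unique_at[OF g(1) f'])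
    then show ?thesis using g by simp
  qed
  then show ?thesis using f' by (auto simp: smooth_line_def)
qed

lemma smooth_line_deriv:
  assumes "smooth_line f" "\<And>x. (f has_vector_derivative f' x) (at x)"
  shows "smooth_line f'"
proof -
  obtain g where g: "\<And>x. (f has_vector_derivative g x) (at x)" "smooth_line g"
    using smooth_line_has_derivative[OF assms(1)] by blast
  have "g = f'" by (rule ext) (rule vector_derivative_unique_at[OF g(1) assms(2)])
  then show ?thesis using g by simp
qed

lemma smooth_line_antideriv:
  assumes "smooth_line f'" "\<And>x. (f has_vector_derivative f' x) (at x)"
  shows "smooth_line f"
  unfolding smooth_line_def
proof
  fix k
  show "times_differentiable k f"
    using assms by (cases k) (auto simp: smooth_line_def)
qed

lemma smooth_line_continuous: "smooth_line f \<Longrightarrow> continuous_on UNIV f"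
  using smooth_line_has_derivative[of f]
  by (auto intro!: continuous_at_imp_continuous_on dest: has_vector_derivative_continuous)

text \<open>The building block \<open>x\<^sup>-\<^sup>k e\<^sup>-\<^sup>1\<^sup>/\<^sup>x\<close> of bump functions, extended by \<open>0\<close> to \<open>x \<le> 0\<close>. The linear span of this
  family is closed under derivatives.\<close>

definition flat :: "nat \<Rightarrow> real \<Rightarrow> real" where
  "flat k x = (if x > 0 then (1 / x) ^ k * exp (- (1 / x)) else 0)"

lemma flat_bound: "\<bar>flat k h\<bar> \<le> fact (k + 2) * h\<^sup>2"
proof (cases "h > 0")
  case True
  define t where "t = 1 / h"
  have t: "t > 0" using True by (simp add: t_def)
  have "t ^ (k + 2) / fact (k + 2) \<le> exp t"
  proof -
    have sums: "(\<lambda>n. t ^ n / fact n) sums exp t"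
      using exp_converges[of t] by (simp add: divide_inverse mult.commute)
    then have "(\<Sum>i\<in>{k + 2}. t ^ i / fact i) \<le> (\<Sum>i. t ^ i / fact i)"
      using t by (intro sum_le_suminf) (auto simp: sums_iff)
    then show ?thesis using sums by (simp add: sums_iff)
  qed
  then have "t ^ (k + 2) \<le> exp t * fact (k + 2)"
    by (simp only: pos_divide_le_eq[OF fact_gt_zero])
  then have "t ^ (k + 2) * exp (- t) \<le> exp t * fact (k + 2) * exp (- t)"
    by (rule mult_right_mono) simp
  also have "\<dots> = fact (k + 2) * (exp t * exp (- t))" by (simp only: mult_ac)
  also have "exp t * exp (- t) = 1" by (simp flip: exp_add)
  finally have "t ^ (k + 2) * exp (- t) \<le> fact (k + 2)" by (simp only: mult_1_right)
  then have "(t ^ (k + 2) * exp (- t)) * h\<^sup>2 \<le> fact (k + 2) * h\<^sup>2"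
    by (rule mult_right_mono) simp
  also have "(t ^ (k + 2) * exp (- t)) * h\<^sup>2 = t ^ k * exp (- t)"
    using True by (simp add: t_def power_add power2_eq_square)
  finally have "t ^ k * exp (- t) \<le> fact (k + 2) * h\<^sup>2" .
  then show ?thesis using True by (simp add: flat_def t_def)
qed (simp add: flat_def)

lemma flat_deriv: "(flat k has_real_derivative (flat (k + 2) x - real k * flat (k + 1) x)) (at x)"
proof -
  consider "x > 0" | "x < 0" | "x = 0" by linarith
  then show ?thesis
  proof cases
    case 1
    have "((\<lambda>x. (1 / x) ^ k * exp (- (1 / x))) has_real_derivative
        ((1 / x) ^ (k + 2) * exp (- (1 / x)) - real k * ((1 / x) ^ (k + 1) * exp (- (1 / x))))) (at x)"
      using 1 by (auto intro!: derivative_eq_intros simp: power2_eq_square field_simps; cases k; simp add: field_simps)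
    then show ?thesis
      unfolding flat_def using 1
      by (subst DERIV_cong_ev[OF refl _ refl, where g="\<lambda>x. (1 / x) ^ k * exp (- (1 / x))"])
         (auto intro: eventually_mono[OF eventually_nhds_in_open[of "{0<..}"]])
  next
    case 2
    have "((\<lambda>x. 0) has_real_derivative 0) (at x)" by simp
    then show ?thesis
      unfolding flat_def using 2
      by (subst DERIV_cong_ev[OF refl _ refl, where g="\<lambda>x. 0"])
         (auto intro: eventually_mono[OF eventually_nhds_in_open[of "{..<0}"]])
  next
    case 3
    have "((\<lambda>h. (flat k (0 + h) - flat k 0) / h) \<longlongrightarrow> 0) (at 0)"
    proof (rule Lim_null_comparison[where g="\<lambda>h. fact (k + 2) * \<bar>h\<bar>"])
      show "eventually (\<lambda>h. norm ((flat k (0 + h) - flat k 0) / h) \<le> fact (k + 2) * \<bar>h\<bar>) (at 0)"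
      proof (rule eventually_mono[OF eventually_at_ball[of 1]])
        fix h :: real
        show "norm ((flat k (0 + h) - flat k 0) / h) \<le> fact (k + 2) * \<bar>h\<bar>"
          using flat_bound[of k h] by (cases "h = 0") (simp_all add: flat_def[of k 0] abs_divide divide_le_eq power2_eq_square mult.assoc)
      qed simp
      have "((\<lambda>h. fact (k + 2) * \<bar>h\<bar>) \<longlongrightarrow> fact (k + 2) * \<bar>0\<bar>) (at (0::real))" by (intro tendsto_intros)
      then show "((\<lambda>h. fact (k + 2) * \<bar>h\<bar>) \<longlongrightarrow> 0) (at (0::real))" by simp
    qed
    then have "(flat k has_real_derivative 0) (at 0)" by (simp add: DERIV_def)
    then show ?thesis using 3 by (simp add: flat_def)
  qed
qed

lemma times_differentiable_flat: "times_differentiable n (\<lambda>x. complex_of_real (flat k x))"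
proof (induction n arbitrary: k)
  case (Suc n)
  let ?d = "\<lambda>x. complex_of_real (flat (k + 2) x) + complex_of_real (- real k) * complex_of_real (flat (k + 1) x)"
  have "((\<lambda>x. complex_of_real (flat k x)) has_vector_derivative ?d x) (at x)" for x
    using has_vector_derivative_of_real[OF flat_deriv[of k x]] by simp
  moreover have "times_differentiable n ?d"
    by (intro times_differentiable_add times_differentiable_mult times_differentiable_const Suc.IH)
  ultimately show ?case unfolding times_differentiable.simps by (intro exI[of _ ?d] conjI allI)
qed simp

text \<open>A smooth step function, the normalized antiderivative of a bump function.\<close>

lemma smooth_step_exists:
  "\<exists>S S' :: real \<Rightarrow> real. smooth_line (\<lambda>x. complex_of_real (S x)) \<and> (\<forall>x. (S has_real_derivative S' x) (at x)) \<and>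
     (\<forall>x\<le>0. S x = 0) \<and> (\<forall>x\<ge>1. S x = 1) \<and> (\<forall>x. 0 \<le> S x \<and> S x \<le> 1) \<and> (\<forall>x. 0 \<le> S' x) \<and>
     (\<forall>x. x \<notin> {0..1} \<longrightarrow> S' x = 0)"
proof -
  define J where "J x = flat 0 x * flat 0 (1 - x)" for x
  have Jsm: "smooth_line (\<lambda>x. complex_of_real (J x))"
  proof -
    have f: "smooth_line (\<lambda>x. complex_of_real (flat 0 x))" by (simp add: smooth_line_def times_differentiable_flat)
    have "smooth_line (\<lambda>x. complex_of_real (flat 0 x) * complex_of_real (flat 0 (- 1 * x + 1)))"
      by (intro smooth_line_mult f smooth_line_affine[OF f])
    then show ?thesis by (simp add: J_def)
  qed
  have J0: "J x \<ge> 0" for x by (simp add: J_def flat_def)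
  have Jpos: "J x > 0" if "0 < x" "x < 1" for x using that by (simp add: J_def flat_def)
  have Jsupp: "J x = 0" if "x \<le> 0 \<or> x \<ge> 1" for x using that by (auto simp: J_def flat_def)
  have Jc: "isCont J x" for x
  proof -
    have "continuous_on UNIV (\<lambda>x. Re (complex_of_real (J x)))"
      by (intro continuous_on_Re smooth_line_continuous Jsm)
    then show ?thesis by (simp add: continuous_on_eq_continuous_at)
  qed
  obtain F where F: "\<And>x. (F has_vector_derivative J x) (at x)"
    using einterval_antiderivative[of "-\<infinity>" "\<infinity>" J] Jc by auto
  then have Fd: "(F has_real_derivative J x) (at x)" for x
    by (simp add: has_real_derivative_iff_has_vector_derivative)
  have mono: "F x \<le> F y" if "x \<le> y" for x y
    by (rule DERIV_nonneg_imp_nondecreasing[OF that]) (use Fd J0 in blast)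
  have lo: "F x = F 0" if "x \<le> 0" for x
  proof (cases "x = 0")
    case False
    with that have "x < 0" by simp
    from MVT2[OF this Fd] Jsupp show ?thesis by force
  qed simp
  have hi: "F x = F 1" if "x \<ge> 1" for x
  proof (cases "x = 1")
    case False
    with that have "1 < x" by simp
    from MVT2[OF this Fd] Jsupp show ?thesis by force
  qed simp
  have inc: "F 0 < F 1"
  proof -
    obtain z where "0 < z" "z < 1" "F 1 - F 0 = (1 - 0) * J z" using MVT2[OF zero_less_one Fd] by blast
    then show ?thesis using Jpos[of z] by simp
  qed
  define c where "c = F 1 - F 0"
  have c: "c > 0" using inc by (simp add: c_def)
  define S where "S x = (F x - F 0) / c" for x
  define S' where "S' x = J x / c" for x
  have Sd: "(S has_real_derivative S' x) (at x)" for x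
    unfolding S_def S'_def using Fd[of x] c by (auto intro!: derivative_eq_intros)
  have "smooth_line (\<lambda>x. complex_of_real (S' x))"
  proof -
    have "smooth_line (\<lambda>x. complex_of_real (1 / c) * complex_of_real (J x))"
      by (intro smooth_line_mult smooth_line_const Jsm)
    then show ?thesis by (simp add: S'_def)
  qed
  then have "smooth_line (\<lambda>x. complex_of_real (S x))"
    by (rule smooth_line_antideriv)
       (rule has_vector_derivative_of_real, use Sd in \<open>simp add: has_real_derivative_iff_has_vector_derivative\<close>)
  moreover have "0 \<le> S x \<and> S x \<le> 1" for x
  proof -
    have "F 0 \<le> F x" using mono[of 0 x] lo[of x] by (cases "0 \<le> x") auto
    moreover have "F x \<le> F 1" using mono[of x 1] hi[of x] by (cases "x \<le> 1") auto
    ultimately show ?thesis using c by (simp add: S_def c_def)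
  qed
  moreover have "S x = 0" if "x \<le> 0" for x using lo[OF that] by (simp add: S_def)
  moreover have "S x = 1" if "x \<ge> 1" for x using hi[OF that] c by (simp add: S_def c_def)
  moreover have "0 \<le> S' x" for x using J0[of x] c by (simp add: S'_def)
  moreover have "S' x = 0" if "x \<notin> {0..1}" for x using Jsupp[of x] that by (auto simp: S'_def)
  ultimately show ?thesis using Sd by blast
qed

subsection \<open>Tensor products of smooth functions\<close>

text \<open>Finite sums of products \<open>a(x) b(y)\<close> of smooth functions: a class of differentiable functions that
  contains its directional derivatives, as the coinductive notion of smoothness requires.\<close>

inductive_set tensor_sums :: "(real \<times> real \<Rightarrow> complex) set" where
  prod: "smooth_line a \<Longrightarrow> smooth_line b \<Longrightarrow> (\<lambda>p. a (fst p) * b (snd p)) \<in> tensor_sums"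
| add: "f \<in> tensor_sums \<Longrightarrow> g \<in> tensor_sums \<Longrightarrow> (\<lambda>p. f p + g p) \<in> tensor_sums"

lemma tensor_has_derivative:
  fixes a b :: "real \<Rightarrow> complex"
  assumes "\<And>x. (a has_vector_derivative a' x) (at x)" "\<And>x. (b has_vector_derivative b' x) (at x)"
  shows "((\<lambda>p. a (fst p) * b (snd p)) has_derivative
     (\<lambda>v. a (fst p) * (snd v *\<^sub>R b' (snd p)) + (fst v *\<^sub>R a' (fst p)) * b (snd p))) (at p)"
proof -
  have "((\<lambda>p. a (fst p)) has_derivative (\<lambda>v. fst v *\<^sub>R a' (fst p))) (at p)"
    by (rule has_derivative_compose[OF has_derivative_fst[OF has_derivative_ident], of a "\<lambda>t. t *\<^sub>R a' (fst p)" p UNIV, simplified])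
       (use assms(1) in \<open>simp add: has_vector_derivative_def\<close>)
  note d1 = this
  have "((\<lambda>p. b (snd p)) has_derivative (\<lambda>v. snd v *\<^sub>R b' (snd p))) (at p)"
    by (rule has_derivative_compose[OF has_derivative_snd[OF has_derivative_ident], of b "\<lambda>t. t *\<^sub>R b' (snd p)" p UNIV, simplified])
       (use assms(2) in \<open>simp add: has_vector_derivative_def\<close>)
  note d2 = this
  show ?thesis by (rule has_derivative_mult[OF d1 d2])
qed

lemma dir_deriv_tensor:
  assumes "\<And>x. (a has_vector_derivative a' x) (at x)" "\<And>x. (b has_vector_derivative b' x) (at x)"
  shows "dir_deriv v (\<lambda>p. a (fst p) * b (snd p)) =
     (\<lambda>p. a (fst p) * (complex_of_real (snd v) * b' (snd p)) + (complex_of_real (fst v) * a' (fst p)) * b (snd p))"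
  unfolding dir_deriv_def
  by (rule ext, subst frechet_derivative_at[OF tensor_has_derivative[OF assms], symmetric])
     (simp add: scaleR_conv_of_real)

lemma tensor_sums_differentiable:
  "f \<in> tensor_sums \<Longrightarrow> (\<forall>x. f differentiable (at x)) \<and> (\<forall>v. dir_deriv v f \<in> tensor_sums)"
proof (induction rule: tensor_sums.induct)
  case (prod a b)
  obtain a' where a': "\<And>x. (a has_vector_derivative a' x) (at x)" "smooth_line a'"
    using smooth_line_has_derivative[OF prod(1)] by blast
  obtain b' where b': "\<And>x. (b has_vector_derivative b' x) (at x)" "smooth_line b'"
    using smooth_line_has_derivative[OF prod(2)] by blast
  have "dir_deriv v (\<lambda>p. a (fst p) * b (snd p)) \<in> tensor_sums" for v
    unfolding dir_deriv_tensor[OF a'(1) b'(1)]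
    by (intro tensor_sums.intros smooth_line_mult smooth_line_const prod a' b')
  then show ?case using tensor_has_derivative[OF a'(1) b'(1)] unfolding differentiable_def by blast
next
  case (add f g)
  have "dir_deriv v (\<lambda>p. f p + g p) = (\<lambda>p. dir_deriv v f p + dir_deriv v g p)" for v
  proof
    fix p
    have "((\<lambda>p. f p + g p) has_derivative (\<lambda>v. frechet_derivative f (at p) v + frechet_derivative g (at p) v)) (at p)"
      using add.IH by (intro has_derivative_add) (simp_all only: frechet_derivative_works[symmetric])
    from frechet_derivative_at[OF this] show "dir_deriv v (\<lambda>p. f p + g p) p = dir_deriv v f p + dir_deriv v g p"
      unfolding dir_deriv_def by metis
  qed
  then show ?case using add by (auto intro: tensor_sums.add differentiable_add)
qed

lemma tensor_sums_smooth: "f \<in> tensor_sums \<Longrightarrow> smooth f"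
  by (coinduction arbitrary: f rule: smooth.coinduct) (use tensor_sums_differentiable in blast)

lemma tensor_test_function:
  assumes "smooth_line a" "smooth_line b" and a: "\<And>x. \<bar>x\<bar> > A \<Longrightarrow> a x = 0" and b: "\<And>x. \<bar>x\<bar> > A \<Longrightarrow> b x = 0"
  shows "(\<lambda>p. a (fst p) * b (snd p)) \<in> test_functions"
proof -
  have "smooth (\<lambda>p. a (fst p) * b (snd p))"
    by (intro tensor_sums_smooth tensor_sums.prod assms)
  moreover have "bounded {p. a (fst p) * b (snd p) \<noteq> 0}"
  proof (rule bounded_subset)
    show "bounded ({-A..A} \<times> {-A..A})" by (intro bounded_Times) auto
    show "{p. a (fst p) * b (snd p) \<noteq> 0} \<subseteq> {-A..A} \<times> {-A..A}"
    proof
      fix p assume "p \<in> {p. a (fst p) * b (snd p) \<noteq> 0}"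
      then have "\<not> \<bar>fst p\<bar> > A" "\<not> \<bar>snd p\<bar> > A" using a b by auto
      then show "p \<in> {-A..A} \<times> {-A..A}" by (cases p) auto
    qed
  qed
  ultimately show ?thesis by (simp add: test_functions_def compact_closure)
qed

section \<open>Slices of the rotated kernel\<close>

text \<open>A smooth cutoff function, equal to \<open>1\<close> on \<open>[-1, 1]\<close> and supported in \<open>[-2, 2]\<close>.\<close>

lemma smooth_cutoff_exists:
  "\<exists>\<theta> \<theta>' :: real \<Rightarrow> real. \<exists>c. smooth_line (\<lambda>x. complex_of_real (\<theta> x)) \<and>
     (\<forall>x. (\<theta> has_real_derivative \<theta>' x) (at x)) \<and> (\<forall>x. \<bar>x\<bar> \<le> 1 \<longrightarrow> \<theta> x = 1) \<and>
     (\<forall>x. \<bar>x\<bar> \<ge> 2 \<longrightarrow> \<theta> x = 0) \<and> (\<forall>x. \<bar>\<theta> x\<bar> \<le> 1) \<and> (\<forall>x. \<bar>\<theta>' x\<bar> \<le> c) \<and>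
     \<theta>' \<in> borel_measurable borel"
proof -
  obtain S S' :: "real \<Rightarrow> real" where sm: "smooth_line (\<lambda>x. complex_of_real (S x))"
    and d: "\<And>x. (S has_real_derivative S' x) (at x)"
    and S0: "\<And>x. x \<le> 0 \<Longrightarrow> S x = 0" and S1: "\<And>x. x \<ge> 1 \<Longrightarrow> S x = 1"
    and S01: "\<And>x. 0 \<le> S x" "\<And>x. S x \<le> 1"
    and S'0: "\<And>x. x \<notin> {0..1} \<Longrightarrow> S' x = 0"
    using smooth_step_exists by blast
  have "smooth_line (\<lambda>x. complex_of_real (S' x))"
    by (rule smooth_line_deriv[OF sm]) (rule has_vector_derivative_of_real[OF d])
  then have "continuous_on UNIV (\<lambda>x. Re (complex_of_real (S' x)))"
    by (intro continuous_on_Re smooth_line_continuous)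
  then have S'c: "continuous_on UNIV S'" by simp
  then have "compact (S' ` {0..1})"
    by (intro compact_continuous_image continuous_on_subset[OF S'c]) auto
  then obtain c where c: "\<And>y. y \<in> S' ` {0..1} \<Longrightarrow> \<bar>y\<bar> \<le> c"
    using compact_imp_bounded[of "S' ` {0..1}"] unfolding bounded_iff real_norm_def by blast
  have S'b: "\<bar>S' x\<bar> \<le> max 0 c" for x
    using S'0[of x] c[of "S' x"] by (cases "x \<in> {0..1}") auto
  define \<theta> where "\<theta> x = S (x + 2) - S (x - 1)" for x
  define \<theta>' where "\<theta>' x = S' (x + 2) - S' (x - 1)" for x
  have "smooth_line (\<lambda>x. complex_of_real (S (1 * x + 2)) + complex_of_real (-1) * complex_of_real (S (1 * x + - 1)))"
    by (intro smooth_line_add smooth_line_mult smooth_line_const smooth_line_affine[OF sm])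
  then have "smooth_line (\<lambda>x. complex_of_real (\<theta> x))" by (simp add: \<theta>_def)
  moreover have "(\<theta> has_real_derivative \<theta>' x) (at x)" for x
  proof -
    have "((\<lambda>x. S (x + a)) has_real_derivative S' (x + a)) (at x)" for a
      using d[of "x + a"] by (simp add: DERIV_shift)
    from DERIV_diff[OF this[of 2] this[of "-1"]] show ?thesis by (simp add: \<theta>_def[abs_def] \<theta>'_def)
  qed
  moreover have "\<theta> x = 1" if "\<bar>x\<bar> \<le> 1" for x
    using S1[of "x + 2"] S0[of "x - 1"] that by (simp add: \<theta>_def)
  moreover have "\<theta> x = 0" if "\<bar>x\<bar> \<ge> 2" for x
  proof (cases "x \<ge> 2")
    case True
    then show ?thesis using S1[of "x + 2"] S1[of "x - 1"] by (simp add: \<theta>_def)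
  next
    case False
    then show ?thesis using S0[of "x + 2"] S0[of "x - 1"] that by (simp add: \<theta>_def)
  qed
  moreover have "\<bar>\<theta> x\<bar> \<le> 1" for x
    using S01(1)[of "x + 2"] S01(2)[of "x + 2"] S01(1)[of "x - 1"] S01(2)[of "x - 1"]
    unfolding \<theta>_def by linarith
  moreover have "\<bar>\<theta>' x\<bar> \<le> max 0 c + max 0 c" for x
    using S'b[of "x + 2"] S'b[of "x - 1"] unfolding \<theta>'_def by linarith
  moreover have "\<theta>' \<in> borel_measurable borel"
    unfolding \<theta>'_def using borel_measurable_continuous_onI[OF S'c] by measurable
  ultimately show ?thesis by blast
qed

text \<open>Up to a translation in \<open>x\<close>, the slice of the rotated kernel at height \<open>y\<close> is \<open>X \<mapsto> K(X, X - h y)\<close>.\<close>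

lemma rotated_kernel_slice:
  assumes K: "(\<lambda>z X. K (X, X + z)) \<in> Cb_L1"
  shows "integrable lborel (\<lambda>x. rotated_kernel h K (x, y))"
proof -
  have "integrable lborel (\<lambda>X. K (X, X + - h * y))" using K unfolding Cb_L1_def mem_Collect_eq by blast
  from lborel_integrable_real_affine[OF this, of 1 "h / 2 * y"]
  show ?thesis by (simp add: rotated_kernel_def algebra_simps)
qed

lemma rotated_kernel_slice_integral:
  "(\<integral>x. rotated_kernel h K (x, y) * \<alpha> x \<partial>lborel) = (\<integral>X. K (X, X + - h * y) * \<alpha> (X - h / 2 * y) \<partial>lborel)"
proof -
  have "(\<integral>X. K (X, X + - h * y) * \<alpha> (X - h / 2 * y) \<partial>lborel)
    = (\<integral>x. K (h / 2 * y + 1 * x, h / 2 * y + 1 * x + - h * y) * \<alpha> (h / 2 * y + 1 * x - h / 2 * y) \<partial>lborel)"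
    using lborel_integral_real_affine[of 1 "\<lambda>X. K (X, X + - h * y) * \<alpha> (X - h / 2 * y)" "h / 2 * y"] by simp
  also have "\<dots> = (\<integral>x. rotated_kernel h K (x, y) * \<alpha> x \<partial>lborel)"
    by (intro Bochner_Integration.integral_cong) (auto simp: rotated_kernel_def algebra_simps)
  finally show ?thesis by simp
qed

lemma rotated_kernel_measurable:
  assumes [measurable]: "K \<in> borel_measurable borel"
  shows "rotated_kernel h K \<in> borel_measurable borel"
proof -
  have "(\<lambda>p. K (fst p + h / 2 * snd p, fst p - h / 2 * snd p)) \<in> borel_measurable (borel \<Otimes>\<^sub>M borel)"
    by measurable
  then show ?thesis by (simp add: rotated_kernel_def split_beta' borel_prod)
qed

lemma rotated_kernel_L2:
  assumes K: "K \<in> L2" and h: "h > 0"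
  shows "rotated_kernel h K \<in> L2"
proof -
  have [measurable]: "K \<in> borel_measurable borel" by (rule L2_measurable[OF K])
  note [measurable] = rotated_kernel_measurable[of K h]
  let ?q = "\<lambda>X Y. ennreal ((cmod (K (X, Y)))\<^sup>2)"
  have "(\<integral>\<^sup>+p. ennreal ((cmod (rotated_kernel h K p))\<^sup>2) \<partial>lborel)
      = (\<integral>\<^sup>+p. (\<lambda>(x, y). ?q (x + h / 2 * y) (x - h / 2 * y)) p \<partial>(lborel \<Otimes>\<^sub>M lborel))"
    unfolding lborel_prod by (intro nn_integral_cong) (simp add: rotated_kernel_def split_beta')
  also have "\<dots> = (\<integral>\<^sup>+y. \<integral>\<^sup>+x. ?q (x + h / 2 * y) (x - h / 2 * y) \<partial>lborel \<partial>lborel)"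
    by (subst lborel_pair.nn_integral_snd[symmetric]) (simp_all add: split_beta' borel_prod)
  also have "\<dots> = (\<integral>\<^sup>+y. \<integral>\<^sup>+X. ?q X (X + (- h) * y) \<partial>lborel \<partial>lborel)"
  proof (rule nn_integral_cong)
    fix y
    show "(\<integral>\<^sup>+x. ?q (x + h / 2 * y) (x - h / 2 * y) \<partial>lborel) = (\<integral>\<^sup>+X. ?q X (X + (- h) * y) \<partial>lborel)"
      by (subst (2) nn_integral_real_affine[of _ 1 "h / 2 * y"]) (auto simp: algebra_simps)
  qed
  also have "\<dots> = (\<integral>\<^sup>+X. \<integral>\<^sup>+y. ?q X (X + (- h) * y) \<partial>lborel \<partial>lborel)"
    by (rule lborel_pair.Fubini') (simp add: split_beta' borel_prod)
  also have "\<dots> = (\<integral>\<^sup>+X. ennreal (1 / h) * (\<integral>\<^sup>+Y. ?q X Y \<partial>lborel) \<partial>lborel)"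
  proof (rule nn_integral_cong)
    fix X
    have "(\<integral>\<^sup>+Y. ?q X Y \<partial>lborel) = ennreal h * (\<integral>\<^sup>+y. ?q X (X + (- h) * y) \<partial>lborel)"
      using h by (subst nn_integral_real_affine[of _ "- h" X]) auto
    then have "ennreal (1 / h) * (\<integral>\<^sup>+Y. ?q X Y \<partial>lborel) = (ennreal (1 / h) * ennreal h) * (\<integral>\<^sup>+y. ?q X (X + (- h) * y) \<partial>lborel)"
      by (simp only: mult.assoc)
    also have "ennreal (1 / h) * ennreal h = 1" using h by (simp flip: ennreal_mult)
    finally show "(\<integral>\<^sup>+y. ?q X (X + (- h) * y) \<partial>lborel) = ennreal (1 / h) * (\<integral>\<^sup>+Y. ?q X Y \<partial>lborel)" by simp
  qed
  also have "\<dots> = ennreal (1 / h) * (\<integral>\<^sup>+X. \<integral>\<^sup>+Y. ?q X Y \<partial>lborel \<partial>lborel)"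
    by (rule nn_integral_cmult) measurable
  also have "(\<integral>\<^sup>+X. \<integral>\<^sup>+Y. ?q X Y \<partial>lborel \<partial>lborel) = (\<integral>\<^sup>+p. ennreal ((cmod (K p))\<^sup>2) \<partial>(lborel \<Otimes>\<^sub>M lborel))"
    by (subst lborel.nn_integral_fst[symmetric]) (simp_all add: lborel_prod)
  finally have eq: "(\<integral>\<^sup>+p. ennreal ((cmod (rotated_kernel h K p))\<^sup>2) \<partial>lborel)
     = ennreal (1 / h) * (\<integral>\<^sup>+p. ennreal ((cmod (K p))\<^sup>2) \<partial>(lborel \<Otimes>\<^sub>M lborel))" .
  have "(\<integral>\<^sup>+p. ennreal ((cmod (K p))\<^sup>2) \<partial>(lborel \<Otimes>\<^sub>M lborel)) < \<infinity>"
    using L2_integrable[OF K] unfolding lborel_prod integrable_iff_bounded by simp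
  then have fin: "(\<integral>\<^sup>+p. ennreal ((cmod (rotated_kernel h K p))\<^sup>2) \<partial>lborel) < \<infinity>"
    unfolding eq by (simp add: ennreal_mult_less_top)
  have "integrable lborel (\<lambda>p. (cmod (rotated_kernel h K p))\<^sup>2)"
    by (rule integrableI_nonneg) (use fin in \<open>auto simp: less_top\<close>)
  then show ?thesis by (simp add: L2_def)
qed

text \<open>Testing the slices against a bounded continuous function gives a bounded continuous function
  of the transversal variable; continuity of translations in \<open>L\<^sup>1\<close> is not needed because the shift is
  moved to the test function.\<close>

lemma rotated_kernel_slice_continuous:
  assumes K: "(\<lambda>z X. K (X, X + z)) \<in> Cb_L1" and \<alpha>: "continuous_on UNIV \<alpha>" and m: "\<And>x. cmod (\<alpha> x) \<le> m"
  shows "\<exists>B. \<forall>y. cmod (\<integral>x. rotated_kernel h K (x, y) * \<alpha> x \<partial>lborel) \<le> B"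
    and "isCont (\<lambda>y. \<integral>x. rotated_kernel h K (x, y) * \<alpha> x \<partial>lborel) y0"
proof -
  have [measurable]: "\<alpha> \<in> borel_measurable borel" by (rule borel_measurable_continuous_onI[OF \<alpha>])
  have Fi: "integrable lborel (\<lambda>X. K (X, X + z))" for z using K by (simp add: Cb_L1_def)
  have Fm [measurable]: "(\<lambda>X. K (X, X + z)) \<in> borel_measurable borel" for z
    using borel_measurable_integrable[OF Fi[of z]] by simp
  have m0: "m \<ge> 0" using m[of 0] norm_ge_zero[of "\<alpha> 0"] by linarith
  have int: "integrable lborel (\<lambda>X. K (X, X + z) * \<alpha> (X - s))" for z s
  proof (rule Bochner_Integration.integrable_bound[OF integrable_mult_left[OF integrable_norm[OF Fi[of z]], of m]])
    show "AE X in lborel. norm (K (X, X + z) * \<alpha> (X - s)) \<le> norm (cmod (K (X, X + z)) * m)"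
      using m m0 by (auto simp: norm_mult abs_mult intro!: mult_left_mono)
  qed measurable
  have bd: "cmod (\<integral>X. g X * \<alpha> (X - s) \<partial>lborel) \<le> (\<integral>X. cmod (g X) \<partial>lborel) * m"
    if g: "integrable lborel g" for g s
  proof -
    have [measurable]: "g \<in> borel_measurable borel" using borel_measurable_integrable[OF g] by simp
    have b: "cmod (g X * \<alpha> (X - s)) \<le> cmod (g X) * m" for X
      unfolding norm_mult by (intro mult_left_mono m) simp
    have i: "integrable lborel (\<lambda>X. cmod (g X) * m)" using g by simp
    have "cmod (\<integral>X. g X * \<alpha> (X - s) \<partial>lborel) \<le> (\<integral>X. cmod (g X) * m \<partial>lborel)"
      by (rule Bochner_Integration.integral_norm_bound_integral[OF Bochner_Integration.integrable_bound[OF i] i])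
         (use b in \<open>auto intro!: AE_I2 order_trans[OF b]\<close>)
    then show ?thesis by simp
  qed
  obtain B where B: "\<And>z. (\<integral>x. cmod (K (x, x + z)) \<partial>lborel) \<le> B" using K by (auto simp: Cb_L1_def)
  show "\<exists>B. \<forall>y. cmod (\<integral>x. rotated_kernel h K (x, y) * \<alpha> x \<partial>lborel) \<le> B"
  proof (intro exI allI)
    fix y
    show "cmod (\<integral>x. rotated_kernel h K (x, y) * \<alpha> x \<partial>lborel) \<le> B * m"
      unfolding rotated_kernel_slice_integral
      by (rule order_trans[OF bd[OF Fi] mult_right_mono[OF B m0]])
  qed
  define z where "z y = - h * y" for y
  define F where "F y X = K (X, X + z y)" for y X
  have FI: "integrable lborel (F y)" for y unfolding F_def by (rule Fi)
  have [measurable]: "F y \<in> borel_measurable borel" for y unfolding F_def by measurable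
  have lim1: "((\<lambda>y. \<integral>X. cmod (F y X - F y0 X) \<partial>lborel) \<longlongrightarrow> 0) (at y0)"
  proof -
    define N where "N w = (\<integral>X. cmod (K (X, X + w) - K (X, X + z y0)) \<partial>lborel)" for w
    have "(N \<longlongrightarrow> 0) (at (z y0))" using K unfolding N_def Cb_L1_def by simp
    then have "isCont N (z y0)" by (simp add: isCont_def N_def)
    moreover have "isCont z y0" unfolding z_def by (intro continuous_intros)
    ultimately have "isCont (\<lambda>y. N (z y)) y0" by (rule isCont_o2[rotated])
    then show ?thesis by (simp add: isCont_def N_def F_def)
  qed
  have lim2: "((\<lambda>y. \<integral>X. F y0 X * \<alpha> (X - h / 2 * y) \<partial>lborel) \<longlongrightarrow> (\<integral>X. F y0 X * \<alpha> (X - h / 2 * y0) \<partial>lborel)) (at y0)"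
    unfolding tendsto_at_iff_sequentially
  proof (intro allI impI)
    fix s :: "nat \<Rightarrow> real" assume s: "\<forall>i. s i \<in> UNIV - {y0}" "s \<longlonglongrightarrow> y0"
    show "((\<lambda>y. \<integral>X. F y0 X * \<alpha> (X - h / 2 * y) \<partial>lborel) \<circ> s) \<longlonglongrightarrow> (\<integral>X. F y0 X * \<alpha> (X - h / 2 * y0) \<partial>lborel)"
      unfolding o_def
    proof (rule integral_dominated_convergence[where w="\<lambda>X. cmod (F y0 X) * m"])
      show "integrable lborel (\<lambda>X. cmod (F y0 X) * m)" using FI by simp
      show "AE X in lborel. (\<lambda>i. F y0 X * \<alpha> (X - h / 2 * s i)) \<longlonglongrightarrow> F y0 X * \<alpha> (X - h / 2 * y0)"
      proof (intro AE_I2 tendsto_mult_left)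
        fix X
        have "(\<lambda>i. X - h / 2 * s i) \<longlonglongrightarrow> X - h / 2 * y0" by (intro tendsto_intros s(2))
        moreover have "isCont \<alpha> (X - h / 2 * y0)" using \<alpha> by (simp add: continuous_on_eq_continuous_at)
        ultimately show "(\<lambda>i. \<alpha> (X - h / 2 * s i)) \<longlonglongrightarrow> \<alpha> (X - h / 2 * y0)" by (rule isCont_tendsto_compose[rotated])
      qed
      show "AE X in lborel. norm (F y0 X * \<alpha> (X - h / 2 * s i)) \<le> cmod (F y0 X) * m" for i
        unfolding norm_mult by (intro AE_I2 mult_left_mono m) simp
    qed measurable
  qed
  have split: "(\<integral>X. F y X * \<alpha> (X - h / 2 * y) \<partial>lborel) =
      (\<integral>X. F y0 X * \<alpha> (X - h / 2 * y) \<partial>lborel) + (\<integral>X. (F y X - F y0 X) * \<alpha> (X - h / 2 * y) \<partial>lborel)" for y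
  proof -
    have i1: "integrable lborel (\<lambda>X. F y0 X * \<alpha> (X - h / 2 * y))" unfolding F_def by (rule int)
    have i2: "integrable lborel (\<lambda>X. F y X * \<alpha> (X - h / 2 * y))" unfolding F_def by (rule int)
    have "(\<lambda>X. (F y X - F y0 X) * \<alpha> (X - h / 2 * y)) = (\<lambda>X. F y X * \<alpha> (X - h / 2 * y) - F y0 X * \<alpha> (X - h / 2 * y))"
      by (simp add: left_diff_distrib)
    then show ?thesis using Bochner_Integration.integral_diff[OF i2 i1] by simp
  qed
  have lim3: "((\<lambda>y. \<integral>X. (F y X - F y0 X) * \<alpha> (X - h / 2 * y) \<partial>lborel) \<longlongrightarrow> 0) (at y0)"
  proof (rule Lim_null_comparison)
    show "eventually (\<lambda>y. norm (\<integral>X. (F y X - F y0 X) * \<alpha> (X - h / 2 * y) \<partial>lborel) \<le> (\<integral>X. cmod (F y X - F y0 X) \<partial>lborel) * m) (at y0)"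
      by (intro always_eventually allI bd Bochner_Integration.integrable_diff FI)
    show "((\<lambda>y. (\<integral>X. cmod (F y X - F y0 X) \<partial>lborel) * m) \<longlongrightarrow> 0) (at y0)"
      using tendsto_mult_right[OF lim1, of m] by simp
  qed
  have "((\<lambda>y. \<integral>X. F y X * \<alpha> (X - h / 2 * y) \<partial>lborel) \<longlongrightarrow> (\<integral>X. F y0 X * \<alpha> (X - h / 2 * y0) \<partial>lborel)) (at y0)"
    using tendsto_add[OF lim2 lim3] unfolding split[symmetric] by simp
  then show "isCont (\<lambda>y. \<integral>x. rotated_kernel h K (x, y) * \<alpha> x \<partial>lborel) y0"
    unfolding isCont_def rotated_kernel_slice_integral F_def z_def .
qed

section \<open>From the weak equation to increments of slices\<close>

lemma L2_mult_bounded_support: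
  fixes f g :: "real \<times> real \<Rightarrow> complex"
  assumes f: "f \<in> L2" and g [measurable]: "g \<in> borel_measurable borel" and C: "\<And>p. cmod (g p) \<le> C"
    and supp: "\<And>p. p \<notin> {-L..L} \<times> {-L..L} \<Longrightarrow> g p = 0"
  shows "integrable lborel (\<lambda>p. f p * g p)"
proof -
  note [measurable] = L2_measurable[OF f]
  have B: "integrable lborel (indicator ({-L..L} \<times> {-L..L}) :: real \<times> real \<Rightarrow> real)"
  proof (rule integrable_real_indicator)
    have "bounded ({-L..L} \<times> {-L..L})" by (intro bounded_Times) auto
    then show "emeasure lborel ({-L..L} \<times> {-L..L}) < \<infinity>" by (rule emeasure_bounded_finite)
  qed (auto simp: closed_Times intro!: borel_closed)
  have "integrable lborel (\<lambda>p. (cmod (g p))\<^sup>2)"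
  proof (rule Bochner_Integration.integrable_bound[OF integrable_mult_right[OF B, of "C\<^sup>2"]])
    have "norm ((cmod (g p))\<^sup>2) \<le> norm (C\<^sup>2 * indicator ({-L..L} \<times> {-L..L}) p)" for p
      using power_mono[OF C[of p] norm_ge_zero, of 2] supp[of p] by (cases "p \<in> {-L..L} \<times> {-L..L}") simp_all
    then show "AE p in lborel. norm ((cmod (g p))\<^sup>2) \<le> norm (C\<^sup>2 * indicator ({-L..L} \<times> {-L..L}) p)" by simp
  qed measurable
  then have "g \<in> L2" by (simp add: L2_def)
  moreover have "(\<lambda>p. cnj (f p)) \<in> L2" using L2_integrable[OF f] by (simp add: L2_def)
  ultimately show ?thesis using L2_product_integrable[of "\<lambda>p. cnj (f p)" g] by simp
qed

lemma continuous_compact_support_bounded: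
  fixes a :: "real \<Rightarrow> complex"
  assumes "continuous_on UNIV a" "\<And>x. \<bar>x\<bar> > L \<Longrightarrow> a x = 0"
  shows "\<exists>C\<ge>0. \<forall>x. cmod (a x) \<le> C"
proof -
  have "compact (a ` {-L..L})"
    by (intro compact_continuous_image continuous_on_subset[OF assms(1)]) auto
  then obtain c where c: "\<And>y. y \<in> a ` {-L..L} \<Longrightarrow> cmod y \<le> c"
    using compact_imp_bounded[of "a ` {-L..L}"] unfolding bounded_iff by blast
  have "cmod (a x) \<le> max 0 c" for x
  proof (cases "\<bar>x\<bar> > L")
    case False
    then have "a x \<in> a ` {-L..L}" by (intro imageI) auto
    then show ?thesis using c by (auto simp: le_max_iff_disj)
  qed (simp add: assms(2))
  then show ?thesis by (intro exI[of _ "max 0 c"]) auto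
qed

lemma deriv_zero_outside:
  fixes a :: "real \<Rightarrow> complex"
  assumes "\<And>x. (a has_vector_derivative a' x) (at x)" "\<And>x. \<bar>x\<bar> > L \<Longrightarrow> a x = 0" "\<bar>x\<bar> > L"
  shows "a' x = 0"
proof -
  have "open {x :: real. \<bar>x\<bar> > L}" by (intro open_Collect_less continuous_intros)
  then have "((\<lambda>_. 0) has_vector_derivative a' x) (at x)"
    using assms by (intro has_vector_derivative_transform_within_open[OF assms(1), of "{x. \<bar>x\<bar> > L}"]) auto
  then show ?thesis by (rule vector_derivative_unique_at) simp
qed

text \<open>The weak equation tested with a product \<open>a(x) b(y)\<close>, after Fubini.\<close>

lemma weak_equation_tensor:
  fixes u :: "nat \<Rightarrow> real \<times> real \<Rightarrow> complex" and a b :: "real \<Rightarrow> complex"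
  assumes F: "F \<in> L2" and u: "\<And>k. k \<le> n \<Longrightarrow> u k \<in> L2"
    and weak: "distr_eq
        (distr_deriv (0, 1) (distr_scale (- \<i>) (distr_deriv (1, 0) (distr_of F))))
        (distr_of (\<lambda>(x, y). \<Sum>k\<le>n. u k (x, y) * complex_of_real y ^ k))"
    and a: "smooth_line a" "\<And>x. (a has_vector_derivative a' x) (at x)" "\<And>x. \<bar>x\<bar> > L \<Longrightarrow> a x = 0"
    and b: "smooth_line b" "\<And>x. (b has_vector_derivative b' x) (at x)" "\<And>x. \<bar>x\<bar> > L \<Longrightarrow> b x = 0"
  shows "integrable lborel (\<lambda>y. b y * (\<integral>x. (\<Sum>k\<le>n. u k (x, y) * complex_of_real y ^ k) * a x \<partial>lborel))"
    and "AE y in lborel. \<forall>k\<le>n. b y \<noteq> 0 \<longrightarrow> integrable lborel (\<lambda>x. u k (x, y) * a x)"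
    and "- \<i> * (\<integral>y. b' y * (\<integral>x. F (x, y) * a' x \<partial>lborel) \<partial>lborel)
       = (\<integral>y. b y * (\<integral>x. (\<Sum>k\<le>n. u k (x, y) * complex_of_real y ^ k) * a x \<partial>lborel) \<partial>lborel)"
proof -
  have a's: "smooth_line a'" "smooth_line b'" using smooth_line_deriv[OF a(1,2)] smooth_line_deriv[OF b(1,2)] by auto
  have a'0: "a' x = 0" "b' x = 0" if "\<bar>x\<bar> > L" for x
    using deriv_zero_outside[OF a(2,3) that] deriv_zero_outside[OF b(2,3) that] by auto
  note cont = smooth_line_continuous[OF a(1)] smooth_line_continuous[OF b(1)] smooth_line_continuous[OF a's(1)] smooth_line_continuous[OF a's(2)]
  note [measurable] = cont[THEN borel_measurable_continuous_onI]
  obtain Ca where Ca: "Ca \<ge> 0" "\<And>x. cmod (a x) \<le> Ca" using continuous_compact_support_bounded[OF cont(1) a(3)] by blast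
  obtain Cb where Cb: "Cb \<ge> 0" "\<And>x. cmod (b x) \<le> Cb" using continuous_compact_support_bounded[OF cont(2) b(3)] by blast
  obtain Ca' where Ca': "Ca' \<ge> 0" "\<And>x. cmod (a' x) \<le> Ca'" using continuous_compact_support_bounded[OF cont(3) a'0(1)] by blast
  obtain Cb' where Cb': "Cb' \<ge> 0" "\<And>x. cmod (b' x) \<le> Cb'" using continuous_compact_support_bounded[OF cont(4) a'0(2)] by blast
  define \<phi> where "\<phi> = (\<lambda>p. a (fst p) * b (snd p))"
  have "\<phi> \<in> test_functions" unfolding \<phi>_def by (rule tensor_test_function[OF a(1) b(1) a(3) b(3)])
  with weak have eq: "distr_deriv (0, 1) (distr_scale (- \<i>) (distr_deriv (1, 0) (distr_of F))) \<phi>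
    = distr_of (\<lambda>(x, y). \<Sum>k\<le>n. u k (x, y) * complex_of_real y ^ k) \<phi>" by (simp add: distr_eq_def)
  have "dir_deriv (0, 1) \<phi> = (\<lambda>p. a (fst p) * b' (snd p))"
    unfolding \<phi>_def dir_deriv_tensor[OF a(2) b(2)] by simp
  then have dd: "dir_deriv (1, 0) (dir_deriv (0, 1) \<phi>) = (\<lambda>p. a' (fst p) * b' (snd p))"
  proof -
    assume e: "dir_deriv (0, 1) \<phi> = (\<lambda>p. a (fst p) * b' (snd p))"
    obtain b'' where b'': "\<And>x. (b' has_vector_derivative b'' x) (at x)"
      using smooth_line_has_derivative[OF a's(2)] by blast
    show ?thesis unfolding e dir_deriv_tensor[OF a(2) b''] by simp
  qed
  have iF: "integrable lborel (\<lambda>p. F p * (a' (fst p) * b' (snd p)))"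
  proof (rule L2_mult_bounded_support[OF F, where L=L and C="Ca' * Cb'"])
    show "(\<lambda>p. a' (fst p) * b' (snd p)) \<in> borel_measurable borel" unfolding borel_prod[symmetric] by measurable
    show "cmod (a' (fst p) * b' (snd p)) \<le> Ca' * Cb'" for p
      unfolding norm_mult by (intro mult_mono Ca' Cb') auto
    fix p assume "p \<notin> {-L..L} \<times> {-L..L}"
    then have "\<bar>fst p\<bar> > L \<or> \<bar>snd p\<bar> > L" by (cases p) auto
    then show "a' (fst p) * b' (snd p) = 0" using a'0 by auto
  qed
  have iu: "integrable lborel (\<lambda>p. u k p * (complex_of_real (snd p) ^ j * (a (fst p) * b (snd p))))" if "k \<le> n" for k j
  proof (rule L2_mult_bounded_support[OF u[OF that], where L=L and C="\<bar>L\<bar> ^ j * (Ca * Cb)"])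
    show "(\<lambda>p. complex_of_real (snd p) ^ j * (a (fst p) * b (snd p))) \<in> borel_measurable borel" unfolding borel_prod[symmetric] by measurable
    fix p :: "real \<times> real"
    show "cmod (complex_of_real (snd p) ^ j * (a (fst p) * b (snd p))) \<le> \<bar>L\<bar> ^ j * (Ca * Cb)"
    proof (cases "\<bar>snd p\<bar> > L")
      case True
      then show ?thesis using b(3)[OF True] Ca(1) Cb(1) by simp
    next
      case False
      then show ?thesis unfolding norm_mult norm_power norm_of_real
        by (intro mult_mono power_mono Ca Cb mult_nonneg_nonneg) auto
    qed
    assume "p \<notin> {-L..L} \<times> {-L..L}"
    then have "\<bar>fst p\<bar> > L \<or> \<bar>snd p\<bar> > L" by (cases p) auto
    then show "complex_of_real (snd p) ^ j * (a (fst p) * b (snd p)) = 0" using a(3) b(3) by auto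
  qed
  define U where "U = (\<lambda>(x, y). \<Sum>k\<le>n. u k (x, y) * complex_of_real y ^ k)"
  have iU: "integrable lborel (\<lambda>p. U p * \<phi> p)"
  proof -
    have "(\<lambda>p. U p * \<phi> p) = (\<lambda>p. \<Sum>k\<le>n. u k p * (complex_of_real (snd p) ^ k * (a (fst p) * b (snd p))))"
      by (rule ext) (simp add: U_def \<phi>_def split_beta' sum_distrib_right mult.assoc)
    then show ?thesis using iu by (auto intro!: Bochner_Integration.integrable_sum)
  qed
  have l: "- \<i> * (\<integral>p. F p * (a' (fst p) * b' (snd p)) \<partial>lborel) = (\<integral>p. U p * \<phi> p \<partial>lborel)"
    using eq unfolding U_def[symmetric] by (simp add: distr_deriv_def distr_scale_def distr_of_def dd)
  have iF': "integrable (lborel \<Otimes>\<^sub>M lborel) (\<lambda>(x, y). F (x, y) * (a' x * b' y))"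
    using iF by (simp add: lborel_prod split_beta')
  have iU': "integrable (lborel \<Otimes>\<^sub>M lborel) (\<lambda>(x, y). U (x, y) * \<phi> (x, y))"
    using iU by (simp add: lborel_prod split_beta')
  have e1: "(\<integral>y. b' y * (\<integral>x. F (x, y) * a' x \<partial>lborel) \<partial>lborel) = (\<integral>p. F p * (a' (fst p) * b' (snd p)) \<partial>lborel)"
  proof -
    have "(\<integral>x. F (x, y) * (a' x * b' y) \<partial>lborel) = b' y * (\<integral>x. F (x, y) * a' x \<partial>lborel)" for y
      by (subst integral_mult_right_zero[symmetric], intro Bochner_Integration.integral_cong) (auto simp: mult_ac)
    then show ?thesis using lborel_pair.integral_snd[OF iF'] by (simp add: lborel_prod split_beta')
  qed
  have U\<phi>: "(\<integral>x. U (x, y) * \<phi> (x, y) \<partial>lborel) = b y * (\<integral>x. (\<Sum>k\<le>n. u k (x, y) * complex_of_real y ^ k) * a x \<partial>lborel)" for y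
    by (subst integral_mult_right_zero[symmetric], intro Bochner_Integration.integral_cong) (auto simp: mult_ac U_def \<phi>_def)
  have e2: "(\<integral>y. b y * (\<integral>x. (\<Sum>k\<le>n. u k (x, y) * complex_of_real y ^ k) * a x \<partial>lborel) \<partial>lborel) = (\<integral>p. U p * \<phi> p \<partial>lborel)"
    using lborel_pair.integral_snd[OF iU'] by (simp add: lborel_prod split_beta' U\<phi>)
  show "- \<i> * (\<integral>y. b' y * (\<integral>x. F (x, y) * a' x \<partial>lborel) \<partial>lborel)
       = (\<integral>y. b y * (\<integral>x. (\<Sum>k\<le>n. u k (x, y) * complex_of_real y ^ k) * a x \<partial>lborel) \<partial>lborel)"
    unfolding e1 e2 by (rule l)
  show "integrable lborel (\<lambda>y. b y * (\<integral>x. (\<Sum>k\<le>n. u k (x, y) * complex_of_real y ^ k) * a x \<partial>lborel))"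
    using lborel_pair.integrable_snd[OF iU'] by (simp add: U\<phi>)
  have "AE y in lborel. b y \<noteq> 0 \<longrightarrow> integrable lborel (\<lambda>x. u k (x, y) * a x)" if "k \<le> n" for k
  proof -
    have "integrable (lborel \<Otimes>\<^sub>M lborel) (\<lambda>(x, y). u k (x, y) * (a x * b y))"
      using iu[OF that, of 0] by (simp add: lborel_prod split_beta')
    from lborel_pair.AE_integrable_snd[OF this] show ?thesis
    proof eventually_elim
      case (elim y)
      then have "integrable lborel (\<lambda>x. (u k (x, y) * a x) * b y)" by (simp add: mult_ac)
      then have "integrable lborel (\<lambda>x. (u k (x, y) * a x) * b y * inverse (b y))"
        by (rule integrable_mult_left)
      then show ?case by (auto simp: mult.assoc)
    qed
  qed
  then have "AE y in lborel. \<forall>k\<in>{..n}. b y \<noteq> 0 \<longrightarrow> integrable lborel (\<lambda>x. u k (x, y) * a x)"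
    by (intro AE_finite_allI) auto
  then show "AE y in lborel. \<forall>k\<le>n. b y \<noteq> 0 \<longrightarrow> integrable lborel (\<lambda>x. u k (x, y) * a x)"
    by eventually_elim auto
qed

text \<open>The derivative of a step that rises from \<open>0\<close> to \<open>1\<close> on \<open>[0, 1]\<close>, rescaled, is an approximate identity.\<close>

lemma mollifier_tendsto:
  fixes A :: "real \<Rightarrow> complex" and S' :: "real \<Rightarrow> real"
  assumes d: "\<And>x. (S has_real_derivative S' x) (at x)"
    and S: "\<And>x. x \<le> 0 \<Longrightarrow> S x = 0" "\<And>x. x \<ge> 1 \<Longrightarrow> S x = 1"
    and S': "\<And>x. 0 \<le> S' x" "\<And>x. x \<notin> {0..1} \<Longrightarrow> S' x = 0" "continuous_on UNIV S'"
    and A: "\<And>y. isCont A y" "\<And>y. cmod (A y) \<le> B"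
  shows "(\<lambda>m. \<integral>y. complex_of_real (real (Suc m) * S' (real (Suc m) * (y - c))) * A y \<partial>lborel) \<longlonglongrightarrow> A c"
    and "\<And>m. integrable lborel (\<lambda>y. complex_of_real (real (Suc m) * S' (real (Suc m) * (y - c))) * A y)"
proof -
  have [measurable]: "S' \<in> borel_measurable borel" by (rule borel_measurable_continuous_onI[OF S'(3)])
  have "continuous_on UNIV A" using A(1) by (simp add: continuous_on_eq_continuous_at)
  then have [measurable]: "A \<in> borel_measurable borel" by (rule borel_measurable_continuous_onI)
  have B0: "B \<ge> 0" using A(2)[of 0] norm_ge_zero[of "A 0"] by linarith
  have "has_bochner_integral lborel (\<lambda>x. S' x * indicator {0..1} x) (S 1 - S 0)"
    by (rule has_bochner_integral_FTC_Icc_real) (use d S' in \<open>auto simp: continuous_on_eq_continuous_at\<close>)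
  moreover have "(\<lambda>x. S' x * indicator {0..1} x) = S'"
  proof
    show "S' x * indicator {0..1} x = S' x" for x
      using S'(2)[of x] by (cases "x \<in> {0..1}") simp_all
  qed
  ultimately have I: "has_bochner_integral lborel S' 1" using S by simp
  then have Si: "integrable lborel S'" and SI: "(\<integral>x. S' x \<partial>lborel) = 1"
    by (auto dest: integrable.intros has_bochner_integral_integral_eq)
  have w: "integrable lborel (\<lambda>t. B * S' t)" by (rule integrable_mult_right[OF Si])
  have bnd: "cmod (complex_of_real (S' t) * A y) \<le> B * S' t" for t y
    using mult_left_mono[OF A(2)[of y] S'(1)[of t]] S'(1)[of t] by (simp add: norm_mult mult.commute)
  have sub: "(\<integral>y. complex_of_real (real (Suc m) * S' (real (Suc m) * (y - c))) * A y \<partial>lborel)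
     = (\<integral>t. complex_of_real (S' t) * A (c + t / real (Suc m)) \<partial>lborel)"
    and subi: "integrable lborel (\<lambda>y. complex_of_real (real (Suc m) * S' (real (Suc m) * (y - c))) * A y)" for m
  proof -
    let ?M = "real (Suc m)"
    let ?k = "\<lambda>t. complex_of_real (S' t) * A (c + t / ?M)"
    have ki: "integrable lborel ?k"
      by (rule Bochner_Integration.integrable_bound[OF w]) (use bnd B0 S'(1) in \<open>auto simp: abs_mult\<close>)
    have e: "(\<lambda>y. complex_of_real (?M * S' (?M * (y - c))) * A y) = (\<lambda>y. ?M *\<^sub>R ?k (- ?M * c + ?M * y))"
    proof
      fix y
      have "- ?M * c + ?M * y = ?M * (y - c)" by (simp add: algebra_simps)
      moreover have "c + ?M * (y - c) / ?M = y" by simp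
      ultimately show "complex_of_real (?M * S' (?M * (y - c))) * A y = ?M *\<^sub>R ?k (- ?M * c + ?M * y)"
        by (simp only: scaleR_conv_of_real of_real_mult mult.assoc)
    qed
    show "integrable lborel (\<lambda>y. complex_of_real (?M * S' (?M * (y - c))) * A y)"
      unfolding e by (intro integrable_scaleR_right lborel_integrable_real_affine[OF ki]) simp
    show "(\<integral>y. complex_of_real (?M * S' (?M * (y - c))) * A y \<partial>lborel) = (\<integral>t. ?k t \<partial>lborel)"
      unfolding e by (subst lborel_integral_real_affine[of ?M ?k "- ?M * c"]) simp_all
  qed
  show "integrable lborel (\<lambda>y. complex_of_real (real (Suc m) * S' (real (Suc m) * (y - c))) * A y)" for m by (rule subi)
  have "(\<lambda>m. \<integral>t. complex_of_real (S' t) * A (c + t / real (Suc m)) \<partial>lborel) \<longlonglongrightarrow> (\<integral>t. complex_of_real (S' t) * A c \<partial>lborel)"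
  proof (rule integral_dominated_convergence[OF _ _ w])
    show "AE t in lborel. (\<lambda>m. complex_of_real (S' t) * A (c + t / real (Suc m))) \<longlonglongrightarrow> complex_of_real (S' t) * A c"
    proof (intro AE_I2 tendsto_mult_left)
      fix t
      have "(\<lambda>m. c + t * (1 / real (Suc m))) \<longlonglongrightarrow> c + t * 0" by (intro tendsto_intros LIMSEQ_Suc lim_1_over_n)
      then have "(\<lambda>m. c + t / real (Suc m)) \<longlonglongrightarrow> c" by simp
      then show "(\<lambda>m. A (c + t / real (Suc m))) \<longlonglongrightarrow> A c" by (rule isCont_tendsto_compose[OF A(1)])
    qed
    show "AE t in lborel. norm (complex_of_real (S' t) * A (c + t / real (Suc m))) \<le> B * S' t" for m
      using bnd by blast
  qed measurable
  also have "(\<integral>t. complex_of_real (S' t) * A c \<partial>lborel) = A c"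
    by (simp only: integral_mult_left_zero integral_complex_of_real SI) simp
  finally show "(\<lambda>m. \<integral>y. complex_of_real (real (Suc m) * S' (real (Suc m) * (y - c))) * A y \<partial>lborel) \<longlonglongrightarrow> A c"
    by (simp only: sub)
qed

text \<open>The tensor equation for \<open>b(y) = S(M (y - y1)) - S(M (y - y2))\<close> with a smooth step \<open>S\<close>, as \<open>M \<rightarrow> \<infinity>\<close>.\<close>

lemma slice_increment:
  fixes u :: "nat \<Rightarrow> real \<times> real \<Rightarrow> complex" and a :: "real \<Rightarrow> complex"
  assumes F: "F \<in> L2" and u: "\<And>k. k \<le> n \<Longrightarrow> u k \<in> L2"
    and weak: "distr_eq
        (distr_deriv (0, 1) (distr_scale (- \<i>) (distr_deriv (1, 0) (distr_of F))))
        (distr_of (\<lambda>(x, y). \<Sum>k\<le>n. u k (x, y) * complex_of_real y ^ k))"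
    and a: "smooth_line a" "\<And>x. (a has_vector_derivative a' x) (at x)" "\<And>x. \<bar>x\<bar> > L \<Longrightarrow> a x = 0"
    and A: "\<And>y. isCont (\<lambda>y. \<integral>x. F (x, y) * a' x \<partial>lborel) y" "\<And>y. cmod (\<integral>x. F (x, y) * a' x \<partial>lborel) \<le> B"
    and y12: "y1 < y2"
  defines "V \<equiv> \<lambda>y. \<integral>x. (\<Sum>k\<le>n. u k (x, y) * complex_of_real y ^ k) * a x \<partial>lborel"
  shows "integrable lborel (\<lambda>y. indicator {y1<..y2} y *\<^sub>R V y)"
    and "AE y in lborel. \<forall>k\<le>n. y \<in> {y1<..y2} \<longrightarrow> integrable lborel (\<lambda>x. u k (x, y) * a x)"
    and "- \<i> * ((\<integral>x. F (x, y1) * a' x \<partial>lborel) - (\<integral>x. F (x, y2) * a' x \<partial>lborel))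
       = (\<integral>y. indicator {y1<..y2} y *\<^sub>R V y \<partial>lborel)"
proof -
  define A where "A y = (\<integral>x. F (x, y) * a' x \<partial>lborel)" for y
  note A' = A[folded A_def]
  obtain S S' :: "real \<Rightarrow> real" where sm: "smooth_line (\<lambda>x. complex_of_real (S x))"
    and d: "\<And>x. (S has_real_derivative S' x) (at x)"
    and S: "\<And>x. x \<le> 0 \<Longrightarrow> S x = 0" "\<And>x. x \<ge> 1 \<Longrightarrow> S x = 1"
    and S01: "\<And>x. 0 \<le> S x" "\<And>x. S x \<le> 1"
    and S': "\<And>x. 0 \<le> S' x" "\<And>x. x \<notin> {0..1} \<Longrightarrow> S' x = 0"
    using smooth_step_exists by blast
  have "smooth_line (\<lambda>x. complex_of_real (S' x))"
    by (rule smooth_line_deriv[OF sm]) (rule has_vector_derivative_of_real[OF d])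
  then have "continuous_on UNIV (\<lambda>x. Re (complex_of_real (S' x)))"
    by (intro continuous_on_Re smooth_line_continuous)
  then have S'c: "continuous_on UNIV S'" by simp
  have Vm: "V \<in> borel_measurable borel"
  proof -
    define U where "U k = (if k \<le> n then u k else (\<lambda>_. 0))" for k
    have Um: "U k \<in> borel_measurable (borel \<Otimes>\<^sub>M borel)" for k
      using L2_measurable[OF u] by (simp add: U_def borel_prod)
    note [measurable] = Um borel_measurable_continuous_onI[OF smooth_line_continuous[OF a(1)]]
    have "V = (\<lambda>y. \<integral>x. (\<Sum>k\<le>n. U k (x, y) * complex_of_real y ^ k) * a x \<partial>lborel)"
      unfolding V_def U_def by (intro ext Bochner_Integration.integral_cong) auto
    then show ?thesis by simp
  qed
  note [measurable] = Vm
  \<comment> \<open>\<open>s c m\<close> rises from \<open>0\<close> to \<open>1\<close> between \<open>c\<close> and \<open>c + 1 / (m + 1)\<close>.\<close>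
  define s where "s c m y = S (real (Suc m) * (y - c))" for c m y
  define L' where "L' = max L (max \<bar>y1 - 1\<bar> \<bar>y2 + 2\<bar>)"
  have aL: "a x = 0" if "\<bar>x\<bar> > L'" for x using a(3) that by (simp add: L'_def)
  have s0: "s c m y = 0" if "y \<le> c" for c m y
    unfolding s_def using that by (intro S) (simp add: mult_nonneg_nonpos)
  have s1: "s c m y = 1" if "y \<ge> c + 1 / real (Suc m)" for c m y
  proof -
    have "real (Suc m) * (y - c) \<ge> real (Suc m) * (1 / real (Suc m))" using that by (intro mult_left_mono) auto
    then show ?thesis unfolding s_def by (intro S) simp
  qed
  have s1': "s c m y = 1" if "y \<ge> c + 1" for c m y
  proof -
    have "1 / real (Suc m) \<le> 1" by simp
    then show ?thesis using that by (intro s1) linarith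
  qed
  have s01: "0 \<le> s c m y" "s c m y \<le> 1" for c m y by (auto simp: s_def S01)
  define s' where "s' c m y = real (Suc m) * S' (real (Suc m) * (y - c))" for c m y
  have sd: "((\<lambda>y. s c m y) has_real_derivative s' c m y) (at y)" for c m y
  proof -
    have "((\<lambda>y. real (Suc m) * (y - c)) has_real_derivative real (Suc m)) (at y)"
      by (auto intro!: derivative_eq_intros)
    from DERIV_chain2[OF d this] show ?thesis unfolding s_def s'_def by (simp add: mult.commute)
  qed
  define b where "b c1 c2 m y = complex_of_real (s c1 m y) - complex_of_real (s c2 m y)" for c1 c2 m y
  define b' where "b' c1 c2 m y = complex_of_real (s' c1 m y) - complex_of_real (s' c2 m y)" for c1 c2 m y
  have b_smooth: "smooth_line (b c1 c2 m)" for c1 c2 m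
  proof -
    have "smooth_line (\<lambda>y. complex_of_real (S (real (Suc m) * y + - (real (Suc m) * c)))) " for c
      by (rule smooth_line_affine[OF sm])
    then have ss: "smooth_line (\<lambda>y. complex_of_real (s c m y))" for c by (simp add: s_def algebra_simps)
    have "smooth_line (\<lambda>y. complex_of_real (s c1 m y) + complex_of_real (-1) * complex_of_real (s c2 m y))"
      by (intro smooth_line_add smooth_line_mult smooth_line_const ss)
    then show ?thesis by (simp add: b_def[abs_def])
  qed
  have b_deriv: "(b c1 c2 m has_vector_derivative b' c1 c2 m y) (at y)" for c1 c2 m y
    unfolding b_def[abs_def] b'_def
    by (intro has_vector_derivative_diff has_vector_derivative_of_real sd)
  have b_supp: "b c1 c2 m y = 0" if "\<bar>y\<bar> > L'" "c1 \<in> {y1 - 1..y2 + 1}" "c2 \<in> {y1 - 1..y2 + 1}" for c1 c2 m y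
  proof -
    have "y < y1 - 1 \<or> y > y2 + 2" using that(1) unfolding L'_def by linarith
    then show ?thesis
    proof
      assume "y < y1 - 1"
      then show ?thesis using that(2,3) by (simp add: b_def s0)
    next
      assume "y > y2 + 2"
      then show ?thesis using that(2,3) by (simp add: b_def s1')
    qed
  qed
  note W = weak_equation_tensor[OF F u weak a(1,2) aL b_smooth b_deriv]
  \<comment> \<open>A test function equal to \<open>1\<close> on the whole interval provides integrability there.\<close>
  have b1: "b (y1 - 1) (y2 + 1) 0 y = 1" if "y \<in> {y1<..y2 + 1}" for y
    using that by (simp add: b_def s0 s1')
  have bs: "\<And>x. \<bar>x\<bar> > L' \<Longrightarrow> b (y1 - 1) (y2 + 1) 0 x = 0" using b_supp y12 by simp
  have Vi1: "integrable lborel (\<lambda>y. b (y1 - 1) (y2 + 1) 0 y * V y)"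
    unfolding V_def by (rule W(1)) (use bs in auto)
  have Vi: "integrable lborel (\<lambda>y. indicator {y1<..y2 + 1} y *\<^sub>R V y)"
  proof (rule Bochner_Integration.integrable_bound[OF Vi1])
    show "AE y in lborel. norm (indicator {y1<..y2 + 1} y *\<^sub>R V y) \<le> norm (b (y1 - 1) (y2 + 1) 0 y * V y)"
      using b1 by (auto simp: indicator_def)
  qed measurable
  show "integrable lborel (\<lambda>y. indicator {y1<..y2} y *\<^sub>R V y)"
    by (rule Bochner_Integration.integrable_bound[OF Vi]) (auto simp: indicator_def)
  have "AE y in lborel. \<forall>k\<le>n. b (y1 - 1) (y2 + 1) 0 y \<noteq> 0 \<longrightarrow> integrable lborel (\<lambda>x. u k (x, y) * a x)"
    by (rule W(2)) (use bs in auto)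
  then show "AE y in lborel. \<forall>k\<le>n. y \<in> {y1<..y2} \<longrightarrow> integrable lborel (\<lambda>x. u k (x, y) * a x)"
    by eventually_elim (use b1 in auto)
  have bs2: "\<And>x. \<bar>x\<bar> > L' \<Longrightarrow> b y1 y2 m x = 0" for m using b_supp y12 by simp
  have E: "- \<i> * (\<integral>y. b' y1 y2 m y * A y \<partial>lborel) = (\<integral>y. b y1 y2 m y * V y \<partial>lborel)" for m
    unfolding V_def A_def by (rule W(3)) (use bs2 in auto)
  note mt = mollifier_tendsto[OF d S S' S'c A', folded s'_def]
  have "(\<lambda>m. (\<integral>y. complex_of_real (s' y1 m y) * A y \<partial>lborel) - (\<integral>y. complex_of_real (s' y2 m y) * A y \<partial>lborel)) \<longlonglongrightarrow> A y1 - A y2"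
    by (intro tendsto_diff mt(1))
  then have l1: "(\<lambda>m. - \<i> * (\<integral>y. b' y1 y2 m y * A y \<partial>lborel)) \<longlonglongrightarrow> - \<i> * (A y1 - A y2)"
  proof -
    assume l: "(\<lambda>m. (\<integral>y. complex_of_real (s' y1 m y) * A y \<partial>lborel) - (\<integral>y. complex_of_real (s' y2 m y) * A y \<partial>lborel)) \<longlonglongrightarrow> A y1 - A y2"
    have "(\<integral>y. b' y1 y2 m y * A y \<partial>lborel) = (\<integral>y. complex_of_real (s' y1 m y) * A y \<partial>lborel) - (\<integral>y. complex_of_real (s' y2 m y) * A y \<partial>lborel)" for m
      unfolding b'_def left_diff_distrib by (rule Bochner_Integration.integral_diff[OF mt(2) mt(2)])
    then show ?thesis using tendsto_mult_left[OF l, of "- \<i>"] by simp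
  qed
  have l2: "(\<lambda>m. \<integral>y. b y1 y2 m y * V y \<partial>lborel) \<longlonglongrightarrow> (\<integral>y. indicator {y1<..y2} y *\<^sub>R V y \<partial>lborel)"
  proof (rule integral_dominated_convergence[where w="\<lambda>y. norm (indicator {y1<..y2 + 1} y *\<^sub>R V y)"])
    show "integrable lborel (\<lambda>y. norm (indicator {y1<..y2 + 1} y *\<^sub>R V y))" by (rule integrable_norm[OF Vi])
    show "(\<lambda>y. b y1 y2 m y * V y) \<in> borel_measurable lborel" for m
      using borel_measurable_continuous_onI[OF smooth_line_continuous[OF b_smooth[of y1 y2 m]]] by measurable
    have lim: "(\<lambda>m. s c m y) \<longlonglongrightarrow> (if y > c then 1 else 0)" for c y
    proof (cases "y > c")
      case True
      then obtain M where M: "1 / real (Suc M) < y - c" using nat_approx_posE[of "y - c"] by (auto simp: inverse_eq_divide)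
      have "s c m y = 1" if "m \<ge> M" for m
      proof (rule s1)
        have "1 / real (Suc m) \<le> 1 / real (Suc M)" using that by (simp add: frac_le)
        then show "y \<ge> c + 1 / real (Suc m)" using M by linarith
      qed
      then show ?thesis using True by (intro tendsto_eventually) (auto simp: eventually_sequentially)
    next
      case False
      then show ?thesis by (simp add: s0)
    qed
    show "AE y in lborel. (\<lambda>m. b y1 y2 m y * V y) \<longlonglongrightarrow> indicator {y1<..y2} y *\<^sub>R V y"
    proof (rule AE_I2)
      fix y
      have "(\<lambda>m. b y1 y2 m y * V y) \<longlonglongrightarrow> (complex_of_real (if y > y1 then 1 else 0) - complex_of_real (if y > y2 then 1 else 0)) * V y"
        unfolding b_def by (intro tendsto_intros tendsto_of_real lim)
      also have "(complex_of_real (if y > y1 then 1 else 0) - complex_of_real (if y > y2 then 1 else 0)) * V y = indicator {y1<..y2} y *\<^sub>R V y"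
        using y12 by (auto simp: indicator_def)
      finally show "(\<lambda>m. b y1 y2 m y * V y) \<longlonglongrightarrow> indicator {y1<..y2} y *\<^sub>R V y" .
    qed
    show "AE y in lborel. norm (b y1 y2 m y * V y) \<le> norm (indicator {y1<..y2 + 1} y *\<^sub>R V y)" for m
    proof (rule AE_I2)
      fix y
      show "norm (b y1 y2 m y * V y) \<le> norm (indicator {y1<..y2 + 1} y *\<^sub>R V y)"
      proof (cases "y \<in> {y1<..y2 + 1}")
        case True
        have "cmod (b y1 y2 m y) = \<bar>s y1 m y - s y2 m y\<bar>" unfolding b_def by (simp flip: of_real_diff)
        also have "\<dots> \<le> 1" using s01[of y1 m y] s01[of y2 m y] by linarith
        finally show ?thesis using True by (simp add: norm_mult mult_left_le_one_le)
      next
        case False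
        then have "b y1 y2 m y = 0" using y12 by (auto simp: b_def s0 s1')
        then show ?thesis by simp
      qed
    qed
  qed measurable
  have "- \<i> * (A y1 - A y2) = (\<integral>y. indicator {y1<..y2} y *\<^sub>R V y \<partial>lborel)"
    by (rule LIMSEQ_unique[OF l1]) (use l2 E in simp)
  then show "- \<i> * ((\<integral>x. F (x, y1) * a' x \<partial>lborel) - (\<integral>x. F (x, y2) * a' x \<partial>lborel))
       = (\<integral>y. indicator {y1<..y2} y *\<^sub>R V y \<partial>lborel)" by (simp only: A_def)
qed

section \<open>The frequency estimate\<close>

text \<open>Integrability is not needed, since the transform of a non-integrable function is \<open>0\<close> by convention.\<close>

lemma plancherel_le_measurable:
  assumes [measurable]: "f \<in> borel_measurable borel"
  shows "(\<integral>\<^sup>+\<xi>. ennreal ((cmod (ft f \<xi>))\<^sup>2) \<partial>lborel) \<le> ennreal (2 * pi) * (\<integral>\<^sup>+x. ennreal ((cmod (f x))\<^sup>2) \<partial>lborel)"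
proof (cases "integrable lborel f")
  case True
  then show ?thesis by (rule plancherel_le)
next
  case False
  have "ft f \<xi> = 0" for \<xi>
  proof -
    have "\<not> integrable lborel (\<lambda>x. exp (- \<i> * complex_of_real (\<xi> * x)) * f x)"
    proof
      assume i: "integrable lborel (\<lambda>x. exp (- \<i> * complex_of_real (\<xi> * x)) * f x)"
      have "integrable lborel f" by (rule Bochner_Integration.integrable_bound[OF i]) (auto simp: norm_mult)
      with False show False ..
    qed
    then show ?thesis unfolding ft_def by (rule not_integrable_integral_eq)
  qed
  then show ?thesis by simp
qed

lemma ft_slice_measurable:
  assumes g: "g \<in> borel_measurable (borel :: (real \<times> real) measure)"
  shows "(\<lambda>(\<xi>, y). ft (\<lambda>x. g (x, y)) \<xi>) \<in> borel_measurable (borel \<Otimes>\<^sub>M borel)"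
proof -
  have [measurable]: "g \<in> borel_measurable (borel \<Otimes>\<^sub>M borel)" using g by (simp add: borel_prod)
  show ?thesis unfolding ft_def split_beta' by measurable
qed

lemma plancherel_slices:
  fixes g f :: "real \<times> real \<Rightarrow> complex"
  assumes g [measurable]: "g \<in> borel_measurable borel" and f: "f \<in> L2" and c: "c \<ge> 0" "\<And>p. cmod (g p) \<le> c * cmod (f p)"
  shows "(\<integral>\<^sup>+\<xi>. \<integral>\<^sup>+y. ennreal ((cmod (ft (\<lambda>x. g (x, y)) \<xi>))\<^sup>2) \<partial>lborel \<partial>lborel) \<le> ennreal (2 * pi * c\<^sup>2 * (L2_norm f)\<^sup>2)"
proof -
  have [measurable]: "g \<in> borel_measurable (borel \<Otimes>\<^sub>M borel)" using g by (simp add: borel_prod)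
  note [measurable] = ft_slice_measurable[OF g]
  have "(\<integral>\<^sup>+\<xi>. \<integral>\<^sup>+y. ennreal ((cmod (ft (\<lambda>x. g (x, y)) \<xi>))\<^sup>2) \<partial>lborel \<partial>lborel)
     = (\<integral>\<^sup>+y. \<integral>\<^sup>+\<xi>. ennreal ((cmod (ft (\<lambda>x. g (x, y)) \<xi>))\<^sup>2) \<partial>lborel \<partial>lborel)"
    by (rule lborel_pair.Fubini'[symmetric]) measurable
  also have "\<dots> \<le> (\<integral>\<^sup>+y. ennreal (2 * pi) * (\<integral>\<^sup>+x. ennreal ((cmod (g (x, y)))\<^sup>2) \<partial>lborel) \<partial>lborel)"
    by (intro nn_integral_mono plancherel_le_measurable) measurable
  also have "\<dots> = ennreal (2 * pi) * (\<integral>\<^sup>+y. \<integral>\<^sup>+x. ennreal ((cmod (g (x, y)))\<^sup>2) \<partial>lborel \<partial>lborel)"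
    by (rule nn_integral_cmult) measurable
  also have "(\<integral>\<^sup>+y. \<integral>\<^sup>+x. ennreal ((cmod (g (x, y)))\<^sup>2) \<partial>lborel \<partial>lborel) = (\<integral>\<^sup>+p. ennreal ((cmod (g p))\<^sup>2) \<partial>lborel)"
    by (subst lborel_pair.nn_integral_snd) (simp_all add: lborel_prod)
  also have "\<dots> \<le> (\<integral>\<^sup>+p. ennreal (c\<^sup>2 * (cmod (f p))\<^sup>2) \<partial>lborel)"
  proof (intro nn_integral_mono ennreal_leI)
    fix p
    show "(cmod (g p))\<^sup>2 \<le> c\<^sup>2 * (cmod (f p))\<^sup>2"
      using power_mono[OF c(2)[of p] norm_ge_zero, of 2] by (simp add: power_mult_distrib)
  qed
  also have "\<dots> = ennreal (\<integral>p. c\<^sup>2 * (cmod (f p))\<^sup>2 \<partial>lborel)"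
    by (rule nn_integral_eq_integral) (auto intro!: integrable_mult_right L2_integrable f)
  also have "(\<integral>p. c\<^sup>2 * (cmod (f p))\<^sup>2 \<partial>lborel) = c\<^sup>2 * (L2_norm f)\<^sup>2"
    by (simp add: L2_norm_def)
  finally show ?thesis
    by (simp add: ennreal_mult' mult.assoc mult_left_mono flip: ennreal_mult')
qed

text \<open>The elementary one-dimensional estimate: a function that varies by at most \<open>\<integral>|V|\<close> is controlled
  at an end point by its mean square and by \<open>V\<close>.\<close>

lemma endpoint_estimate:
  fixes A V :: "real \<Rightarrow> complex" and v :: "nat \<Rightarrow> real \<Rightarrow> complex"
  assumes \<delta>: "\<delta> > 0" and [measurable]: "A \<in> borel_measurable borel" "V \<in> borel_measurable borel" "\<And>k. v k \<in> borel_measurable borel"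
    and Vi: "integrable lborel (\<lambda>y. indicator {0<..\<delta>} y *\<^sub>R V y)"
    and A: "\<And>y. 0 < y \<Longrightarrow> y \<le> \<delta> \<Longrightarrow> cmod (A 0) \<le> cmod (A y) + (\<integral>t. norm (indicator {0<..\<delta>} t *\<^sub>R V t) \<partial>lborel)"
    and V: "AE y in lborel. y \<in> {0<..\<delta>} \<longrightarrow> V y = (\<Sum>k\<le>n. complex_of_real y ^ k * v k y)"
  shows "ennreal (\<delta> * (cmod (A 0))\<^sup>2) \<le> 2 * (\<integral>\<^sup>+y. ennreal ((cmod (A y))\<^sup>2) \<partial>lborel)
     + (\<Sum>k\<le>n. ennreal (2 * (real n + 1) * (\<delta> ^ (k + 1))\<^sup>2) * (\<integral>\<^sup>+y. ennreal ((cmod (v k y))\<^sup>2) \<partial>lborel))"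
proof -
  let ?I = "indicator {0<..\<delta>} :: real \<Rightarrow> ennreal"
  define W where "W = (\<integral>t. norm (indicator {0<..\<delta>} t *\<^sub>R V t) \<partial>lborel)"
  have W0: "W \<ge> 0" by (simp add: W_def)
  have emI: "(\<integral>\<^sup>+y. ?I y \<partial>lborel) = ennreal \<delta>" using \<delta> by simp
  have Wn: "ennreal W = (\<integral>\<^sup>+t. ?I t * (?I t * ennreal (cmod (V t))) \<partial>lborel)"
  proof -
    have "ennreal W = (\<integral>\<^sup>+t. ennreal (norm (indicator {0<..\<delta>} t *\<^sub>R V t)) \<partial>lborel)"
      unfolding W_def by (rule nn_integral_eq_integral[OF integrable_norm[OF Vi], symmetric]) simp
    also have "\<dots> = (\<integral>\<^sup>+t. ?I t * (?I t * ennreal (cmod (V t))) \<partial>lborel)"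
      by (intro nn_integral_cong) (auto simp: indicator_def)
    finally show ?thesis .
  qed
  have "(ennreal W)\<^sup>2 \<le> (\<integral>\<^sup>+t. (?I t)\<^sup>2 \<partial>lborel) * (\<integral>\<^sup>+t. (?I t * ennreal (cmod (V t)))\<^sup>2 \<partial>lborel)"
    unfolding Wn by (rule Cauchy_Schwarz_nn_integral) measurable
  also have "(\<integral>\<^sup>+t. (?I t)\<^sup>2 \<partial>lborel) = ennreal \<delta>"
    unfolding emI[symmetric] by (intro nn_integral_cong) (auto simp: indicator_def)
  also have "(\<integral>\<^sup>+t. (?I t * ennreal (cmod (V t)))\<^sup>2 \<partial>lborel)
     \<le> (\<integral>\<^sup>+t. (\<Sum>k\<le>n. ennreal ((real n + 1) * (\<delta> ^ k)\<^sup>2) * ennreal ((cmod (v k t))\<^sup>2)) \<partial>lborel)"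
  proof (rule nn_integral_mono_AE)
    show "AE t in lborel. (?I t * ennreal (cmod (V t)))\<^sup>2 \<le> (\<Sum>k\<le>n. ennreal ((real n + 1) * (\<delta> ^ k)\<^sup>2) * ennreal ((cmod (v k t))\<^sup>2))"
      using V
    proof eventually_elim
      case (elim t)
      show ?case
      proof (cases "t \<in> {0<..\<delta>}")
        case True
        have "(cmod (V t))\<^sup>2 \<le> (\<Sum>k\<le>n. \<delta> ^ k * cmod (v k t))\<^sup>2"
        proof (rule power_mono)
          have "cmod (V t) \<le> (\<Sum>k\<le>n. cmod (complex_of_real t ^ k * v k t))"
            using elim True by (simp add: norm_sum)
          also have "\<dots> \<le> (\<Sum>k\<le>n. \<delta> ^ k * cmod (v k t))"
            using True by (intro sum_mono) (auto simp: norm_mult norm_power intro!: mult_right_mono power_mono)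
          finally show "cmod (V t) \<le> (\<Sum>k\<le>n. \<delta> ^ k * cmod (v k t))" .
        qed simp
        also have "\<dots> \<le> (\<Sum>k\<le>n. (\<delta> ^ k * cmod (v k t))\<^sup>2) * real (card {..n})"
          by (rule sum_squared_le_sum_of_squares)
        also have "\<dots> = (\<Sum>k\<le>n. (real n + 1) * (\<delta> ^ k)\<^sup>2 * (cmod (v k t))\<^sup>2)"
          unfolding sum_distrib_right by (intro sum.cong) (simp_all add: power_mult_distrib add.commute)
        finally have "ennreal ((cmod (V t))\<^sup>2) \<le> ennreal (\<Sum>k\<le>n. (real n + 1) * (\<delta> ^ k)\<^sup>2 * (cmod (v k t))\<^sup>2)" by (rule ennreal_leI)
        also have "\<dots> = (\<Sum>k\<le>n. ennreal ((real n + 1) * (\<delta> ^ k)\<^sup>2 * (cmod (v k t))\<^sup>2))"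
          by (rule sum_ennreal[symmetric]) auto
        also have "\<dots> = (\<Sum>k\<le>n. ennreal ((real n + 1) * (\<delta> ^ k)\<^sup>2) * ennreal ((cmod (v k t))\<^sup>2))"
          by (intro sum.cong refl ennreal_mult) auto
        finally show ?thesis using True by (simp add: ennreal_power)
      qed simp
    qed
  qed
  also have "\<dots> = (\<Sum>k\<le>n. ennreal ((real n + 1) * (\<delta> ^ k)\<^sup>2) * (\<integral>\<^sup>+t. ennreal ((cmod (v k t))\<^sup>2) \<partial>lborel))"
    by (subst nn_integral_sum) (auto intro!: sum.cong nn_integral_cmult)
  finally have W2: "(ennreal W)\<^sup>2 \<le> ennreal \<delta> * (\<Sum>k\<le>n. ennreal ((real n + 1) * (\<delta> ^ k)\<^sup>2) * (\<integral>\<^sup>+t. ennreal ((cmod (v k t))\<^sup>2) \<partial>lborel))"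
    by (simp add: mult_left_mono)
  have "ennreal (\<delta> * (cmod (A 0))\<^sup>2) = (\<integral>\<^sup>+y. ?I y * ennreal ((cmod (A 0))\<^sup>2) \<partial>lborel)"
    using \<delta> by (subst nn_integral_multc) (auto simp: ennreal_mult)
  also have "\<dots> \<le> (\<integral>\<^sup>+y. 2 * ennreal ((cmod (A y))\<^sup>2) + ?I y * (2 * (ennreal W)\<^sup>2) \<partial>lborel)"
  proof (rule nn_integral_mono)
    fix y
    show "?I y * ennreal ((cmod (A 0))\<^sup>2) \<le> 2 * ennreal ((cmod (A y))\<^sup>2) + ?I y * (2 * (ennreal W)\<^sup>2)"
    proof (cases "y \<in> {0<..\<delta>}")
      case True
      have "(cmod (A 0))\<^sup>2 \<le> (cmod (A y) + W)\<^sup>2"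
        using A[of y] True unfolding W_def by (intro power_mono) auto
      also have "\<dots> \<le> 2 * (cmod (A y))\<^sup>2 + 2 * W\<^sup>2"
        using sum_squares_bound[of "cmod (A y)" W] by (simp add: power2_sum)
      finally have "ennreal ((cmod (A 0))\<^sup>2) \<le> ennreal (2 * (cmod (A y))\<^sup>2 + 2 * W\<^sup>2)" by (rule ennreal_leI)
      also have "\<dots> = 2 * ennreal ((cmod (A y))\<^sup>2) + 2 * (ennreal W)\<^sup>2"
        by (subst ennreal_plus) (simp_all add: ennreal_mult' ennreal_power W0)
      finally show ?thesis using True by simp
    qed simp
  qed
  also have "\<dots> = 2 * (\<integral>\<^sup>+y. ennreal ((cmod (A y))\<^sup>2) \<partial>lborel) + ennreal \<delta> * (2 * (ennreal W)\<^sup>2)"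
    by (subst nn_integral_add) (auto simp: nn_integral_cmult nn_integral_multc emI)
  also have "\<dots> \<le> 2 * (\<integral>\<^sup>+y. ennreal ((cmod (A y))\<^sup>2) \<partial>lborel)
     + ennreal \<delta> * (2 * (ennreal \<delta> * (\<Sum>k\<le>n. ennreal ((real n + 1) * (\<delta> ^ k)\<^sup>2) * (\<integral>\<^sup>+t. ennreal ((cmod (v k t))\<^sup>2) \<partial>lborel))))"
    by (intro add_left_mono mult_left_mono W2) auto
  also have "ennreal \<delta> * (2 * (ennreal \<delta> * (\<Sum>k\<le>n. ennreal ((real n + 1) * (\<delta> ^ k)\<^sup>2) * (\<integral>\<^sup>+t. ennreal ((cmod (v k t))\<^sup>2) \<partial>lborel))))
     = (\<Sum>k\<le>n. ennreal (2 * (real n + 1) * (\<delta> ^ (k + 1))\<^sup>2) * (\<integral>\<^sup>+y. ennreal ((cmod (v k y))\<^sup>2) \<partial>lborel))"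
  proof -
    have "ennreal \<delta> * (2 * (ennreal \<delta> * (ennreal ((real n + 1) * (\<delta> ^ k)\<^sup>2) * X))) = ennreal (2 * (real n + 1) * (\<delta> ^ (k + 1))\<^sup>2) * X" for k X
    proof -
      have "2 * (real n + 1) * (\<delta> ^ (k + 1))\<^sup>2 = \<delta> * (2 * (\<delta> * ((real n + 1) * (\<delta> ^ k)\<^sup>2)))"
        by (simp add: power2_eq_square mult_ac)
      also have "ennreal \<dots> = ennreal \<delta> * (ennreal 2 * (ennreal \<delta> * ennreal ((real n + 1) * (\<delta> ^ k)\<^sup>2)))"
        using \<delta> by (simp only: ennreal_mult' less_imp_le zero_le_numeral)
      finally show ?thesis by (simp add: mult.assoc)
    qed
    then show ?thesis by (simp only: sum_distrib_left)
  qed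
  finally show ?thesis .
qed


text \<open>The endpoint estimate at a fixed frequency, for \<open>A(y) = P^(\<xi>, y) - i \<xi> Q^(\<xi>, y)\<close>, where \<open>Q\<close> is the cut-off kernel
  and \<open>P\<close> the error caused by differentiating the cutoff. This is the transform of \<open>F(\<cdot>, y)\<close> tested with the
  derivative of \<open>a(x) = \<theta>(x / m) exp(-i \<xi> x)\<close>.\<close>

lemma frequency_estimate_cutoff:
  fixes K :: "real \<times> real \<Rightarrow> complex" and u :: "nat \<Rightarrow> real \<times> real \<Rightarrow> complex" and \<theta> \<theta>' :: "real \<Rightarrow> real"
  assumes h: "h > 0" and K: "K \<in> L2" and Cb: "(\<lambda>z X. K (X, X + z)) \<in> Cb_L1" and u: "\<And>k. u k \<in> L2"
  defines "F \<equiv> rotated_kernel h K"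
  assumes weak: "distr_eq
        (distr_deriv (0, 1) (distr_scale (- \<i>) (distr_deriv (1, 0) (distr_of F))))
        (distr_of (\<lambda>(x, y). \<Sum>k\<le>n. u k (x, y) * complex_of_real y ^ k))"
    and \<theta>: "smooth_line (\<lambda>x. complex_of_real (\<theta> x))" "\<And>x. (\<theta> has_real_derivative \<theta>' x) (at x)"
      "\<And>x. \<bar>x\<bar> \<ge> 2 \<Longrightarrow> \<theta> x = 0" "\<And>x. \<bar>\<theta> x\<bar> \<le> 1" "\<And>x. \<bar>\<theta>' x\<bar> \<le> c" "\<theta>' \<in> borel_measurable borel"
    and m: "m \<ge> 1" and \<xi>: "\<bar>\<xi>\<bar> \<ge> 1"
  defines "Q \<equiv> \<lambda>p. F p * complex_of_real (\<theta> (fst p / m))"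
    and "P \<equiv> \<lambda>p. F p * complex_of_real (\<theta>' (fst p / m) / m)"
    and "w \<equiv> \<lambda>k p. u k p * complex_of_real (\<theta> (fst p / m))"
  shows "ennreal (\<bar>\<xi>\<bar> powr (1 / (real n + 1)) / \<xi>\<^sup>2 *
      (cmod (ft (\<lambda>x. P (x, 0)) \<xi> - \<i> * complex_of_real \<xi> * ft (\<lambda>x. Q (x, 0)) \<xi>))\<^sup>2)
    \<le> 4 * (\<integral>\<^sup>+y. ennreal ((cmod (ft (\<lambda>x. P (x, y)) \<xi>))\<^sup>2) \<partial>lborel)
      + 4 * (\<integral>\<^sup>+y. ennreal ((cmod (ft (\<lambda>x. Q (x, y)) \<xi>))\<^sup>2) \<partial>lborel)
      + (\<Sum>k\<le>n. ennreal (2 * (real n + 1)) * (\<integral>\<^sup>+y. ennreal ((cmod (ft (\<lambda>x. w k (x, y)) \<xi>))\<^sup>2) \<partial>lborel))"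
proof -
  have FL: "F \<in> L2" unfolding F_def by (rule rotated_kernel_L2[OF K h])
  have slice: "integrable lborel (\<lambda>x. F (x, y))" for y unfolding F_def by (rule rotated_kernel_slice[OF Cb])
  have \<theta>c: "continuous_on UNIV \<theta>"
    using \<theta>(2) by (intro continuous_at_imp_continuous_on ballI) (blast intro: DERIV_isCont)
  note [measurable] = borel_measurable_continuous_onI[OF \<theta>c] \<theta>(6)
  have bm [measurable]: "F \<in> borel_measurable (borel \<Otimes>\<^sub>M borel)" "u k \<in> borel_measurable (borel \<Otimes>\<^sub>M borel)" for k
    using L2_measurable[OF FL] L2_measurable[OF u] by (simp_all add: borel_prod)
  have bm' [measurable]: "F \<in> borel_measurable borel" "u k \<in> borel_measurable borel" for k
    using L2_measurable[OF FL] L2_measurable[OF u] by auto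
  have Qm: "Q \<in> borel_measurable borel" and Pm: "P \<in> borel_measurable borel" and wm: "w k \<in> borel_measurable borel" for k
    unfolding Q_def P_def w_def borel_prod[symmetric] by measurable
  note [measurable] = ft_slice_measurable[OF Qm] ft_slice_measurable[OF Pm] ft_slice_measurable[OF wm]
  let ?e = "\<lambda>x. exp (- \<i> * complex_of_real (\<xi> * x))"
  define a where "a x = complex_of_real (\<theta> (x / m)) * ?e x" for x
  define a' where "a' x = complex_of_real (\<theta> (x / m)) * (- \<i> * complex_of_real \<xi> * ?e x) + complex_of_real (\<theta>' (x / m) / m) * ?e x" for x
  have e_eq: "?e = (\<lambda>x. exp ((- \<i> * complex_of_real \<xi>) * complex_of_real x))" by (simp add: mult.assoc)
  have a_smooth: "smooth_line a"
  proof -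
    have "smooth_line (\<lambda>x. complex_of_real (\<theta> ((1 / m) * x + 0)))" by (rule smooth_line_affine[OF \<theta>(1)])
    then have "smooth_line (\<lambda>x. complex_of_real (\<theta> (x / m)))" by simp
    moreover have "smooth_line ?e" unfolding e_eq by (rule smooth_line_exp)
    ultimately show ?thesis unfolding a_def[abs_def] by (rule smooth_line_mult)
  qed
  have a_deriv: "(a has_vector_derivative a' x) (at x)" for x
  proof -
    have "((\<lambda>x. x / m) has_real_derivative 1 / m) (at x)" using m by (auto intro!: derivative_eq_intros)
    from DERIV_chain2[OF \<theta>(2) this] have "((\<lambda>x. \<theta> (x / m)) has_real_derivative \<theta>' (x / m) / m) (at x)" by simp
    then have d1: "((\<lambda>x. complex_of_real (\<theta> (x / m))) has_vector_derivative complex_of_real (\<theta>' (x / m) / m)) (at x)"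
      by (rule has_vector_derivative_of_real)
    have "((\<lambda>z. exp ((- \<i> * complex_of_real \<xi>) * z)) has_field_derivative (- \<i> * complex_of_real \<xi>) * exp ((- \<i> * complex_of_real \<xi>) * complex_of_real x)) (at (complex_of_real x))"
      by (auto intro!: derivative_eq_intros)
    from has_vector_derivative_real_field[OF this]
    have d2: "(?e has_vector_derivative (- \<i> * complex_of_real \<xi>) * ?e x) (at x)"
      by (simp add: mult.assoc)
    show ?thesis unfolding a_def[abs_def] a'_def by (rule has_vector_derivative_mult[OF d1 d2])
  qed
  have a_supp: "a x = 0" if "\<bar>x\<bar> > 2 * m" for x
  proof -
    have "2 \<le> \<bar>x / m\<bar>" using that m by (simp add: abs_divide le_divide_eq)
    then show ?thesis by (simp add: a_def \<theta>(3))
  qed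
  have a'c: "continuous_on UNIV a'" by (rule smooth_line_continuous[OF smooth_line_deriv[OF a_smooth a_deriv]])
  have "\<exists>C\<ge>0. \<forall>x. cmod (a' x) \<le> C"
    by (rule continuous_compact_support_bounded[OF a'c]) (rule deriv_zero_outside[OF a_deriv a_supp])
  then obtain Ca where Ca: "\<And>x. cmod (a' x) \<le> Ca" by blast
  define A where "A y = (\<integral>x. F (x, y) * a' x \<partial>lborel)" for y
  obtain B where B: "\<And>y. cmod (\<integral>x. F (x, y) * a' x \<partial>lborel) \<le> B"
    using rotated_kernel_slice_continuous(1)[OF Cb a'c Ca] unfolding F_def by blast
  have Acont: "isCont (\<lambda>y. \<integral>x. F (x, y) * a' x \<partial>lborel) y" for y
    unfolding F_def by (rule rotated_kernel_slice_continuous(2)[OF Cb a'c Ca])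
  have c0: "c \<ge> 0" using \<theta>(5)[of 0] by linarith
  have Qi: "integrable lborel (\<lambda>x. Q (x, y))" for y
  proof (rule Bochner_Integration.integrable_bound[OF slice[of y]])
    show "AE x in lborel. norm (Q (x, y)) \<le> norm (F (x, y))"
      using \<theta>(4) by (auto simp: Q_def norm_mult intro!: mult_right_le_one_le)
  qed (use Qm in measurable)
  have Pi: "integrable lborel (\<lambda>x. P (x, y))" for y
  proof (rule Bochner_Integration.integrable_bound[OF integrable_mult_right[OF slice[of y], of "complex_of_real c"]])
    have "\<bar>\<theta>' (x / m) / m\<bar> \<le> c" for x
    proof -
      have "\<bar>\<theta>' (x / m) / m\<bar> \<le> \<bar>\<theta>' (x / m)\<bar> / 1"
        unfolding abs_divide using m by (intro divide_left_mono) auto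
      then show ?thesis using \<theta>(5)[of "x / m"] by simp
    qed
    then have "cmod (F (x, y)) * \<bar>\<theta>' (x / m) / m\<bar> \<le> cmod (F (x, y)) * c" for x
      by (rule mult_left_mono) simp
    then have "norm (P (x, y)) \<le> norm (complex_of_real c * F (x, y))" for x
      using c0 by (simp only: P_def norm_mult norm_of_real fst_conv abs_of_nonneg mult.commute[of c])
    then show "AE x in lborel. norm (P (x, y)) \<le> norm (complex_of_real c * F (x, y))" by simp
  qed (use Pm in measurable)
  have A_eq: "A y = ft (\<lambda>x. P (x, y)) \<xi> - \<i> * complex_of_real \<xi> * ft (\<lambda>x. Q (x, y)) \<xi>" for y
  proof -
    have "A y = (\<integral>x. ?e x * P (x, y) - \<i> * complex_of_real \<xi> * (?e x * Q (x, y)) \<partial>lborel)"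
      unfolding A_def by (intro Bochner_Integration.integral_cong) (auto simp: a'_def P_def Q_def algebra_simps)
    also have "\<dots> = ft (\<lambda>x. P (x, y)) \<xi> - \<i> * complex_of_real \<xi> * ft (\<lambda>x. Q (x, y)) \<xi>"
      using ft_integrand_integrable[OF Pi[of y], of \<xi>] ft_integrand_integrable[OF Qi[of y], of \<xi>]
      unfolding ft_def by (subst Bochner_Integration.integral_diff) (auto intro!: integrable_mult_right)
    finally show ?thesis .
  qed
  define V where "V y = (\<integral>x. (\<Sum>k\<le>n. u k (x, y) * complex_of_real y ^ k) * a x \<partial>lborel)" for y
  note [measurable] = borel_measurable_continuous_onI[OF smooth_line_continuous[OF a_smooth]]
  have Vm [measurable]: "V \<in> borel_measurable borel" unfolding V_def by measurable
  have Am [measurable]: "A \<in> borel_measurable borel" unfolding A_eq[abs_def] by measurable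
  \<comment> \<open>With this length both \<open>\<xi>\<^sup>2 \<integral>|Q^|\<^sup>2\<close> and \<open>\<delta>\<^sup>2\<^sup>k\<^sup>+\<^sup>2 \<integral>|u\<^sub>k^|\<^sup>2\<close> are bounded by \<open>\<xi>\<^sup>2\<close> times an integral, for every \<open>k \<le> n\<close>.\<close>
  define \<delta> where "\<delta> = \<bar>\<xi>\<bar> powr (1 / (real n + 1))"
  have \<delta>: "\<delta> > 0" using \<xi> by (simp add: \<delta>_def)
  have inc: "integrable lborel (\<lambda>y. indicator {0<..y2} y *\<^sub>R V y)"
      "AE y in lborel. \<forall>k\<le>n. y \<in> {0<..y2} \<longrightarrow> integrable lborel (\<lambda>x. u k (x, y) * a x)"
      "- \<i> * (A 0 - A y2) = (\<integral>y. indicator {0<..y2} y *\<^sub>R V y \<partial>lborel)" if "y2 > 0" for y2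
    using slice_increment[OF FL u weak a_smooth a_deriv a_supp Acont B that] unfolding V_def[symmetric] A_def[symmetric] by auto
  have est: "ennreal (\<delta> * (cmod (A 0))\<^sup>2) \<le> 2 * (\<integral>\<^sup>+y. ennreal ((cmod (A y))\<^sup>2) \<partial>lborel)
     + (\<Sum>k\<le>n. ennreal (2 * (real n + 1) * (\<delta> ^ (k + 1))\<^sup>2) * (\<integral>\<^sup>+y. ennreal ((cmod (ft (\<lambda>x. w k (x, y)) \<xi>))\<^sup>2) \<partial>lborel))"
  proof (rule endpoint_estimate[where v="\<lambda>k y. ft (\<lambda>x. w k (x, y)) \<xi>", OF \<delta> Am Vm _ inc(1)[OF \<delta>]])
    show "(\<lambda>y. ft (\<lambda>x. w k (x, y)) \<xi>) \<in> borel_measurable borel" for k by measurable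
    fix y assume y: "0 < y" "y \<le> \<delta>"
    have "cmod (A 0 - A y) = cmod (\<integral>t. indicator {0<..y} t *\<^sub>R V t \<partial>lborel)"
      unfolding inc(3)[OF y(1), symmetric] by (simp add: norm_mult)
    also have "\<dots> \<le> (\<integral>t. norm (indicator {0<..\<delta>} t *\<^sub>R V t) \<partial>lborel)"
      by (rule Bochner_Integration.integral_norm_bound_integral[OF inc(1)[OF y(1)] integrable_norm[OF inc(1)[OF \<delta>]]])
         (use y in \<open>auto simp: indicator_def\<close>)
    finally show "cmod (A 0) \<le> cmod (A y) + (\<integral>t. norm (indicator {0<..\<delta>} t *\<^sub>R V t) \<partial>lborel)"
      using norm_triangle_sub[of "A 0" "A y"] by linarith
  next
    show "AE y in lborel. y \<in> {0<..\<delta>} \<longrightarrow> V y = (\<Sum>k\<le>n. complex_of_real y ^ k * ft (\<lambda>x. w k (x, y)) \<xi>)"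
      using inc(2)[OF \<delta>]
    proof eventually_elim
      case (elim y)
      show ?case
      proof
        assume "y \<in> {0<..\<delta>}"
        with elim have i: "integrable lborel (\<lambda>x. u k (x, y) * a x)" if "k \<le> n" for k using that by blast
        have "V y = (\<integral>x. (\<Sum>k\<le>n. complex_of_real y ^ k * (u k (x, y) * a x)) \<partial>lborel)"
          unfolding V_def sum_distrib_right by (intro Bochner_Integration.integral_cong sum.cong) (simp_all add: mult_ac)
        also have "\<dots> = (\<Sum>k\<le>n. complex_of_real y ^ k * (\<integral>x. u k (x, y) * a x \<partial>lborel))"
          by (subst Bochner_Integration.integral_sum) (auto intro!: integrable_mult_right i)
        also have "(\<lambda>k. \<integral>x. u k (x, y) * a x \<partial>lborel) = (\<lambda>k. ft (\<lambda>x. w k (x, y)) \<xi>)"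
          unfolding ft_def w_def a_def by (intro ext Bochner_Integration.integral_cong) (auto simp: mult_ac)
        finally show "V y = (\<Sum>k\<le>n. complex_of_real y ^ k * ft (\<lambda>x. w k (x, y)) \<xi>)" by (simp add: fun_eq_iff)
      qed
    qed
  qed
  let ?IP = "\<integral>\<^sup>+y. ennreal ((cmod (ft (\<lambda>x. P (x, y)) \<xi>))\<^sup>2) \<partial>lborel"
  let ?IQ = "\<integral>\<^sup>+y. ennreal ((cmod (ft (\<lambda>x. Q (x, y)) \<xi>))\<^sup>2) \<partial>lborel"
  let ?Iw = "\<lambda>k. \<integral>\<^sup>+y. ennreal ((cmod (ft (\<lambda>x. w k (x, y)) \<xi>))\<^sup>2) \<partial>lborel"
  have \<xi>2: "1 \<le> \<xi>\<^sup>2" using power_mono[OF \<xi>, of 2] by simp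
  have "2 * (\<integral>\<^sup>+y. ennreal ((cmod (A y))\<^sup>2) \<partial>lborel) \<le> ennreal (\<xi>\<^sup>2) * (4 * ?IP + 4 * ?IQ)"
  proof -
    have "(\<integral>\<^sup>+y. ennreal ((cmod (A y))\<^sup>2) \<partial>lborel) \<le> (\<integral>\<^sup>+y. ennreal (2 * \<xi>\<^sup>2) * (ennreal ((cmod (ft (\<lambda>x. P (x, y)) \<xi>))\<^sup>2) + ennreal ((cmod (ft (\<lambda>x. Q (x, y)) \<xi>))\<^sup>2)) \<partial>lborel)"
    proof (rule nn_integral_mono)
      fix y
      let ?p = "cmod (ft (\<lambda>x. P (x, y)) \<xi>)" and ?q = "cmod (ft (\<lambda>x. Q (x, y)) \<xi>)"
      have "cmod (A y) \<le> ?p + \<bar>\<xi>\<bar> * ?q"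
        unfolding A_eq using norm_triangle_ineq4[of "ft (\<lambda>x. P (x, y)) \<xi>" "\<i> * complex_of_real \<xi> * ft (\<lambda>x. Q (x, y)) \<xi>"]
        by (simp add: norm_mult)
      then have "(cmod (A y))\<^sup>2 \<le> (?p + \<bar>\<xi>\<bar> * ?q)\<^sup>2" by (rule power_mono) simp
      also have "\<dots> \<le> 2 * ?p\<^sup>2 + 2 * (\<bar>\<xi>\<bar> * ?q)\<^sup>2"
        using sum_squares_bound[of ?p "\<bar>\<xi>\<bar> * ?q"] by (simp add: power2_sum)
      also have "\<dots> \<le> 2 * \<xi>\<^sup>2 * (?p\<^sup>2 + ?q\<^sup>2)"
        using mult_right_mono[OF \<xi>2, of "?p\<^sup>2"] by (simp add: power_mult_distrib algebra_simps)
      finally have "ennreal ((cmod (A y))\<^sup>2) \<le> ennreal (2 * \<xi>\<^sup>2 * (?p\<^sup>2 + ?q\<^sup>2))" by (rule ennreal_leI)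
      also have "\<dots> = ennreal (2 * \<xi>\<^sup>2) * (ennreal (?p\<^sup>2) + ennreal (?q\<^sup>2))"
        by (simp add: ennreal_mult' ennreal_plus[symmetric] del: ennreal_plus)
      finally show "ennreal ((cmod (A y))\<^sup>2) \<le> ennreal (2 * \<xi>\<^sup>2) * (ennreal (?p\<^sup>2) + ennreal (?q\<^sup>2))" .
    qed
    also have "\<dots> = ennreal (2 * \<xi>\<^sup>2) * (?IP + ?IQ)"
      by (subst nn_integral_cmult) (auto simp: nn_integral_add)
    finally have "2 * (\<integral>\<^sup>+y. ennreal ((cmod (A y))\<^sup>2) \<partial>lborel) \<le> 2 * (ennreal (2 * \<xi>\<^sup>2) * (?IP + ?IQ))" by (rule mult_left_mono) simp
    also have "\<dots> = ennreal (\<xi>\<^sup>2) * (4 * (?IP + ?IQ))"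
    proof -
      have e2: "ennreal (2 * \<xi>\<^sup>2) = 2 * ennreal (\<xi>\<^sup>2)" by (subst ennreal_mult') auto
      have "2 * (2 * e * Y) = e * (4 * Y)" for e Y :: ennreal
      proof -
        have "2 * (2 * e * Y) = (2 * 2) * (e * Y)" by (simp only: mult.assoc)
        also have "(2 :: ennreal) * 2 = 4" by simp
        finally show ?thesis by (simp only: mult.left_commute)
      qed
      then show ?thesis unfolding e2 .
    qed
    finally show ?thesis by (simp add: distrib_left)
  qed
  moreover have "(\<Sum>k\<le>n. ennreal (2 * (real n + 1) * (\<delta> ^ (k + 1))\<^sup>2) * ?Iw k) \<le> ennreal (\<xi>\<^sup>2) * (\<Sum>k\<le>n. ennreal (2 * (real n + 1)) * ?Iw k)"
    unfolding sum_distrib_left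
  proof (rule sum_mono)
    fix k assume k: "k \<in> {..n}"
    have "\<delta> ^ (k + 1) = \<bar>\<xi>\<bar> powr (1 / (real n + 1) * real (k + 1))"
      using \<xi> by (simp only: \<delta>_def powr_powr[symmetric] powr_realpow[symmetric] powr_gt_zero)
    also have "\<dots> \<le> \<bar>\<xi>\<bar> powr 1"
      using \<xi> k by (intro powr_mono) (auto simp: divide_le_eq)
    finally have "(\<delta> ^ (k + 1))\<^sup>2 \<le> \<bar>\<xi>\<bar>\<^sup>2" using \<xi> \<delta> by (intro power_mono) auto
    then have "ennreal (2 * (real n + 1) * (\<delta> ^ (k + 1))\<^sup>2) \<le> ennreal (\<xi>\<^sup>2 * (2 * (real n + 1)))"
      by (intro ennreal_leI) (simp add: mult.commute mult_left_mono)
    also have "\<dots> = ennreal (\<xi>\<^sup>2) * ennreal (2 * (real n + 1))" by (rule ennreal_mult') simp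
    finally show "ennreal (2 * (real n + 1) * (\<delta> ^ (k + 1))\<^sup>2) * ?Iw k \<le> ennreal (\<xi>\<^sup>2) * (ennreal (2 * (real n + 1)) * ?Iw k)"
      unfolding mult.assoc[symmetric] by (rule mult_right_mono) simp
  qed
  ultimately have "ennreal (\<delta> * (cmod (A 0))\<^sup>2) \<le> ennreal (\<xi>\<^sup>2) * (4 * ?IP + 4 * ?IQ) + ennreal (\<xi>\<^sup>2) * (\<Sum>k\<le>n. ennreal (2 * (real n + 1)) * ?Iw k)"
    using est by (meson add_mono order_trans)
  then have le: "ennreal (\<delta> * (cmod (A 0))\<^sup>2) \<le> ennreal (\<xi>\<^sup>2) * (4 * ?IP + 4 * ?IQ + (\<Sum>k\<le>n. ennreal (2 * (real n + 1)) * ?Iw k))"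
    by (simp only: distrib_left)
  have "ennreal (\<delta> / \<xi>\<^sup>2 * (cmod (A 0))\<^sup>2) = ennreal (1 / \<xi>\<^sup>2) * ennreal (\<delta> * (cmod (A 0))\<^sup>2)"
    by (subst ennreal_mult'[symmetric]) auto
  also have "\<dots> \<le> ennreal (1 / \<xi>\<^sup>2) * (ennreal (\<xi>\<^sup>2) * (4 * ?IP + 4 * ?IQ + (\<Sum>k\<le>n. ennreal (2 * (real n + 1)) * ?Iw k)))"
    by (rule mult_left_mono[OF le]) simp
  also have "\<dots> = (ennreal (1 / \<xi>\<^sup>2) * ennreal (\<xi>\<^sup>2)) * (4 * ?IP + 4 * ?IQ + (\<Sum>k\<le>n. ennreal (2 * (real n + 1)) * ?Iw k))"
    by (simp only: mult.assoc)
  also have "ennreal (1 / \<xi>\<^sup>2) * ennreal (\<xi>\<^sup>2) = 1" using \<xi>2 by (subst ennreal_mult'[symmetric]) auto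
  finally show ?thesis by (simp add: \<delta>_def A_eq)
qed

text \<open>As the cutoff scale tends to infinity, \<open>P^(\<xi>, 0) - i \<xi> Q^(\<xi>, 0)\<close> tends to \<open>- i \<xi> \<rho>^(\<xi>)\<close>, while the bounds by
  Plancherel's inequality are uniform in the scale.\<close>

lemma high_frequency_estimate:
  fixes K :: "real \<times> real \<Rightarrow> complex" and u :: "nat \<Rightarrow> real \<times> real \<Rightarrow> complex" and \<theta> \<theta>' :: "real \<Rightarrow> real"
  assumes h: "h > 0" and K: "K \<in> L2" and Cb: "(\<lambda>z X. K (X, X + z)) \<in> Cb_L1" and u: "\<And>k. u k \<in> L2"
  defines "F \<equiv> rotated_kernel h K"
  assumes weak: "distr_eq
        (distr_deriv (0, 1) (distr_scale (- \<i>) (distr_deriv (1, 0) (distr_of F))))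
        (distr_of (\<lambda>(x, y). \<Sum>k\<le>n. u k (x, y) * complex_of_real y ^ k))"
    and \<theta>: "smooth_line (\<lambda>x. complex_of_real (\<theta> x))" "\<And>x. (\<theta> has_real_derivative \<theta>' x) (at x)"
      "\<And>x. \<bar>x\<bar> \<ge> 2 \<Longrightarrow> \<theta> x = 0" "\<And>x. \<bar>\<theta> x\<bar> \<le> 1" "\<And>x. \<bar>\<theta>' x\<bar> \<le> c" "\<theta>' \<in> borel_measurable borel"
    and \<theta>1: "\<And>x. \<bar>x\<bar> \<le> 1 \<Longrightarrow> \<theta> x = 1"
  shows "(\<integral>\<^sup>+\<xi>. ennreal (indicator {\<xi>. \<bar>\<xi>\<bar> \<ge> 1} \<xi> * (\<bar>\<xi>\<bar> powr (1 / (real n + 1)) * (cmod (ft (\<lambda>x. F (x, 0)) \<xi>))\<^sup>2)) \<partial>lborel)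
     \<le> ennreal (2 * pi * ((4 * c\<^sup>2 + 4) * (L2_norm F)\<^sup>2 + 2 * (real n + 1) * (\<Sum>k\<le>n. (L2_norm (u k))\<^sup>2)))"
proof -
  have FL: "F \<in> L2" unfolding F_def by (rule rotated_kernel_L2[OF K h])
  have slice: "integrable lborel (\<lambda>x. F (x, 0))" unfolding F_def by (rule rotated_kernel_slice[OF Cb])
  have \<theta>c: "continuous_on UNIV \<theta>"
    using \<theta>(2) by (intro continuous_at_imp_continuous_on ballI) (blast intro: DERIV_isCont)
  note [measurable] = borel_measurable_continuous_onI[OF \<theta>c] \<theta>(6)
  have bm [measurable]: "F \<in> borel_measurable (borel \<Otimes>\<^sub>M borel)" "u k \<in> borel_measurable (borel \<Otimes>\<^sub>M borel)" for k
    using L2_measurable[OF FL] L2_measurable[OF u] by (simp_all add: borel_prod)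
  have c0: "c \<ge> 0" using \<theta>(5)[of 0] by linarith
  define m where "m M = real (Suc M)" for M
  have m1: "m M \<ge> 1" for M by (simp add: m_def)
  define Q where "Q M p = F p * complex_of_real (\<theta> (fst p / m M))" for M p
  define P where "P M p = F p * complex_of_real (\<theta>' (fst p / m M) / m M)" for M p
  define w where "w M k p = u k p * complex_of_real (\<theta> (fst p / m M))" for M k p
  have Qm: "Q M \<in> borel_measurable borel" and Pm: "P M \<in> borel_measurable borel" and wm: "w M k \<in> borel_measurable borel" for M k
    unfolding Q_def[abs_def] P_def[abs_def] w_def[abs_def] borel_prod[symmetric] by measurable
  note [measurable] = ft_slice_measurable[OF Qm] ft_slice_measurable[OF Pm] ft_slice_measurable[OF wm]
  have Ple: "\<bar>\<theta>' (x / m M) / m M\<bar> \<le> c / m M" for x M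
    unfolding abs_divide using \<theta>(5)[of "x / m M"] m1[of M] by (simp add: divide_right_mono)
  have cm: "c / m M \<le> c" for M
    using mult_left_mono[OF m1[of M] c0] m1[of M] by (simp add: divide_le_eq)
  define Z where "Z M \<xi> = ft (\<lambda>x. P M (x, 0)) \<xi> - \<i> * complex_of_real \<xi> * ft (\<lambda>x. Q M (x, 0)) \<xi>" for M \<xi>
  have sm [measurable]: "(\<lambda>x. P M (x, 0)) \<in> borel_measurable borel" "(\<lambda>x. Q M (x, 0)) \<in> borel_measurable borel" for M
    unfolding P_def Q_def fst_conv by measurable
  define I where "I = (indicator {\<xi>. \<bar>\<xi>\<bar> \<ge> 1} :: real \<Rightarrow> real)"
  have Im [measurable]: "I \<in> borel_measurable borel" unfolding I_def by measurable
  define T where "T M \<xi> = ennreal (I \<xi> * (\<bar>\<xi>\<bar> powr (1 / (real n + 1)) / \<xi>\<^sup>2 * (cmod (Z M \<xi>))\<^sup>2))" for M \<xi>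
  have Tm [measurable]: "T M \<in> borel_measurable borel" for M unfolding T_def Z_def by measurable
  let ?IP = "\<lambda>M \<xi>. \<integral>\<^sup>+y. ennreal ((cmod (ft (\<lambda>x. P M (x, y)) \<xi>))\<^sup>2) \<partial>lborel"
  let ?IQ = "\<lambda>M \<xi>. \<integral>\<^sup>+y. ennreal ((cmod (ft (\<lambda>x. Q M (x, y)) \<xi>))\<^sup>2) \<partial>lborel"
  let ?Iw = "\<lambda>M k \<xi>. \<integral>\<^sup>+y. ennreal ((cmod (ft (\<lambda>x. w M k (x, y)) \<xi>))\<^sup>2) \<partial>lborel"
  let ?bound = "2 * pi * ((4 * c\<^sup>2 + 4) * (L2_norm F)\<^sup>2 + 2 * (real n + 1) * (\<Sum>k\<le>n. (L2_norm (u k))\<^sup>2))"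
  have Tb: "(\<integral>\<^sup>+\<xi>. T M \<xi> \<partial>lborel) \<le> ennreal ?bound" for M
  proof -
    have "(\<integral>\<^sup>+\<xi>. T M \<xi> \<partial>lborel) \<le> (\<integral>\<^sup>+\<xi>. 4 * ?IP M \<xi> + 4 * ?IQ M \<xi> + (\<Sum>k\<le>n. ennreal (2 * (real n + 1)) * ?Iw M k \<xi>) \<partial>lborel)"
    proof (rule nn_integral_mono)
      fix \<xi>
      show "T M \<xi> \<le> 4 * ?IP M \<xi> + 4 * ?IQ M \<xi> + (\<Sum>k\<le>n. ennreal (2 * (real n + 1)) * ?Iw M k \<xi>)"
      proof (cases "\<bar>\<xi>\<bar> \<ge> 1")
        case True
        from frequency_estimate_cutoff[OF h K Cb u weak[unfolded F_def] \<theta> m1 True, of M]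
        show ?thesis using True by (simp add: T_def Z_def I_def P_def Q_def w_def F_def)
      next
        case False
        then show ?thesis by (simp add: T_def I_def)
      qed
    qed
    also have "\<dots> = 4 * (\<integral>\<^sup>+\<xi>. ?IP M \<xi> \<partial>lborel) + 4 * (\<integral>\<^sup>+\<xi>. ?IQ M \<xi> \<partial>lborel) + (\<Sum>k\<le>n. ennreal (2 * (real n + 1)) * (\<integral>\<^sup>+\<xi>. ?Iw M k \<xi> \<partial>lborel))"
      by (simp add: nn_integral_add nn_integral_cmult nn_integral_sum)
    also have "\<dots> \<le> 4 * ennreal (2 * pi * c\<^sup>2 * (L2_norm F)\<^sup>2) + 4 * ennreal (2 * pi * 1\<^sup>2 * (L2_norm F)\<^sup>2)
        + (\<Sum>k\<le>n. ennreal (2 * (real n + 1)) * ennreal (2 * pi * 1\<^sup>2 * (L2_norm (u k))\<^sup>2))"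
    proof (intro add_mono mult_left_mono sum_mono plancherel_slices FL u Pm Qm wm c0)
      fix p :: "real \<times> real"
      have "cmod (P M p) = cmod (F p) * \<bar>\<theta>' (fst p / m M) / m M\<bar>" by (simp only: P_def norm_mult norm_of_real)
      also have "\<dots> \<le> cmod (F p) * c" using Ple[of "fst p" M] cm[of M] by (intro mult_left_mono) auto
      finally show "cmod (P M p) \<le> c * cmod (F p)" by (simp add: mult.commute)
      show "cmod (Q M p) \<le> 1 * cmod (F p)"
        using mult_left_mono[OF \<theta>(4)[of "fst p / m M"], of "cmod (F p)"] by (simp add: Q_def norm_mult)
      show "cmod (w M k p) \<le> 1 * cmod (u k p)" for k
        using mult_left_mono[OF \<theta>(4)[of "fst p / m M"], of "cmod (u k p)"] by (simp add: w_def norm_mult)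
    qed auto
    also have "\<dots> = ennreal ?bound"
    proof -
      have s: "(\<Sum>k\<le>n. ennreal (2 * (real n + 1)) * ennreal (2 * pi * 1\<^sup>2 * (L2_norm (u k))\<^sup>2)) = ennreal (\<Sum>k\<le>n. 2 * (real n + 1) * (2 * pi * (L2_norm (u k))\<^sup>2))"
        by (subst sum_ennreal[symmetric]) (auto intro!: sum.cong simp: ennreal_mult')
      have 4: "4 * ennreal x = ennreal (4 * x)" for x by (subst ennreal_mult') auto
      have "?bound = 4 * (2 * pi * c\<^sup>2 * (L2_norm F)\<^sup>2) + 4 * (2 * pi * 1\<^sup>2 * (L2_norm F)\<^sup>2) + (\<Sum>k\<le>n. 2 * (real n + 1) * (2 * pi * (L2_norm (u k))\<^sup>2))"
        unfolding sum_distrib_left[symmetric] by (simp add: algebra_simps)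
      note e = this
      have add3: "ennreal x + ennreal y + ennreal z = ennreal (x + y + z)" if "x \<ge> 0" "y \<ge> 0" "z \<ge> 0" for x y z
        using that by simp
      show ?thesis unfolding s 4 e by (intro add3 mult_nonneg_nonneg sum_nonneg) auto
    qed
    finally show ?thesis .
  qed
  have lim: "(\<lambda>M. Z M \<xi>) \<longlonglongrightarrow> - \<i> * complex_of_real \<xi> * ft (\<lambda>x. F (x, 0)) \<xi>" for \<xi>
  proof -
    have minf: "(\<lambda>M. 1 / m M) \<longlonglongrightarrow> 0" unfolding m_def by (intro LIMSEQ_Suc lim_1_over_n)
    have "(\<lambda>M. ft (\<lambda>x. P M (x, 0)) \<xi>) \<longlonglongrightarrow> (\<integral>x. 0 \<partial>(lborel :: real measure))"
      unfolding ft_def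
    proof (rule integral_dominated_convergence[where w="\<lambda>x. c * cmod (F (x, 0))"])
      show "integrable lborel (\<lambda>x. c * cmod (F (x, 0)))" using slice by simp
      have b: "cmod (exp (- \<i> * complex_of_real (\<xi> * x)) * P M (x, 0)) \<le> c / m M * cmod (F (x, 0))" for x M
      proof -
        have "cmod (exp (- \<i> * complex_of_real (\<xi> * x)) * P M (x, 0)) = cmod (F (x, 0)) * \<bar>\<theta>' (x / m M) / m M\<bar>"
          by (simp add: norm_mult P_def norm_divide)
        also have "\<dots> \<le> cmod (F (x, 0)) * (c / m M)" by (intro mult_left_mono Ple) simp
        finally show ?thesis by (simp add: mult.commute)
      qed
      show "AE x in lborel. cmod (exp (- \<i> * complex_of_real (\<xi> * x)) * P M (x, 0)) \<le> c * cmod (F (x, 0))" for M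
        by (intro AE_I2 order_trans[OF b] mult_right_mono cm) simp
      show "AE x in lborel. (\<lambda>M. exp (- \<i> * complex_of_real (\<xi> * x)) * P M (x, 0)) \<longlonglongrightarrow> 0"
      proof (rule AE_I2)
        fix x
        have "(\<lambda>M. c * (1 / m M) * cmod (F (x, 0))) \<longlonglongrightarrow> c * 0 * cmod (F (x, 0))" by (intro tendsto_intros minf)
        then have "(\<lambda>M. c / m M * cmod (F (x, 0))) \<longlonglongrightarrow> 0" by simp
        then show "(\<lambda>M. exp (- \<i> * complex_of_real (\<xi> * x)) * P M (x, 0)) \<longlonglongrightarrow> 0"
          by (rule Lim_null_comparison[rotated]) (use b in \<open>blast intro: always_eventually\<close>)
      qed
    qed measurable
    moreover have "(\<lambda>M. ft (\<lambda>x. Q M (x, 0)) \<xi>) \<longlonglongrightarrow> ft (\<lambda>x. F (x, 0)) \<xi>"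
      unfolding ft_def
    proof (rule integral_dominated_convergence[where w="\<lambda>x. cmod (F (x, 0))"])
      show "integrable lborel (\<lambda>x. cmod (F (x, 0)))" using slice by simp
      show "AE x in lborel. cmod (exp (- \<i> * complex_of_real (\<xi> * x)) * Q M (x, 0)) \<le> cmod (F (x, 0))" for M
        using \<theta>(4) by (intro AE_I2) (simp add: Q_def norm_mult mult_right_le_one_le)
      show "AE x in lborel. (\<lambda>M. exp (- \<i> * complex_of_real (\<xi> * x)) * Q M (x, 0)) \<longlonglongrightarrow> exp (- \<i> * complex_of_real (\<xi> * x)) * F (x, 0)"
      proof (intro AE_I2 tendsto_eventually)
        fix x :: real
        show "eventually (\<lambda>M. exp (- \<i> * complex_of_real (\<xi> * x)) * Q M (x, 0) = exp (- \<i> * complex_of_real (\<xi> * x)) * F (x, 0)) sequentially"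
          using eventually_ge_at_top[of "nat \<lceil>\<bar>x\<bar>\<rceil>"]
        proof eventually_elim
          case (elim M)
          then have "\<bar>x\<bar> \<le> m M" unfolding m_def by linarith
          then have "\<bar>x / m M\<bar> \<le> 1" using m1[of M] by (simp add: abs_divide divide_le_eq)
          then show ?case by (simp add: Q_def \<theta>1)
        qed
      qed
    qed measurable
    ultimately have "(\<lambda>M. Z M \<xi>) \<longlonglongrightarrow> 0 - \<i> * complex_of_real \<xi> * ft (\<lambda>x. F (x, 0)) \<xi>"
      unfolding Z_def by (intro tendsto_diff tendsto_mult_left) simp_all
    then show ?thesis by simp
  qed
  have "(\<integral>\<^sup>+\<xi>. ennreal (I \<xi> * (\<bar>\<xi>\<bar> powr (1 / (real n + 1)) * (cmod (ft (\<lambda>x. F (x, 0)) \<xi>))\<^sup>2)) \<partial>lborel) = (\<integral>\<^sup>+\<xi>. liminf (\<lambda>M. T M \<xi>) \<partial>lborel)"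
  proof (rule nn_integral_cong)
    fix \<xi>
    have "(\<lambda>M. T M \<xi>) \<longlonglongrightarrow> ennreal (I \<xi> * (\<bar>\<xi>\<bar> powr (1 / (real n + 1)) / \<xi>\<^sup>2 * (cmod (- \<i> * complex_of_real \<xi> * ft (\<lambda>x. F (x, 0)) \<xi>))\<^sup>2))"
      unfolding T_def by (intro tendsto_ennrealI tendsto_mult_left tendsto_power tendsto_norm lim)
    also have "I \<xi> * (\<bar>\<xi>\<bar> powr (1 / (real n + 1)) / \<xi>\<^sup>2 * (cmod (- \<i> * complex_of_real \<xi> * ft (\<lambda>x. F (x, 0)) \<xi>))\<^sup>2)
      = I \<xi> * (\<bar>\<xi>\<bar> powr (1 / (real n + 1)) * (cmod (ft (\<lambda>x. F (x, 0)) \<xi>))\<^sup>2)"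
      by (cases "\<bar>\<xi>\<bar> \<ge> 1") (auto simp: I_def norm_mult power_mult_distrib)
    finally show "ennreal (I \<xi> * (\<bar>\<xi>\<bar> powr (1 / (real n + 1)) * (cmod (ft (\<lambda>x. F (x, 0)) \<xi>))\<^sup>2)) = liminf (\<lambda>M. T M \<xi>)"
      by (rule lim_imp_Liminf[symmetric, rotated]) simp
  qed
  also have "\<dots> \<le> liminf (\<lambda>M. \<integral>\<^sup>+\<xi>. T M \<xi> \<partial>lborel)" by (rule nn_integral_liminf) measurable
  also have "\<dots> \<le> liminf (\<lambda>M::nat. ennreal ?bound)" by (intro Liminf_mono always_eventually allI Tb)
  also have "\<dots> = ennreal ?bound" by (simp add: Liminf_const)
  finally show ?thesis unfolding I_def .
qed

section \<open>The Fourier--Plancherel transform of the density\<close>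

lemma minus_abs_l2: "f \<in> L2 \<Longrightarrow> g \<in> L2 \<Longrightarrow> abs_l2 f - abs_l2 g = abs_l2 (\<lambda>x. f x - g x)"
  by (rule minus_l2.abs_eq) (auto simp: L2_rel_def)

lemma ft_diff:
  "integrable lborel f \<Longrightarrow> integrable lborel g \<Longrightarrow> ft (\<lambda>x. f x - g x) \<xi> = ft f \<xi> - ft g \<xi>"
  unfolding ft_def right_diff_distrib
  by (rule Bochner_Integration.integral_diff) (rule ft_integrand_integrable, assumption)+

lemma fourier_L1_eq_ft: "fourier_L1 f = (\<lambda>\<xi>. complex_of_real (1 / sqrt (2 * pi)) * ft f \<xi>)"
  by (simp add: fourier_L1_def ft_def)

lemma cmod_fourier_L1_sq: "(cmod (fourier_L1 f \<xi>))\<^sup>2 = 1 / (2 * pi) * (cmod (ft f \<xi>))\<^sup>2"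
proof -
  have "(cmod (fourier_L1 f \<xi>))\<^sup>2 = (1 / sqrt (2 * pi))\<^sup>2 * (cmod (ft f \<xi>))\<^sup>2"
    unfolding fourier_L1_eq_ft norm_mult norm_of_real power_mult_distrib by simp
  then show ?thesis by (simp add: power_divide)
qed

lemma fourier_L1_plancherel_le:
  assumes f: "integrable lborel f" and f2: "f \<in> L2"
  shows "fourier_L1 f \<in> L2" and "L2_norm (fourier_L1 f) \<le> L2_norm f"
proof -
  note [measurable] = L2_measurable[OF f2]
  have m [measurable]: "fourier_L1 f \<in> borel_measurable borel" unfolding fourier_L1_eq_ft by measurable
  have "(\<integral>\<^sup>+\<xi>. ennreal ((cmod (fourier_L1 f \<xi>))\<^sup>2) \<partial>lborel) = ennreal (1 / (2 * pi)) * (\<integral>\<^sup>+\<xi>. ennreal ((cmod (ft f \<xi>))\<^sup>2) \<partial>lborel)"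
    unfolding cmod_fourier_L1_sq by (subst nn_integral_cmult[symmetric]) (auto simp: ennreal_mult'[symmetric])
  also have "\<dots> \<le> ennreal (1 / (2 * pi)) * (ennreal (2 * pi) * (\<integral>\<^sup>+x. ennreal ((cmod (f x))\<^sup>2) \<partial>lborel))"
    by (intro mult_left_mono plancherel_le f) simp
  also have "\<dots> = (ennreal (1 / (2 * pi)) * ennreal (2 * pi)) * (\<integral>\<^sup>+x. ennreal ((cmod (f x))\<^sup>2) \<partial>lborel)"
    by (simp only: mult.assoc)
  also have "ennreal (1 / (2 * pi)) * ennreal (2 * pi) = 1" by (subst ennreal_mult'[symmetric]) auto
  also have "(\<integral>\<^sup>+x. ennreal ((cmod (f x))\<^sup>2) \<partial>lborel) = ennreal (\<integral>x. (cmod (f x))\<^sup>2 \<partial>lborel)"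
    by (rule nn_integral_eq_integral[OF L2_integrable[OF f2]]) simp
  finally have le: "(\<integral>\<^sup>+\<xi>. ennreal ((cmod (fourier_L1 f \<xi>))\<^sup>2) \<partial>lborel) \<le> ennreal (\<integral>x. (cmod (f x))\<^sup>2 \<partial>lborel)" by simp
  then have i: "integrable lborel (\<lambda>\<xi>. (cmod (fourier_L1 f \<xi>))\<^sup>2)"
    by (intro integrableI_nonneg) (auto intro: le_less_trans)
  then show "fourier_L1 f \<in> L2" by (simp add: L2_def)
  have "ennreal (\<integral>\<xi>. (cmod (fourier_L1 f \<xi>))\<^sup>2 \<partial>lborel) \<le> ennreal (\<integral>x. (cmod (f x))\<^sup>2 \<partial>lborel)"
    using le nn_integral_eq_integral[OF i] by simp
  then show "L2_norm (fourier_L1 f) \<le> L2_norm f"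
    unfolding L2_norm_def by (intro real_sqrt_le_mono) (simp add: ennreal_le_iff)
qed

text \<open>Both the integral transform and the chosen limit are \<open>L\<^sup>2\<close> limits of the transforms of truncations.\<close>

lemma fourier_L2_eq_fourier_L1:
  assumes f: "integrable lborel f" and f2: "f \<in> L2"
  shows "fourier_L2 f \<in> L2" and "AE \<xi> in lborel. fourier_L2 f \<xi> = fourier_L1 f \<xi>"
proof -
  note [measurable] = L2_measurable[OF f2]
  define t where "t N x = indicator {- real N..real N} x * f x" for N x
  have [measurable]: "t N \<in> borel_measurable borel" for N unfolding t_def by measurable
  have ti: "integrable lborel (t N)" for N
    by (rule Bochner_Integration.integrable_bound[OF f]) (auto simp: t_def norm_mult indicator_def)
  have t2: "t N \<in> L2" for N
  proof -
    have "integrable lborel (\<lambda>x. (cmod (t N x))\<^sup>2)"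
      by (rule Bochner_Integration.integrable_bound[OF L2_integrable[OF f2]]) (auto simp: t_def norm_mult indicator_def)
    then show ?thesis by (simp add: L2_def)
  qed
  have diff: "(\<lambda>\<xi>. fourier_L1 (t N) \<xi> - fourier_L1 f \<xi>) = fourier_L1 (\<lambda>x. t N x - f x)" for N
    by (simp add: fourier_L1_eq_ft ft_diff ti f right_diff_distrib)
  have tail: "(\<lambda>N. L2_norm (\<lambda>x. t N x - f x)) \<longlonglongrightarrow> 0"
  proof -
    have "(\<lambda>N. \<integral>x. (cmod (t N x - f x))\<^sup>2 \<partial>lborel) \<longlonglongrightarrow> (\<integral>x. 0 \<partial>(lborel :: real measure))"
    proof (rule integral_dominated_convergence[OF _ _ L2_integrable[OF f2]])
      show "AE x in lborel. (\<lambda>N. (cmod (t N x - f x))\<^sup>2) \<longlonglongrightarrow> 0"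
      proof (intro AE_I2 tendsto_eventually)
        fix x :: real
        show "eventually (\<lambda>N. (cmod (t N x - f x))\<^sup>2 = 0) sequentially"
          using eventually_ge_at_top[of "nat \<lceil>\<bar>x\<bar>\<rceil>"]
        proof eventually_elim
          case (elim N)
          then have "\<bar>x\<bar> \<le> real N" by linarith
          then show ?case by (simp add: t_def indicator_def abs_le_iff)
        qed
      qed
      show "AE x in lborel. norm ((cmod (t N x - f x))\<^sup>2) \<le> (cmod (f x))\<^sup>2" for N
        by (auto simp: t_def indicator_def)
    qed measurable
    then have "(\<lambda>N. sqrt (\<integral>x. (cmod (t N x - f x))\<^sup>2 \<partial>lborel)) \<longlonglongrightarrow> sqrt 0"
      by (intro tendsto_real_sqrt) simp
    then show ?thesis by (simp add: L2_norm_def)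
  qed
  have is1: "is_fourier_L2 f (fourier_L1 f)"
  proof -
    have "(\<lambda>N. L2_norm (\<lambda>\<xi>. fourier_L1 (t N) \<xi> - fourier_L1 f \<xi>)) \<longlonglongrightarrow> 0"
    proof (rule Lim_null_comparison[OF _ tail])
      have "L2_norm (fourier_L1 (\<lambda>x. t N x - f x)) \<le> L2_norm (\<lambda>x. t N x - f x)" for N
        by (rule fourier_L1_plancherel_le(2)) (intro Bochner_Integration.integrable_diff ti f, rule L2_diff[OF t2 f2])
      then show "eventually (\<lambda>N. norm (L2_norm (\<lambda>\<xi>. fourier_L1 (t N) \<xi> - fourier_L1 f \<xi>)) \<le> L2_norm (\<lambda>x. t N x - f x)) sequentially"
        unfolding diff by (intro always_eventually allI) (simp add: L2_norm_def)
    qed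
    then show ?thesis
      using fourier_L1_plancherel_le(1)[OF f f2] by (simp add: is_fourier_L2_def t_def[abs_def])
  qed
  have is2: "is_fourier_L2 f (fourier_L2 f)" unfolding fourier_L2_def by (rule someI[of "is_fourier_L2 f", OF is1])
  show g2: "fourier_L2 f \<in> L2" using is2 by (simp add: is_fourier_L2_def)
  have g1: "fourier_L1 f \<in> L2" using is1 by (simp add: is_fourier_L2_def)
  have hN: "fourier_L1 (t N) \<in> L2" for N by (rule fourier_L1_plancherel_le(1)[OF ti t2])
  have l: "(\<lambda>N. norm (abs_l2 (fourier_L1 (t N)) - abs_l2 g)) \<longlonglongrightarrow> 0" if "is_fourier_L2 f g" for g
  proof -
    have "g \<in> L2" using that by (simp add: is_fourier_L2_def)
    moreover have "(\<lambda>N. L2_norm (\<lambda>\<xi>. fourier_L1 (t N) \<xi> - g \<xi>)) \<longlonglongrightarrow> 0"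
      using that by (simp add: is_fourier_L2_def t_def[abs_def])
    ultimately show ?thesis by (simp add: minus_abs_l2 hN norm_abs_l2 L2_diff)
  qed
  have "(\<lambda>N. abs_l2 (fourier_L1 (t N))) \<longlonglongrightarrow> abs_l2 (fourier_L2 f)" "(\<lambda>N. abs_l2 (fourier_L1 (t N))) \<longlonglongrightarrow> abs_l2 (fourier_L1 f)"
    using l[OF is2] l[OF is1] by (simp_all add: tendsto_norm_zero_iff LIM_zero_iff)
  then have "abs_l2 (fourier_L2 f) = abs_l2 (fourier_L1 f)" by (rule LIMSEQ_unique)
  then show "AE \<xi> in lborel. fourier_L2 f \<xi> = fourier_L1 f \<xi>" by (simp add: abs_l2_eq_iff g1 g2)
qed

lemma japanese_bracket_le:
  fixes \<xi> s :: real
  assumes "0 < s" "s \<le> 1 / 2"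
  shows "\<bar>\<xi>\<bar> \<ge> 1 \<Longrightarrow> (1 + \<xi>\<^sup>2) powr s \<le> 2 * \<bar>\<xi>\<bar> powr (2 * s)" and "\<bar>\<xi>\<bar> < 1 \<Longrightarrow> (1 + \<xi>\<^sup>2) powr s \<le> 2"
proof -
  have two: "(2::real) powr s \<le> 2" using powr_mono[of s 1 "2::real"] assms by simp
  show "(1 + \<xi>\<^sup>2) powr s \<le> 2 * \<bar>\<xi>\<bar> powr (2 * s)" if "\<bar>\<xi>\<bar> \<ge> 1"
  proof -
    have "1 \<le> \<xi>\<^sup>2" using power_mono[OF that, of 2] by simp
    then have "(1 + \<xi>\<^sup>2) powr s \<le> (2 * \<xi>\<^sup>2) powr s" using assms by (intro powr_mono2) auto
    also have "\<dots> = 2 powr s * (\<xi>\<^sup>2) powr s" by (simp add: powr_mult)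
    also have "(\<xi>\<^sup>2) powr s = \<bar>\<xi>\<bar> powr (2 * s)"
    proof -
      have "\<xi>\<^sup>2 = \<bar>\<xi>\<bar> powr 2" using that by (simp add: powr_numeral)
      then show ?thesis by (simp only: powr_powr)
    qed
    also have "2 powr s * \<bar>\<xi>\<bar> powr (2 * s) \<le> 2 * \<bar>\<xi>\<bar> powr (2 * s)" by (intro mult_right_mono two) simp
    finally show ?thesis .
  qed
  show "(1 + \<xi>\<^sup>2) powr s \<le> 2" if "\<bar>\<xi>\<bar> < 1"
  proof -
    have "\<xi>\<^sup>2 \<le> 1" using that by (simp add: abs_square_le_1)
    then have "(1 + \<xi>\<^sup>2) powr s \<le> 2 powr s" using assms by (intro powr_mono2) auto
    then show ?thesis using two by linarith
  qed
qed

text \<open>Low frequencies are controlled by a bound on the transform, high frequencies by a weighted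
  square integral.\<close>

lemma sobolev_from_frequency_bounds:
  fixes \<rho> :: "real \<Rightarrow> complex"
  assumes \<rho>: "integrable lborel \<rho>" and s: "0 < s" "s \<le> 1 / 2"
    and low: "\<And>\<xi>. cmod (ft \<rho> \<xi>) \<le> t" and "D \<ge> 0"
    and high: "(\<integral>\<^sup>+\<xi>. ennreal (indicator {\<xi>. \<bar>\<xi>\<bar> \<ge> 1} \<xi> * (\<bar>\<xi>\<bar> powr (2 * s) * (cmod (ft \<rho> \<xi>))\<^sup>2)) \<partial>lborel) \<le> ennreal (2 * pi * D)"
  shows "\<rho> \<in> sobolev_space s" and "(sobolev_norm s \<rho>)\<^sup>2 \<le> t\<^sup>2 + 2 * D"
proof -
  have [measurable]: "\<rho> \<in> borel_measurable borel" using borel_measurable_integrable[OF \<rho>] by simp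
  let ?hi = "\<lambda>\<xi>. indicator {\<xi>. \<bar>\<xi>\<bar> \<ge> 1} \<xi> * (\<bar>\<xi>\<bar> powr (2 * s) * (cmod (ft \<rho> \<xi>))\<^sup>2)"
  let ?lo = "\<lambda>\<xi>::real. indicator {-1<..<1} \<xi> * t\<^sup>2 :: real"
  have t2: "(cmod (ft \<rho> \<xi>))\<^sup>2 \<le> t\<^sup>2" for \<xi> by (intro power_mono low) simp
  have lo: "(\<integral>\<^sup>+\<xi>. ennreal (?lo \<xi>) \<partial>lborel) = ennreal (2 * t\<^sup>2)"
  proof -
    have "(\<integral>\<^sup>+\<xi>. ennreal (?lo \<xi>) \<partial>lborel) = (\<integral>\<^sup>+\<xi>. ennreal (t\<^sup>2) * indicator {-1<..<1} \<xi> \<partial>(lborel :: real measure))"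
      by (intro nn_integral_cong) (auto simp: indicator_def)
    also have "\<dots> = ennreal (t\<^sup>2) * ennreal 2" by (subst nn_integral_cmult_indicator) auto
    finally show ?thesis by (simp add: ennreal_mult' mult.commute)
  qed
  have bound: "(1 + \<xi>\<^sup>2) powr s * (cmod (ft \<rho> \<xi>))\<^sup>2 \<le> 2 * ?lo \<xi> + 2 * ?hi \<xi>" for \<xi>
  proof (cases "\<bar>\<xi>\<bar> \<ge> 1")
    case True
    have "(1 + \<xi>\<^sup>2) powr s * (cmod (ft \<rho> \<xi>))\<^sup>2 \<le> 2 * \<bar>\<xi>\<bar> powr (2 * s) * (cmod (ft \<rho> \<xi>))\<^sup>2"
      by (intro mult_right_mono japanese_bracket_le(1)[OF s True]) simp
    then show ?thesis using True by (auto simp: indicator_def)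
  next
    case False
    have "(1 + \<xi>\<^sup>2) powr s * (cmod (ft \<rho> \<xi>))\<^sup>2 \<le> 2 * t\<^sup>2"
      using False by (intro mult_mono japanese_bracket_le(2)[OF s] t2) auto
    then show ?thesis using False by (auto simp: indicator_def)
  qed
  have total: "(\<integral>\<^sup>+\<xi>. ennreal ((1 + \<xi>\<^sup>2) powr s * (cmod (ft \<rho> \<xi>))\<^sup>2) \<partial>lborel) \<le> ennreal (4 * t\<^sup>2 + 4 * pi * D)"
  proof -
    have "(\<integral>\<^sup>+\<xi>. ennreal ((1 + \<xi>\<^sup>2) powr s * (cmod (ft \<rho> \<xi>))\<^sup>2) \<partial>lborel) \<le> (\<integral>\<^sup>+\<xi>. 2 * ennreal (?lo \<xi>) + 2 * ennreal (?hi \<xi>) \<partial>lborel)"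
    proof (rule nn_integral_mono)
      fix \<xi>
      have "ennreal ((1 + \<xi>\<^sup>2) powr s * (cmod (ft \<rho> \<xi>))\<^sup>2) \<le> ennreal (2 * ?lo \<xi> + 2 * ?hi \<xi>)" by (rule ennreal_leI[OF bound])
      also have "\<dots> = 2 * ennreal (?lo \<xi>) + 2 * ennreal (?hi \<xi>)"
        by (subst ennreal_plus) (auto simp: ennreal_mult')
      finally show "ennreal ((1 + \<xi>\<^sup>2) powr s * (cmod (ft \<rho> \<xi>))\<^sup>2) \<le> 2 * ennreal (?lo \<xi>) + 2 * ennreal (?hi \<xi>)" .
    qed
    also have "\<dots> = 2 * (\<integral>\<^sup>+\<xi>. ennreal (?lo \<xi>) \<partial>lborel) + 2 * (\<integral>\<^sup>+\<xi>. ennreal (?hi \<xi>) \<partial>lborel)"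
      by (subst nn_integral_add) (auto simp: nn_integral_cmult)
    also have "\<dots> \<le> 2 * ennreal (2 * t\<^sup>2) + 2 * ennreal (2 * pi * D)"
      unfolding lo by (intro add_left_mono mult_left_mono high) simp
    also have "\<dots> = ennreal (2 * (2 * t\<^sup>2) + 2 * (2 * pi * D))"
    proof -
      have 2: "2 * ennreal x = ennreal (2 * x)" for x by (subst ennreal_mult') auto
      show ?thesis unfolding 2 by (rule ennreal_plus[symmetric]) (use \<open>D \<ge> 0\<close> in auto)
    qed
    finally show ?thesis by (simp add: mult.assoc)
  qed
  have wi: "integrable lborel (\<lambda>\<xi>. (1 + \<xi>\<^sup>2) powr s * (cmod (ft \<rho> \<xi>))\<^sup>2)"
    by (rule integrableI_nonneg) (use total in \<open>auto intro: le_less_trans\<close>)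
  have fi: "integrable lborel (\<lambda>\<xi>. (cmod (ft \<rho> \<xi>))\<^sup>2)"
  proof (rule Bochner_Integration.integrable_bound[OF wi])
    have "(cmod (ft \<rho> \<xi>))\<^sup>2 \<le> (1 + \<xi>\<^sup>2) powr s * (cmod (ft \<rho> \<xi>))\<^sup>2" for \<xi>
    proof -
      have "1 \<le> (1 + \<xi>\<^sup>2) powr s" using s by (intro ge_one_powr_ge_zero) auto
      from mult_right_mono[OF this, of "(cmod (ft \<rho> \<xi>))\<^sup>2"] show ?thesis by simp
    qed
    then show "AE \<xi> in lborel. norm ((cmod (ft \<rho> \<xi>))\<^sup>2) \<le> norm ((1 + \<xi>\<^sup>2) powr s * (cmod (ft \<rho> \<xi>))\<^sup>2)" by simp
  qed measurable
  have \<rho>2: "\<rho> \<in> L2" by (rule ft_L2_imp_L2[OF \<rho> fi])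
  note FT = fourier_L2_eq_fourier_L1[OF \<rho> \<rho>2]
  have FTm [measurable]: "fourier_L2 \<rho> \<in> borel_measurable borel" by (rule L2_measurable[OF FT(1)])
  have ae: "AE \<xi> in lborel. (1 + \<xi>\<^sup>2) powr s * (cmod (fourier_L2 \<rho> \<xi>))\<^sup>2 = 1 / (2 * pi) * ((1 + \<xi>\<^sup>2) powr s * (cmod (ft \<rho> \<xi>))\<^sup>2)"
    using FT(2) by eventually_elim (simp add: cmod_fourier_L1_sq)
  have i: "integrable lborel (\<lambda>\<xi>. 1 / (2 * pi) * ((1 + \<xi>\<^sup>2) powr s * (cmod (ft \<rho> \<xi>))\<^sup>2))"
    by (rule integrable_mult_right[OF wi])
  have "integrable lborel (\<lambda>\<xi>. (1 + \<xi>\<^sup>2) powr s * (cmod (fourier_L2 \<rho> \<xi>))\<^sup>2)"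
    using i by (subst integrable_cong_AE[OF _ _ ae]) auto
  then show "\<rho> \<in> sobolev_space s" using \<rho>2 by (simp add: sobolev_space_def)
  have "(sobolev_norm s \<rho>)\<^sup>2 = (\<integral>\<xi>. (1 + \<xi>\<^sup>2) powr s * (cmod (fourier_L2 \<rho> \<xi>))\<^sup>2 \<partial>lborel)"
    unfolding sobolev_norm_def by (intro real_sqrt_pow2 Bochner_Integration.integral_nonneg) simp
  also have "\<dots> = (\<integral>\<xi>. 1 / (2 * pi) * ((1 + \<xi>\<^sup>2) powr s * (cmod (ft \<rho> \<xi>))\<^sup>2) \<partial>lborel)"
    by (rule integral_cong_AE[OF _ _ ae]) auto
  also have "\<dots> = 1 / (2 * pi) * (\<integral>\<xi>. (1 + \<xi>\<^sup>2) powr s * (cmod (ft \<rho> \<xi>))\<^sup>2 \<partial>lborel)" by simp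
  also have "\<dots> \<le> 1 / (2 * pi) * (4 * t\<^sup>2 + 4 * pi * D)"
  proof (rule mult_left_mono)
    have "ennreal (\<integral>\<xi>. (1 + \<xi>\<^sup>2) powr s * (cmod (ft \<rho> \<xi>))\<^sup>2 \<partial>lborel) \<le> ennreal (4 * t\<^sup>2 + 4 * pi * D)"
      using total nn_integral_eq_integral[OF wi] by simp
    then show "(\<integral>\<xi>. (1 + \<xi>\<^sup>2) powr s * (cmod (ft \<rho> \<xi>))\<^sup>2 \<partial>lborel) \<le> 4 * t\<^sup>2 + 4 * pi * D"
      using \<open>D \<ge> 0\<close> by (subst (asm) ennreal_le_iff) auto
  qed simp
  also have "\<dots> = 2 / pi * t\<^sup>2 + 2 * D" by (simp add: field_simps)
  also have "\<dots> \<le> 1 * t\<^sup>2 + 2 * D"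
    using pi_gt3 by (intro add_right_mono mult_right_mono) auto
  finally show "(sobolev_norm s \<rho>)\<^sup>2 \<le> t\<^sup>2 + 2 * D" by simp
qed

theorem theorem3:
  fixes n :: nat
  shows "\<exists>C>0. \<forall>(h::real) (R :: L2_op) (K :: real \<times> real \<Rightarrow> complex)
             (u :: nat \<Rightarrow> real \<times> real \<Rightarrow> complex).
      h > 0 \<longrightarrow> self_adjoint R \<longrightarrow> trace_class R \<longrightarrow> is_continuous_kernel R K \<longrightarrow>
      (\<forall>k\<le>n. u k \<in> L2) \<longrightarrow>
      distr_eq
        (distr_deriv (0, 1) (distr_scale (- \<i>) (distr_deriv (1, 0) (distr_of (rotated_kernel h K)))))
        (distr_of (\<lambda>(x, y). \<Sum>k\<le>n. u k (x, y) * complex_of_real y ^ k)) \<longrightarrow>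
      (let s = 1 / (2 * (real n + 1)); \<rho> = (\<lambda>x. K (x, x)) in
        \<rho> \<in> sobolev_space s \<and>
        (sobolev_norm s \<rho>)\<^sup>2
          \<le> C * ((trace_norm R)\<^sup>2 + (L2_norm (rotated_kernel h K))\<^sup>2 + (\<Sum>k\<le>n. (L2_norm (u k))\<^sup>2)))"
proof -
  obtain \<theta> \<theta>' :: "real \<Rightarrow> real" and c :: real where \<theta>: "smooth_line (\<lambda>x. complex_of_real (\<theta> x))"
      "\<And>x. (\<theta> has_real_derivative \<theta>' x) (at x)" "\<And>x. \<bar>x\<bar> \<ge> 2 \<Longrightarrow> \<theta> x = 0"
      "\<And>x. \<bar>\<theta> x\<bar> \<le> 1" "\<And>x. \<bar>\<theta>' x\<bar> \<le> c" "\<theta>' \<in> borel_measurable borel"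
    and \<theta>1: "\<And>x. \<bar>x\<bar> \<le> 1 \<Longrightarrow> \<theta> x = 1"
    using smooth_cutoff_exists by blast
  define s where "s = 1 / (2 * (real n + 1))"
  have s: "0 < s" "s \<le> 1 / 2" "2 * s = 1 / (real n + 1)" by (auto simp: s_def field_simps)
  define C where "C = 1 + (8 * c\<^sup>2 + 8) + 4 * (real n + 1)"
  have main: "(\<lambda>x. K (x, x)) \<in> sobolev_space s \<and> (sobolev_norm s (\<lambda>x. K (x, x)))\<^sup>2
      \<le> C * ((trace_norm R)\<^sup>2 + (L2_norm (rotated_kernel h K))\<^sup>2 + (\<Sum>k\<le>n. (L2_norm (u k))\<^sup>2))"
    if h: "h > 0" and R: "self_adjoint R" and tc: "trace_class R" and ck: "is_continuous_kernel R K"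
      and u: "\<forall>k\<le>n. u k \<in> L2"
      and weak: "distr_eq
        (distr_deriv (0, 1) (distr_scale (- \<i>) (distr_deriv (1, 0) (distr_of (rotated_kernel h K)))))
        (distr_of (\<lambda>(x, y). \<Sum>k\<le>n. u k (x, y) * complex_of_real y ^ k))"
    for h :: real and R :: L2_op and K :: "real \<times> real \<Rightarrow> complex" and u :: "nat \<Rightarrow> real \<times> real \<Rightarrow> complex"
  proof -
    have K: "K \<in> L2" and Cb: "(\<lambda>z X. K (X, X + z)) \<in> Cb_L1"
      using ck by (auto simp: is_continuous_kernel_def is_kernel_def)
    define \<rho> where "\<rho> = (\<lambda>x. K (x, x))"
    have \<rho>_rot: "\<rho> = (\<lambda>x. rotated_kernel h K (x, 0))" by (simp add: \<rho>_def rotated_kernel_def)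
    have \<rho>: "integrable lborel \<rho>" unfolding \<rho>_rot by (rule rotated_kernel_slice[OF Cb])
    \<comment> \<open>Only \<open>u k\<close> with \<open>k \<le> n\<close> is assumed square integrable; the others do not matter and are set to \<open>0\<close>.\<close>
    define v where "v k = (if k \<le> n then u k else (\<lambda>_. 0))" for k
    have v: "v k \<in> L2" for k using u by (simp add: v_def L2_zero)
    have veq: "(\<lambda>(x, y). \<Sum>k\<le>n. u k (x, y) * complex_of_real y ^ k) = (\<lambda>(x, y). \<Sum>k\<le>n. v k (x, y) * complex_of_real y ^ k)"
      by (auto simp: v_def intro!: sum.cong)
    have vs: "(\<Sum>k\<le>n. (L2_norm (v k))\<^sup>2) = (\<Sum>k\<le>n. (L2_norm (u k))\<^sup>2)" by (simp add: v_def)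
    let ?t = "trace_norm R" and ?F = "(L2_norm (rotated_kernel h K))\<^sup>2" and ?U = "\<Sum>k\<le>n. (L2_norm (u k))\<^sup>2"
    define D where "D = (4 * c\<^sup>2 + 4) * ?F + 2 * (real n + 1) * ?U"
    have U0: "?U \<ge> 0" by (intro sum_nonneg) simp
    have D0: "D \<ge> 0" unfolding D_def using U0 by (intro add_nonneg_nonneg mult_nonneg_nonneg) auto
    have low: "cmod (ft \<rho> \<xi>) \<le> ?t" for \<xi>
      unfolding ft_def \<rho>_def by (rule diagonal_fourier_le_trace_norm[OF R tc ck])
    have high: "(\<integral>\<^sup>+\<xi>. ennreal (indicator {\<xi>. \<bar>\<xi>\<bar> \<ge> 1} \<xi> * (\<bar>\<xi>\<bar> powr (2 * s) * (cmod (ft \<rho> \<xi>))\<^sup>2)) \<partial>lborel) \<le> ennreal (2 * pi * D)"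
      using high_frequency_estimate[OF h K Cb v weak[unfolded veq] \<theta> \<theta>1] unfolding D_def s(3) \<rho>_rot vs .
    note S = sobolev_from_frequency_bounds[OF \<rho> s(1,2) low D0 high]
    have "?t\<^sup>2 + 2 * D = 1 * ?t\<^sup>2 + (8 * c\<^sup>2 + 8) * ?F + 4 * (real n + 1) * ?U" by (simp add: D_def algebra_simps)
    also have "\<dots> \<le> C * ?t\<^sup>2 + C * ?F + C * ?U"
      using U0 by (intro add_mono mult_right_mono) (auto simp: C_def)
    finally show ?thesis using S unfolding \<rho>_def by (simp add: distrib_left)
  qed
  have "C > 0" unfolding C_def by (intro add_pos_nonneg) auto
  then show ?thesis using main unfolding Let_def s_def by (intro exI[of _ C]) blast
qed

end
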